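(* Let $X=\{X(t)\}$ be the Markov chain on $\mathbb{R}^\ell$ defined by $X(t+1)=a(X(t),N(t+1))$, and suppose that assumptions (A1)--(A4) (listed in the context) hold. Let $v=e^V$ with $V$ the Lyapunov function of (A4). Then there is $t_1\ge 1$ such that: (i) For all $t\ge t_1$ and all $\eta\in(0,1]$: (a) $P^t$ maps $L_\infty^{v^\eta,k}$ to $L_\infty^{v^\eta,k}$ for $k=0,1$. (b) $Q^t_{i,j}$ maps $L_\infty^{v^\eta,0}$ to $L_\infty^{v^\eta,0}$ for all $1\le i,j\le\ell$. (c) $\nabla P^tf=Q^t\nabla f$ for every $f\in L_\infty^{v^\eta,1}$. (d) $P^t$ is separable in $L_\infty^{v^\eta,k}$ for $k=0$ and $k=1$. (ii) If $\eta\in(0,1)$, then results (a), (b) and (c) hold for all $t\ge1$.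
   Context: **Model.** The state space is $\mathsf{X}=\mathbb{R}^\ell$ with Borel $\sigma$-field $\mathcal{B}$. The chain is $X(t+1)=a(X(t),N(t+1))$, $t\ge 0$, where $\{N(t)\}$ are i.i.d. $\mathbb{R}^m$-valued random variables and $a:\mathbb{R}^\ell\times\mathbb{R}^m\to\mathbb{R}^\ell$ is continuous. $P^t(x,A)=\Pr\{X(t)\in A\mid X(0)=x\}$, $P=P^1$, $P^tf(x)=\int f(y)P^t(x,dy)=\mathsf{E}_x[f(X(t))]$. **Assumptions.** (A1) (i) The process $\{N(t)\}$ does not depend on the initial condition $X(0)$. (ii) $a$ is continuously differentiable in its first variable, with $\sup_{x,n}\|\nabla_x a(x,n)\|<\infty$ (any matrix norm), where $[\nabla_x a(x,n)]_{i,j}=\partial a_j(x,n)/\partial x_i$. (A2) For some $t_0\ge1$ there is a continuously differentiable function $p_{t_0}$ on $\mathsf{X}\times\mathsf{X}$ with $P^{t_0}(x,A)=\int_A p_{t_0}(x,y)\,dy$ for all $x\in\mathsf{X}$, $A\in\mathcal{B}$. (A3) There is a state $x_0\in\mathsf{X}$ such that for any $x\in\mathsf{X}$ and any open set $O$ containing $x_0$, $P^t(x,O)>0$ for all $t\ge0$ sufficiently large. (A4) There are functions $V:\mathsf{X}\to(0,\infty)$ and $W:\mathsf{X}\to[1,\infty)$, both continuously differentiable with compact sublevel sets $\{x: F(x)\le r\}$ ($F=V,W$, $r\ge 0$), a compact set $C\subset\mathsf{X}$ and constants $\delta>0$, $b<\infty$ such that (DV3) holds: $\log(Pe^V)-V\le-\delta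 W+b\,\mathbb{I}_C$ on $\mathsf{X}$. **Spaces.** For a continuous $w:\mathsf{X}\to[1,\infty)$ (such as $w=v^\eta=e^{\eta V}$): $\|f\|_w=\sup_x|f(x)|/w(x)$; $L_\infty^w=\{f \text{ measurable}:\|f\|_w<\infty\}$; $L_\infty^{w,0}=\{f\in L_\infty^w: f\text{ continuous}\}$ with norm $\|\cdot\|_{w,0}=\|\cdot\|_w$; $L_\infty^{w,1}$ is the space of $f:\mathsf X\to\mathbb{R}$ such that $f,\partial_1f,\dots,\partial_\ell f$ exist and all belong to $L_\infty^{w,0}$, with norm $\|f\|_{w,1}=\max\{\|f\|_w,\|\partial_1f\|_w,\dots,\|\partial_\ell f\|_w\}$. For a linear operator $Z$ on $L_\infty^{w,k}$, $|||Z|||_{w,k}=\sup\{\|Zf\|_{w,k}/\|f\|_{w,k}:f\in L_\infty^{w,k},\ \|f\|_{w,k}\neq0\}$. $\mathcal{M}_1^w$ is the space of signed measures $\mu$ on $(\mathsf X,\mathcal B)$ with $\|\mu\|_w=\sup\{|\mu(h)|/\|h\|_w: h\in L_\infty^w, \|h\|_w\ne0\}<\infty$. **Separability.** A linear operator $T$ on $L_\infty^{w,k}$ has finite rank if $T=\sum_{i,j=1}^Nm_{ij}\,s_i\otimes\nu_j$ with $N<\infty$, $s_i\in L_\infty^{w,k}$, $\nu_j\in\mathcal{M}_1^w$ and constants $m_{ij}$, where $[s\otimes\nu](x,dy)=s(x)\nu(dy)$. A linear operator $\widehat P$ on $L_\infty^{w,k}$ is separable in $L_\infty^{w,k}$ if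 for each $\varepsilon>0$ there is a finite-rank $T$ with $|||\widehat P-T|||_{w,k}\le\varepsilon$. **Sensitivity process and $Q^t$.** $\mathcal{S}(t)$ is the $\ell\times\ell$ matrix $\mathcal{S}_{i,j}(t)=\partial X_i(t)/\partial X_j(0)$; equivalently $\mathcal{S}(0)=I$, $\mathcal{S}(t+1)=\mathcal{A}(t+1)\mathcal{S}(t)$ with $\mathcal{A}^{T}(t)=\nabla_xa(X(t-1),N(t))$. For $g:\mathsf{X}\to\mathbb{R}^\ell$ measurable, $Q^tg(x)=\mathsf{E}_x[\mathcal{S}^{T}(t)g(X(t))]$ for $t\ge1$. $Q^t_{i,j}$ is the $(i,j)$ component of $Q^t$, acting on scalar functions: $Q^t_{i,j}f(x)=\mathsf{E}_x[\mathcal{S}_{j,i}(t)f(X(t))]$, so that $(Q^tg)_i=\sum_jQ^t_{i,j}g_j$. *)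

theory Defs
  imports "HOL-Probability.Probability"
begin

section \<open>Differentiability\<close>

definition continuously_differentiable ::
  "('a::real_normed_vector \<Rightarrow> 'b::real_normed_vector) \<Rightarrow> bool" where
  "continuously_differentiable f \<longleftrightarrow>
     (\<exists>f'. (\<forall>x. (f has_derivative blinfun_apply (f' x)) (at x)) \<and> continuous_on UNIV f')"

definition has_partial :: "'l \<Rightarrow> (real^'l \<Rightarrow> real) \<Rightarrow> real^'l \<Rightarrow> bool" where
  "has_partial i f x \<longleftrightarrow> (\<lambda>s. f (x + s *\<^sub>R axis i 1)) differentiable (at 0)"

definition partial :: "'l \<Rightarrow> (real^'l \<Rightarrow> real) \<Rightarrow> real^'l \<Rightarrow> real" where
  "partial i f x = deriv (\<lambda>s. f (x + s *\<^sub>R axis i 1)) 0"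

definition grad :: "(real^'l \<Rightarrow> real) \<Rightarrow> real^'l \<Rightarrow> real^'l" where
  "grad f x = (\<chi> i. partial i f x)"


section \<open>The chain, its transition kernel, and the sensitivity process\<close>

text \<open>
  \<open>chain a N x t\<close> is \<open>X(t)\<close> started at \<open>X(0) = x\<close>.  One and the same noise sequence \<open>N\<close> drives
  the chain from every initial state: this is the requirement that the noise does not depend on
  the initial condition.  \<open>N 0\<close> is never used.
\<close>

primrec chain :: "(real^'l \<Rightarrow> real^'m \<Rightarrow> real^'l) \<Rightarrow> (nat \<Rightarrow> 'w \<Rightarrow> real^'m) \<Rightarrow>
    real^'l \<Rightarrow> nat \<Rightarrow> 'w \<Rightarrow> real^'l" where
  "chain a N x 0 \<omega> = x"
| "chain a N x (Suc t) \<omega> = a (chain a N x t \<omega>) (N (Suc t) \<omega>)"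

definition iid_noise :: "'w measure \<Rightarrow> (nat \<Rightarrow> 'w \<Rightarrow> real^'m) \<Rightarrow> bool" where
  "iid_noise M N \<longleftrightarrow> prob_space.indep_vars M (\<lambda>_. borel) N {1..} \<and>
     (\<forall>t\<ge>1. distr M borel (N t) = distr M borel (N 1))"

definition kernel :: "'w measure \<Rightarrow> (real^'l \<Rightarrow> real^'m \<Rightarrow> real^'l) \<Rightarrow> (nat \<Rightarrow> 'w \<Rightarrow> real^'m) \<Rightarrow>
    nat \<Rightarrow> real^'l \<Rightarrow> (real^'l) measure" where
  "kernel M a N t x = distr M borel (chain a N x t)"

definition P_op :: "'w measure \<Rightarrow> (real^'l \<Rightarrow> real^'m \<Rightarrow> real^'l) \<Rightarrow> (nat \<Rightarrow> 'w \<Rightarrow> real^'m) \<Rightarrow>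
    nat \<Rightarrow> (real^'l \<Rightarrow> real) \<Rightarrow> real^'l \<Rightarrow> real" where
  "P_op M a N t f x = (\<integral>y. f y \<partial>kernel M a N t x)"

text \<open>\<open>nabla_x a x n $ i $ j\<close> is the derivative of \<open>a\<^sub>j(x,n)\<close> with respect to \<open>x\<^sub>i\<close>,
  the transpose of the Jacobian.\<close>

definition nabla_x :: "(real^'l \<Rightarrow> real^'m \<Rightarrow> real^'l) \<Rightarrow> real^'l \<Rightarrow> real^'m \<Rightarrow> real^'l^'l" where
  "nabla_x a x n = (\<chi> i j. partial i (\<lambda>y. a y n $ j) x)"

definition sensitivity :: "(real^'l \<Rightarrow> real^'m \<Rightarrow> real^'l) \<Rightarrow> (nat \<Rightarrow> 'w \<Rightarrow> real^'m) \<Rightarrow>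
    real^'l \<Rightarrow> nat \<Rightarrow> 'w \<Rightarrow> real^'l^'l" where
  "sensitivity a N x t \<omega> = (\<chi> i j. partial j (\<lambda>y. chain a N y t \<omega> $ i) x)"

definition Q_op :: "'w measure \<Rightarrow> (real^'l \<Rightarrow> real^'m \<Rightarrow> real^'l) \<Rightarrow> (nat \<Rightarrow> 'w \<Rightarrow> real^'m) \<Rightarrow>
    nat \<Rightarrow> (real^'l \<Rightarrow> real^'l) \<Rightarrow> real^'l \<Rightarrow> real^'l" where
  "Q_op M a N t g x =
     (\<integral>\<omega>. transpose (sensitivity a N x t \<omega>) *v g (chain a N x t \<omega>) \<partial>M)"

definition Q_comp :: "'w measure \<Rightarrow> (real^'l \<Rightarrow> real^'m \<Rightarrow> real^'l) \<Rightarrow> (nat \<Rightarrow> 'w \<Rightarrow> real^'m) \<Rightarrow>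
    nat \<Rightarrow> 'l \<Rightarrow> 'l \<Rightarrow> (real^'l \<Rightarrow> real) \<Rightarrow> real^'l \<Rightarrow> real" where
  "Q_comp M a N t i j f x =
     (\<integral>\<omega>. sensitivity a N x t \<omega> $ j $ i * f (chain a N x t \<omega>) \<partial>M)"


section \<open>Standing assumptions\<close>

definition smooth_dynamics :: "(real^'l \<Rightarrow> real^'m \<Rightarrow> real^'l) \<Rightarrow> bool" where
  "smooth_dynamics a \<longleftrightarrow> (\<forall>n. continuously_differentiable (\<lambda>x. a x n)) \<and>
     (\<exists>K. \<forall>x n. norm (nabla_x a x n) \<le> K)"

definition smooth_density :: "'w measure \<Rightarrow> (real^'l \<Rightarrow> real^'m \<Rightarrow> real^'l) \<Rightarrow>
    (nat \<Rightarrow> 'w \<Rightarrow> real^'m) \<Rightarrow> bool" where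
  "smooth_density M a N \<longleftrightarrow>
     (\<exists>t0\<ge>1. \<exists>p :: (real^'l) \<times> (real^'l) \<Rightarrow> real. continuously_differentiable p \<and>
        (\<forall>x. \<forall>A\<in>sets borel. set_integrable lborel A (\<lambda>y. p (x, y)) \<and>
           measure (kernel M a N t0 x) A = (LINT y:A|lborel. p (x, y))))"

definition reachable_state :: "'w measure \<Rightarrow> (real^'l \<Rightarrow> real^'m \<Rightarrow> real^'l) \<Rightarrow>
    (nat \<Rightarrow> 'w \<Rightarrow> real^'m) \<Rightarrow> bool" where
  "reachable_state M a N \<longleftrightarrow>
     (\<exists>x0. \<forall>x. \<forall>U. open U \<and> x0 \<in> U \<longrightarrow> (\<forall>\<^sub>F t in sequentially. measure (kernel M a N t x) U > 0))"

text \<open>The integrability clause makes the finiteness of \<open>P e\<^sup>V\<close>, implicit in the drift inequality,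
  explicit; the Bochner integral of a non-integrable function would be 0.\<close>

definition drift_DV3 :: "'w measure \<Rightarrow> (real^'l \<Rightarrow> real^'m \<Rightarrow> real^'l) \<Rightarrow> (nat \<Rightarrow> 'w \<Rightarrow> real^'m) \<Rightarrow>
    (real^'l \<Rightarrow> real) \<Rightarrow> (real^'l \<Rightarrow> real) \<Rightarrow> (real^'l) set \<Rightarrow> real \<Rightarrow> real \<Rightarrow> bool" where
  "drift_DV3 M a N V W C \<delta> b \<longleftrightarrow>
     (\<forall>x. integrable (kernel M a N 1 x) (\<lambda>y. exp (V y)) \<and>
        ln (P_op M a N 1 (\<lambda>y. exp (V y)) x) - V x \<le> - \<delta> * W x + b * indicator C x)"

definition lyapunov :: "'w measure \<Rightarrow> (real^'l \<Rightarrow> real^'m \<Rightarrow> real^'l) \<Rightarrow> (nat \<Rightarrow> 'w \<Rightarrow> real^'m) \<Rightarrow>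
    (real^'l \<Rightarrow> real) \<Rightarrow> (real^'l \<Rightarrow> real) \<Rightarrow> (real^'l) set \<Rightarrow> real \<Rightarrow> real \<Rightarrow> bool" where
  "lyapunov M a N V W C \<delta> b \<longleftrightarrow>
     (\<forall>x. V x > 0) \<and> (\<forall>x. W x \<ge> 1) \<and>
     continuously_differentiable V \<and> continuously_differentiable W \<and>
     (\<forall>r\<ge>0. compact {x. V x \<le> r} \<and> compact {x. W x \<le> r}) \<and>
     compact C \<and> \<delta> > 0 \<and> drift_DV3 M a N V W C \<delta> b"


section \<open>Weighted function spaces\<close>

text \<open>All norms take values in the extended nonnegative reals, so that they are meaningful for
  arbitrary arguments.\<close>

definition wnorm :: "(real^'l \<Rightarrow> real) \<Rightarrow> (real^'l \<Rightarrow> real) \<Rightarrow> ennreal" where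
  "wnorm w f = (SUP x. ennreal (\<bar>f x\<bar> / w x))"

definition L_inf :: "(real^'l \<Rightarrow> real) \<Rightarrow> (real^'l \<Rightarrow> real) set" where
  "L_inf w = {f \<in> borel_measurable borel. wnorm w f < \<infinity>}"

definition L_inf0 :: "(real^'l \<Rightarrow> real) \<Rightarrow> (real^'l \<Rightarrow> real) set" where
  "L_inf0 w = {f \<in> L_inf w. continuous_on UNIV f}"

definition L_inf1 :: "(real^'l \<Rightarrow> real) \<Rightarrow> (real^'l \<Rightarrow> real) set" where
  "L_inf1 w = {f \<in> L_inf0 w. \<forall>i. (\<forall>x. has_partial i f x) \<and> partial i f \<in> L_inf0 w}"

definition wnorm1 :: "(real^'l \<Rightarrow> real) \<Rightarrow> (real^'l \<Rightarrow> real) \<Rightarrow> ennreal" where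
  "wnorm1 w f = Max (insert (wnorm w f) (range (\<lambda>i. wnorm w (partial i f))))"

text \<open>The order of smoothness \<open>k\<close> is only ever 0 or 1.\<close>

definition Lk :: "(real^'l \<Rightarrow> real) \<Rightarrow> nat \<Rightarrow> (real^'l \<Rightarrow> real) set" where
  "Lk w k = (if k = 0 then L_inf0 w else L_inf1 w)"

definition normk :: "(real^'l \<Rightarrow> real) \<Rightarrow> nat \<Rightarrow> (real^'l \<Rightarrow> real) \<Rightarrow> ennreal" where
  "normk w k = (if k = 0 then wnorm w else wnorm1 w)"

definition linear_operator ::
  "(real^'l \<Rightarrow> real) \<Rightarrow> nat \<Rightarrow> ((real^'l \<Rightarrow> real) \<Rightarrow> real^'l \<Rightarrow> real) \<Rightarrow> bool" where
  "linear_operator w k Z \<longleftrightarrow>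
     (\<forall>f\<in>Lk w k. Z f \<in> Lk w k) \<and>
     (\<forall>f\<in>Lk w k. \<forall>g\<in>Lk w k. \<forall>c d. Z (\<lambda>x. c * f x + d * g x) = (\<lambda>x. c * Z f x + d * Z g x))"

definition opnorm ::
  "(real^'l \<Rightarrow> real) \<Rightarrow> nat \<Rightarrow> ((real^'l \<Rightarrow> real) \<Rightarrow> real^'l \<Rightarrow> real) \<Rightarrow> ennreal" where
  "opnorm w k Z = (SUP f\<in>{f \<in> Lk w k. normk w k f \<noteq> 0}. normk w k (Z f) / normk w k f)"


section \<open>Signed measures and separability\<close>

text \<open>Finite signed measures are countably additive real-valued functions on the Borel sets.
  Infinite values need not be allowed: since \<open>w \<ge> 1\<close>, a signed measure of finite \<open>w\<close>-norm is
  finite on every Borel set.  Integration is with respect to the Jordan decomposition,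
  whose positive part is the upper variation
  \<open>A \<mapsto> sup {\<mu>(B) | B \<subseteq> A}\<close> (\<open>B = {}\<close> makes the truncation by \<open>ennreal\<close> harmless).\<close>

definition signed_measure :: "((real^'l) set \<Rightarrow> real) \<Rightarrow> bool" where
  "signed_measure \<mu> \<longleftrightarrow> \<mu> {} = 0 \<and>
     (\<forall>A :: nat \<Rightarrow> (real^'l) set. range A \<subseteq> sets borel \<and> disjoint_family A \<longrightarrow>
        (\<lambda>n. \<mu> (A n)) sums \<mu> (\<Union>n. A n))"

definition pos_part :: "((real^'l) set \<Rightarrow> real) \<Rightarrow> (real^'l) measure" where
  "pos_part \<mu> = measure_of UNIV (sets borel) (\<lambda>A. SUP B\<in>{B \<in> sets borel. B \<subseteq> A}. ennreal (\<mu> B))"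

definition neg_part :: "((real^'l) set \<Rightarrow> real) \<Rightarrow> (real^'l) measure" where
  "neg_part \<mu> = pos_part (\<lambda>A. - \<mu> A)"

definition sm_integrable :: "((real^'l) set \<Rightarrow> real) \<Rightarrow> (real^'l \<Rightarrow> real) \<Rightarrow> bool" where
  "sm_integrable \<mu> h \<longleftrightarrow> integrable (pos_part \<mu>) h \<and> integrable (neg_part \<mu>) h"

definition sm_integral :: "((real^'l) set \<Rightarrow> real) \<Rightarrow> (real^'l \<Rightarrow> real) \<Rightarrow> real" where
  "sm_integral \<mu> h = (\<integral>x. h x \<partial>pos_part \<mu>) - (\<integral>x. h x \<partial>neg_part \<mu>)"

definition sm_norm :: "(real^'l \<Rightarrow> real) \<Rightarrow> ((real^'l) set \<Rightarrow> real) \<Rightarrow> ennreal" where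
  "sm_norm w \<mu> =
     (SUP h\<in>{h \<in> L_inf w. wnorm w h \<noteq> 0}. ennreal \<bar>sm_integral \<mu> h\<bar> / wnorm w h)"

definition M1 :: "(real^'l \<Rightarrow> real) \<Rightarrow> ((real^'l) set \<Rightarrow> real) set" where
  "M1 w = {\<mu>. signed_measure \<mu> \<and> (\<forall>h\<in>L_inf w. sm_integrable \<mu> h) \<and> sm_norm w \<mu> < \<infinity>}"

definition finite_rank ::
  "(real^'l \<Rightarrow> real) \<Rightarrow> nat \<Rightarrow> ((real^'l \<Rightarrow> real) \<Rightarrow> real^'l \<Rightarrow> real) \<Rightarrow> bool" where
  "finite_rank w k T \<longleftrightarrow> linear_operator w k T \<and>
     (\<exists>(n::nat) (m :: nat \<Rightarrow> nat \<Rightarrow> real) s \<nu>.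
        (\<forall>i<n. s i \<in> Lk w k) \<and> (\<forall>j<n. \<nu> j \<in> M1 w) \<and>
        (\<forall>f\<in>Lk w k. \<forall>x. T f x = (\<Sum>i<n. \<Sum>j<n. m i j * (s i x * sm_integral (\<nu> j) f))))"

definition separable_op ::
  "(real^'l \<Rightarrow> real) \<Rightarrow> nat \<Rightarrow> ((real^'l \<Rightarrow> real) \<Rightarrow> real^'l \<Rightarrow> real) \<Rightarrow> bool" where
  "separable_op w k Z \<longleftrightarrow> linear_operator w k Z \<and>
     (\<forall>\<epsilon>>0. \<exists>T. finite_rank w k T \<and> opnorm w k (\<lambda>f x. Z f x - T f x) \<le> ennreal \<epsilon>)"


section \<open>Mapping properties\<close>

text \<open>Each property asserts that the integrals involved converge, besides membership or equality.\<close>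

definition P_maps :: "'w measure \<Rightarrow> (real^'l \<Rightarrow> real^'m \<Rightarrow> real^'l) \<Rightarrow> (nat \<Rightarrow> 'w \<Rightarrow> real^'m) \<Rightarrow>
    nat \<Rightarrow> (real^'l \<Rightarrow> real) \<Rightarrow> nat \<Rightarrow> bool" where
  "P_maps M a N t w k \<longleftrightarrow>
     (\<forall>f\<in>Lk w k. (\<forall>x. integrable (kernel M a N t x) f) \<and> P_op M a N t f \<in> Lk w k)"

definition Q_maps :: "'w measure \<Rightarrow> (real^'l \<Rightarrow> real^'m \<Rightarrow> real^'l) \<Rightarrow> (nat \<Rightarrow> 'w \<Rightarrow> real^'m) \<Rightarrow>
    nat \<Rightarrow> (real^'l \<Rightarrow> real) \<Rightarrow> 'l \<Rightarrow> 'l \<Rightarrow> bool" where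
  "Q_maps M a N t w i j \<longleftrightarrow>
     (\<forall>f\<in>L_inf0 w.
        (\<forall>x. integrable M (\<lambda>\<omega>. sensitivity a N x t \<omega> $ j $ i * f (chain a N x t \<omega>))) \<and>
        Q_comp M a N t i j f \<in> L_inf0 w)"

definition grad_P_eq_Q_grad :: "'w measure \<Rightarrow> (real^'l \<Rightarrow> real^'m \<Rightarrow> real^'l) \<Rightarrow>
    (nat \<Rightarrow> 'w \<Rightarrow> real^'m) \<Rightarrow> nat \<Rightarrow> (real^'l \<Rightarrow> real) \<Rightarrow> bool" where
  "grad_P_eq_Q_grad M a N t w \<longleftrightarrow>
     (\<forall>f\<in>L_inf1 w.
        (\<forall>x. integrable (kernel M a N t x) f) \<and>
        (\<forall>i x. has_partial i (P_op M a N t f) x) \<and>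
        (\<forall>x. integrable M (\<lambda>\<omega>. transpose (sensitivity a N x t \<omega>) *v grad f (chain a N x t \<omega>))) \<and>
        grad (P_op M a N t f) = Q_op M a N t (grad f))"

end

theory Submission
  imports Defs
begin

text \<open>
  Write \<open>v = e\<^sup>V\<close> and \<open>w = v\<^sup>\<eta>\<close>.  The drift condition gives \<open>P\<^sup>t w \<le> c w e\<^sup>-\<^sup>\<eta>\<^sup>\<delta>\<^sup>W\<close> for \<open>t \<ge> 1\<close>, so a
  function of size \<open>w\<close> becomes \<open>o(w)\<close> after one step.  Everything except separability rests on uniform
  integrability of \<open>f(X(t))\<close>, locally uniformly in the initial state: together with pathwise smoothness
  of the chain and the bound on the sensitivity it yields continuity of \<open>P\<^sup>t f\<close> and \<open>Q\<^sup>t f\<close>, and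
  \<open>\<nabla>P\<^sup>t f = Q\<^sup>t \<nabla>f\<close> follows by Fubini and the fundamental theorem of calculus.  Uniform integrability
  is immediate when \<open>f = o(v)\<close>, in particular for \<open>\<eta> < 1\<close>; for \<open>\<eta> = 1\<close> and \<open>t > t\<^sub>0\<close> it follows from
  the strong Feller property supplied by the density of \<open>P\<close> at time \<open>t\<^sub>0\<close>.

  For separability take \<open>t > 2 t\<^sub>0\<close> and write \<open>P\<^sup>t f\<close> as \<open>P\<close> at time \<open>t\<^sub>0\<close> applied to \<open>g = P\<^sup>s f\<close>.  Both
  \<open>g\<close> and \<open>P\<^sup>t f\<close> are \<open>o(w)\<close> together with their gradients, so up to a small error they can be cut off
  outside a ball, and there the density \<open>p(x, y)\<close> is approximated, in \<open>C\<^sup>1\<close> in \<open>x\<close>, by a step function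
  of \<open>y\<close>.
\<close>

text \<open>At \<eta> = 1 the drift inequality bounds the expectation of v(X(t)) but does not keep
  mass from escaping to infinity as the initial state varies. The remedy lies in the tail
  expectations: at a fixed initial state they vanish by dominated convergence, and the strong Feller
  property carries their smallness to a neighbourhood. This costs \<open>t0\<close> steps for
  smoothing and one for decay. In the separability argument the function P^s f, with s = t -
  \<open>t0\<close>, must already be regular, whence the threshold \<open>2 * t0 + 1\<close>.
  Uniform integrability yields no single function dominating the gradient near a given state;
  integrating along coordinate lines avoids the need for one. Approximation in the norm with k = 1
  forces factors of class C^1 in x: these are densities frozen at a node z_i and multiplied by a
  smooth cutoff. In y a step function is enough, because y is integrated out. The functionals have
  to act on f rather than on P^s f, so each cell of the partition is carried through s steps of the
  chain to become a measure. All errors depend on f only through its weighted norm, so they bound an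
  operator norm.\<close>

section \<open>Continuously differentiable functions\<close>

text \<open>Carrying the gradient as an explicit vector field lets product rule, sums and the
  passage from f to P^t f be computed on gradients. By \<open>C1_iff\<close> this amounts to
  existence and continuity of all partial derivatives, the form used in
  \<open>L_inf1\<close>.\<close>

definition C1 :: "(real^'l \<Rightarrow> real) \<Rightarrow> (real^'l \<Rightarrow> real^'l) \<Rightarrow> bool" where
  "C1 f G \<longleftrightarrow> (\<forall>x. (f has_derivative (\<lambda>h. G x \<bullet> h)) (at x)) \<and> continuous_on UNIV G"

lemma C1I:
  assumes "\<And>x. (f has_derivative D x) (at x)" "\<And>x h. D x h = G x \<bullet> h" "continuous_on UNIV G"
  shows "C1 f G"
proof -
  have "D x = (\<lambda>h. G x \<bullet> h)" for x using assms(2) by auto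
  with assms(1,3) show ?thesis by (metis C1_def)
qed

lemma C1D:
  assumes "C1 f G"
  shows "(f has_derivative (\<lambda>h. G x \<bullet> h)) (at x)" "continuous_on UNIV G"
  using assms by (auto simp: C1_def)

lemma has_partial_derivative:
  fixes f :: "real^'l \<Rightarrow> real"
  assumes "(f has_derivative D) (at x)"
  shows "((\<lambda>s. f (x + s *\<^sub>R axis i 1)) has_real_derivative D (axis i 1)) (at 0)"
proof -
  have lin: "linear D" using assms has_derivative_linear by blast
  have "((\<lambda>s::real. x + s *\<^sub>R axis i 1) has_derivative (\<lambda>s. s *\<^sub>R axis i 1)) (at 0)"
    by (auto intro!: derivative_eq_intros)
  from diff_chain_at[OF this, of f D] assms
  have "((\<lambda>s. f (x + s *\<^sub>R axis i 1)) has_derivative (\<lambda>s. D (s *\<^sub>R axis i 1))) (at 0)"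
    by (simp add: o_def)
  moreover have "(\<lambda>s. D (s *\<^sub>R axis i 1)) = (\<lambda>s. s * D (axis i 1))"
    using linear_cmul[OF lin] by auto
  ultimately show ?thesis
    by (simp add: has_field_derivative_def mult.commute[of _ "D (axis i 1)"] mult_commute_abs)
qed

lemma partial_eqI:
  assumes "(f has_derivative D) (at x)"
  shows "has_partial i f x" "partial i f x = D (axis i 1)"
  using has_partial_derivative[OF assms, of i]
  by (auto simp: has_partial_def partial_def real_differentiable_def DERIV_imp_deriv)

lemma has_partial_shift:
  fixes f :: "real^'l \<Rightarrow> real"
  assumes "has_partial i f (x + u *\<^sub>R axis i 1)"
  shows "((\<lambda>s. f (x + s *\<^sub>R axis i 1)) has_real_derivative partial i f (x + u *\<^sub>R axis i 1)) (at u)"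
proof -
  let ?y = "x + u *\<^sub>R axis i (1::real)"
  have "((\<lambda>s. f (?y + s *\<^sub>R axis i 1)) has_real_derivative partial i f ?y) (at 0)"
    using assms unfolding has_partial_def partial_def
    by (metis DERIV_imp_deriv real_differentiable_def)
  then have "((\<lambda>s. f (?y + (s - u) *\<^sub>R axis i 1)) has_real_derivative partial i f ?y) (at u)"
    using DERIV_shift[of "\<lambda>s. f (?y + (s - u) *\<^sub>R axis i 1)" "partial i f ?y" 0 u] by simp
  moreover have "?y + (s - u) *\<^sub>R axis i 1 = x + s *\<^sub>R axis i 1" for s
    by (simp add: scaleR_left_diff_distrib)
  ultimately show ?thesis by simp
qed

lemma C1_partial:
  assumes "C1 f G"
  shows "has_partial i f x" "partial i f x = G x $ i" "grad f = G"
proof -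
  have d: "(f has_derivative (\<lambda>h. G x \<bullet> h)) (at x)" for x using assms by (simp add: C1_def)
  show "has_partial i f x" using partial_eqI(1)[OF d] .
  show "partial i f x = G x $ i"
    using partial_eqI(2)[OF d] by (simp add: inner_axis)
  show "grad f = G"
    by (auto simp: grad_def fun_eq_iff vec_eq_iff partial_eqI(2)[OF d] inner_axis)
qed

lemma C1_continuous: "C1 f G \<Longrightarrow> continuous_on UNIV f"
  unfolding C1_def by (meson differentiable_def differentiable_imp_continuous_on differentiable_on_def has_derivative_at_withinI)

text \<open>The coordinates of the increment are switched on one at a time. Each switch moves along
  a coordinate line, where the mean value inequality applies and the partial derivative differs
  little from its value at x.\<close>

lemma continuous_partials_imp_C1:
  fixes f :: "real^'l \<Rightarrow> real"
  assumes hp: "\<And>i x. has_partial i f x" and cont: "\<And>i. continuous_on UNIV (partial i f)"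
  shows "C1 f (grad f)"
  unfolding C1_def
proof (intro conjI allI)
  show "continuous_on UNIV (grad f)"
    unfolding grad_def by (intro continuous_intros cont)
  fix x :: "real^'l"
  have bl: "bounded_linear (\<lambda>h. grad f x \<bullet> h)" by (rule bounded_linear_inner_right)
  have key: "\<exists>d>0. \<forall>h. norm h < d \<longrightarrow> norm (f (x + h) - f x - grad f x \<bullet> h) \<le> e * norm h"
    if e: "e > 0" for e :: real
  proof -
    \<comment> \<open>The error is shared equally among the coordinates.\<close>
    define e1 where "e1 = e / real CARD('l)"
    have e1: "e1 > 0" using e by (simp add: e1_def)
    have "\<exists>d>0. \<forall>y. norm (y - x) < d \<longrightarrow> \<bar>partial i f y - partial i f x\<bar> \<le> e1" for i
    proof -
      have "isCont (partial i f) x" using cont[of i] by (simp add: continuous_on_eq_continuous_at)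
      then obtain d where "d > 0" "\<And>y. dist y x < d \<Longrightarrow> dist (partial i f y) (partial i f x) < e1"
        using e1 unfolding continuous_at_eps_delta by blast
      then show ?thesis by (intro exI[of _ d]) (auto simp: dist_norm less_imp_le)
    qed
    then obtain d where d: "\<And>i. d i > 0"
        "\<And>i y. norm (y - x) < d i \<Longrightarrow> \<bar>partial i f y - partial i f x\<bar> \<le> e1" by metis
    define d0 where "d0 = Min (range d)"
    have d0: "d0 > 0" "\<And>i. d0 \<le> d i" using d(1) by (auto simp: d0_def)
    have "norm (f (x + h) - f x - grad f x \<bullet> h) \<le> e * norm h" if h: "norm h < d0" for h
    proof -
      \<comment> \<open>\<open>pr S\<close> keeps the coordinates of h in \<open>S\<close> and
        clears the others, so it leads from 0 at the empty set to h at \<open>UNIV\<close>.\<close>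
      define pr where "pr S = (\<chi> i. if i \<in> S then h $ i else 0)" for S
      have ind: "\<bar>f (x + pr S) - f x - (\<Sum>i\<in>S. h $ i * partial i f x)\<bar> \<le> real (card S) * e1 * norm h"
        if "finite S" for S using that
      proof induct
        case empty
        have "pr {} = 0" by (simp add: pr_def vec_eq_iff)
        then show ?case by simp
      next
        case (insert k S)
        have ins: "pr (insert k S) = pr S + (h $ k) *\<^sub>R axis k 1"
          using insert by (auto simp: pr_def vec_eq_iff axis_def)
        let ?F = "\<lambda>s. f (x + pr S + s *\<^sub>R axis k 1)"
        have dF: "(?F has_real_derivative partial k f (x + pr S + s *\<^sub>R axis k 1)) (at s)" for s
          by (rule has_partial_shift) (rule hp)
        \<comment> \<open>With the linear part subtracted, the derivative is the oscillation of the
          partial derivative, at most \<open>e1\<close> on the segment.\<close>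
        let ?G = "\<lambda>s. ?F s - s * partial k f x"
        have dG: "(?G has_real_derivative (partial k f (x + pr S + s *\<^sub>R axis k 1) - partial k f x)) (at s)" for s
          using DERIV_diff[OF dF DERIV_cmult_right[OF DERIV_ident, of "partial k f x"]] by simp
        have bd: "\<bar>partial k f (x + pr S + s *\<^sub>R axis k 1) - partial k f x\<bar> \<le> e1"
          if s: "\<bar>s\<bar> \<le> \<bar>h $ k\<bar>" for s
        proof (rule d(2))
          have "norm (pr S + s *\<^sub>R axis k 1) \<le> norm h"
          proof (rule norm_le_componentwise_cart)
            fix i show "norm ((pr S + s *\<^sub>R axis k 1) $ i) \<le> norm (h $ i)"
              using insert s by (auto simp: pr_def axis_def)
          qed
          then show "norm (x + pr S + s *\<^sub>R axis k 1 - x) < d k"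
            using h d0(2)[of k] by (simp add: algebra_simps)
        qed
        have "norm (?G (h $ k) - ?G 0) \<le> e1 * norm (h $ k - 0)"
        proof (rule field_differentiable_bound[of "{- \<bar>h $ k\<bar>..\<bar>h $ k\<bar>}"
              ?G "\<lambda>s. partial k f (x + pr S + s *\<^sub>R axis k 1) - partial k f x"])
          show "\<And>s. s \<in> {- \<bar>h $ k\<bar>..\<bar>h $ k\<bar>} \<Longrightarrow>
            norm (partial k f (x + pr S + s *\<^sub>R axis k 1) - partial k f x) \<le> e1"
            using bd by auto
        qed (auto intro: has_field_derivative_at_within[OF dG])
        also have "\<dots> \<le> e1 * norm h" using e1 component_le_norm_cart[of h k] by simp
        finally have "\<bar>f (x + pr (insert k S)) - f (x + pr S) - h $ k * partial k f x\<bar> \<le> e1 * norm h"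
          by (simp add: ins add.assoc)
        moreover have "(\<Sum>i\<in>insert k S. h $ i * partial i f x)
            = h $ k * partial k f x + (\<Sum>i\<in>S. h $ i * partial i f x)" using insert by simp
        moreover have "real (card (insert k S)) * e1 * norm h = e1 * norm h + real (card S) * e1 * norm h"
          using insert by (simp add: algebra_simps)
        ultimately show ?case using insert(3) by linarith
      qed
      have "pr UNIV = h" by (simp add: pr_def vec_eq_iff)
      with ind[of UNIV] show ?thesis
        by (simp add: e1_def inner_vec_def grad_def mult.commute)
    qed
    with d0(1) show ?thesis by blast
  qed
  show "(f has_derivative (\<lambda>h. grad f x \<bullet> h)) (at x)"
    unfolding has_derivative_at_alt
  proof (intro conjI bl allI impI)
    fix e :: real assume "e > 0"
    from key[OF this] obtain d where d: "d > 0"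
      "\<And>h. norm h < d \<Longrightarrow> norm (f (x + h) - f x - grad f x \<bullet> h) \<le> e * norm h" by blast
    show "\<exists>d>0. \<forall>y. norm (y - x) < d \<longrightarrow>
        norm (f y - f x - grad f x \<bullet> (y - x)) \<le> e * norm (y - x)"
      using d(1) d(2)[of "_ - x"] by (auto intro!: exI[of _ d])
  qed
qed

lemma C1_iff: "C1 f G \<longleftrightarrow> (\<forall>i x. has_partial i f x) \<and> (\<forall>i. continuous_on UNIV (partial i f)) \<and> grad f = G"
proof
  assume C: "C1 f G"
  have "continuous_on UNIV (partial i f)" for i
  proof -
    have "partial i f = (\<lambda>x. G x $ i)" using C1_partial(2)[OF C] by auto
    moreover have "continuous_on UNIV (\<lambda>x. G x $ i)" using C by (auto simp: C1_def intro: continuous_intros)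
    ultimately show ?thesis by simp
  qed
  then show "(\<forall>i x. has_partial i f x) \<and> (\<forall>i. continuous_on UNIV (partial i f)) \<and> grad f = G"
    using C1_partial[OF C] by auto
qed (auto intro: continuous_partials_imp_C1)

lemma C1_mult:
  assumes "C1 f F" "C1 g G"
  shows "C1 (\<lambda>x. f x * g x) (\<lambda>x. f x *\<^sub>R G x + g x *\<^sub>R F x)"
  unfolding C1_def
proof (intro conjI allI)
  fix x
  have "(f has_derivative (\<lambda>h. F x \<bullet> h)) (at x)" "(g has_derivative (\<lambda>h. G x \<bullet> h)) (at x)"
    using assms by (auto simp: C1_def)
  from has_derivative_mult[OF this]
  show "((\<lambda>x. f x * g x) has_derivative (\<lambda>h. (f x *\<^sub>R G x + g x *\<^sub>R F x) \<bullet> h)) (at x)"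
    by (simp add: inner_add_left mult.commute)
next
  show "continuous_on UNIV (\<lambda>x. f x *\<^sub>R G x + g x *\<^sub>R F x)"
    using assms C1_continuous[OF assms(1)] C1_continuous[OF assms(2)]
    by (auto simp: C1_def intro!: continuous_intros)
qed

lemma C1_diff:
  assumes "C1 f F" "C1 g G"
  shows "C1 (\<lambda>x. f x - g x) (\<lambda>x. F x - G x)"
  by (rule C1I, rule has_derivative_diff[OF assms[THEN C1D(1)]])
    (auto intro!: continuous_intros assms[THEN C1D(2)] simp: inner_diff_left)

lemma C1_const: "C1 (\<lambda>x. c) (\<lambda>x. 0)"
  by (rule C1I, rule has_derivative_const) auto

lemma C1_sum:
  assumes "\<And>i. i \<in> I \<Longrightarrow> C1 (f i) (F i)"
  shows "C1 (\<lambda>x. \<Sum>i\<in>I. f i x) (\<lambda>x. \<Sum>i\<in>I. F i x)"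
  by (rule C1I, rule has_derivative_sum[OF assms[THEN C1D(1)]])
    (auto intro!: continuous_intros assms[THEN C1D(2)] simp: inner_sum_left)

section \<open>Cutoffs of class C^1 built from the squared positive part\<close>

definition sqpos :: "real \<Rightarrow> real" where "sqpos s = (max 0 s)\<^sup>2"

lemma DERIV_sqpos: "(sqpos has_real_derivative 2 * max 0 s) (at s)"
proof -
  consider "s > 0" | "s < 0" | "s = 0" by linarith
  then show ?thesis
  proof cases
    case 1
    have "((\<lambda>s. s\<^sup>2) has_real_derivative 2 * max 0 s) (at s)"
      using 1 by (auto intro!: derivative_eq_intros)
    moreover have "eventually (\<lambda>y. sqpos y = y\<^sup>2) (nhds s)"
      using eventually_nhds_in_open[of "{0<..}" s] 1 by (auto simp: sqpos_def elim!: eventually_mono)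
    ultimately show ?thesis using DERIV_cong_ev[OF refl] by fast
  next
    case 2
    have "((\<lambda>s. 0) has_real_derivative 2 * max 0 s) (at s)"
      using 2 by (auto intro!: derivative_eq_intros)
    moreover have "eventually (\<lambda>y. sqpos y = 0) (nhds s)"
      using eventually_nhds_in_open[of "{..<0}" s] 2 by (auto simp: sqpos_def elim!: eventually_mono)
    ultimately show ?thesis using DERIV_cong_ev[OF refl] by fast
  next
    case 3
    have "(\<lambda>h. sqpos h / h) \<midarrow>0\<rightarrow> 0"
    proof (rule Lim_null_comparison)
      show "\<forall>\<^sub>F x in at 0. norm (sqpos x / x) \<le> \<bar>x\<bar>"
        by (auto simp: sqpos_def power2_eq_square max_def abs_mult divide_simps split: if_splits)
      show "((\<lambda>x. \<bar>x\<bar>) \<longlongrightarrow> 0) (at (0::real))" by (rule tendsto_eq_intros | simp)+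
    qed
    then show ?thesis using 3 by (simp add: DERIV_def sqpos_def)
  qed
qed

text \<open>Composition with \<open>ln (1 + x \<bullet> x)\<close>, whose gradient is bounded, keeps the gradient of the
  cutoff bounded uniformly in the radius.\<close>

definition cutoff :: "real \<Rightarrow> real^'l \<Rightarrow> real" where
  "cutoff r x = sqpos (1 - sqpos (ln (1 + x \<bullet> x) - r))"

lemma sqpos_nonneg: "sqpos s \<ge> 0" by (simp add: sqpos_def)

lemma cutoff_bounds: "0 \<le> cutoff r x" "cutoff r x \<le> 1"
proof -
  show "0 \<le> cutoff r x" by (simp add: cutoff_def sqpos_nonneg)
  have "max 0 (1 - sqpos (ln (1 + x \<bullet> x) - r)) \<le> 1" using sqpos_nonneg[of "ln (1 + x \<bullet> x) - r"] by auto
  then show "cutoff r x \<le> 1" by (simp add: cutoff_def sqpos_def[of "1 - _"] power_le_one)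
qed

text \<open>The bound 4 comes from two derivatives of \<open>sqpos\<close>, each at most 2 where the
  product does not vanish, and from 2|x| / (1 + |x|^2), at most 1. It is independent of
  \<open>r\<close>, so the radius may be chosen after the error budget is fixed.\<close>

lemma ex_cutoff:
  obtains \<psi> :: "real^'l \<Rightarrow> real" and \<Psi> R where "C1 \<psi> \<Psi>" "\<And>x. 0 \<le> \<psi> x" "\<And>x. \<psi> x \<le> 1"
    "\<And>x. norm x \<le> r \<Longrightarrow> \<psi> x = 1" "\<And>x. norm x \<le> r \<Longrightarrow> \<Psi> x = 0"
    "\<And>x. norm x > R \<Longrightarrow> \<psi> x = 0" "\<And>x. norm x > R \<Longrightarrow> \<Psi> x = 0" "\<And>x. norm (\<Psi> x) \<le> 4"
proof -
  define \<rho> where "\<rho> = ln (1 + r^2)"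
  define l where "l x = ln (1 + x \<bullet> x) - \<rho>" for x :: "real^'l"
  define \<psi> where "\<psi> = (cutoff \<rho> :: real^'l \<Rightarrow> real)"
  define \<Psi> where "\<Psi> x = (2 * max 0 (1 - sqpos (l x)) * (- (2 * max 0 (l x)) * (1 / (1 + x \<bullet> x)))) *\<^sub>R (2 *\<^sub>R x)"
    for x :: "real^'l"
  \<comment> \<open>Beyond this radius \<open>l\<close> exceeds 1, which makes the argument of the
    outer \<open>sqpos\<close> negative.\<close>
  define R where "R = exp (\<rho> + 1)"
  have pos: "1 + x \<bullet> x > 0" for x :: "real^'l" by (simp add: add_pos_nonneg)
  have csq: "continuous_on UNIV sqpos"
    using DERIV_sqpos DERIV_isCont continuous_at_imp_continuous_on by blast
  have cl: "continuous_on UNIV l" unfolding l_def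
    using pos by (intro continuous_intros) (auto simp: less_imp_neq[symmetric])
  have C: "C1 \<psi> \<Psi>" unfolding C1_def
  proof (intro conjI allI)
    fix x :: "real^'l"
    have dl: "(l has_derivative (\<lambda>h. (1 / (1 + x \<bullet> x)) * (2 * (x \<bullet> h)))) (at x)"
    proof -
      have "((\<lambda>x. 1 + x \<bullet> x) has_derivative (\<lambda>h. 2 * (x \<bullet> h))) (at x)"
        by (rule has_derivative_eq_rhs, rule has_derivative_add, rule has_derivative_const,
            rule has_derivative_inner, rule has_derivative_ident, rule has_derivative_ident)
          (auto simp: inner_commute)
      from has_derivative_ln[OF pos this] show ?thesis
        unfolding l_def
        by (intro has_derivative_eq_rhs[OF has_derivative_diff[OF _ has_derivative_const]])
          (auto simp: divide_inverse mult.commute)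
    qed
    have d2: "((\<lambda>s. sqpos (1 - sqpos s)) has_real_derivative
        2 * max 0 (1 - sqpos (l x)) * (- (2 * max 0 (l x)))) (at (l x))"
      by (rule DERIV_chain2[of sqpos _ "\<lambda>s. 1 - sqpos s", OF DERIV_sqpos])
        (auto intro!: derivative_eq_intros DERIV_sqpos)
    have "(\<psi> has_derivative (\<lambda>h. 2 * max 0 (1 - sqpos (l x)) * (- (2 * max 0 (l x))) *
        ((1 / (1 + x \<bullet> x)) * (2 * (x \<bullet> h))))) (at x)"
      using diff_chain_at[OF dl d2[unfolded has_field_derivative_def]]
      by (simp add: o_def \<psi>_def cutoff_def[abs_def] l_def)
    then show "(\<psi> has_derivative (\<lambda>h. \<Psi> x \<bullet> h)) (at x)"
      by (simp add: \<Psi>_def mult.assoc)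
  next
    show "continuous_on UNIV \<Psi>" unfolding \<Psi>_def
      using pos by (intro continuous_intros cl continuous_on_compose2[OF csq cl]) (auto simp: less_imp_neq[symmetric])
  qed
  have small: "l x \<le> 0" if "norm x \<le> r" for x
    using that pos[of x] by (auto simp: l_def \<rho>_def dot_square_norm add_pos_nonneg intro!: power_mono)
  have large: "l x > 1" if "norm x > R" for x
  proof -
    have R1: "R \<ge> 1" by (simp add: R_def \<rho>_def)
    have "R < norm x" by fact
    also have "\<dots> \<le> (norm x)\<^sup>2" using that R1 mult_left_mono[of 1 "norm x" "norm x"] by (simp add: power2_eq_square)
    also have "\<dots> < 1 + x \<bullet> x" by (simp add: dot_square_norm)
    finally have "ln R < ln (1 + x \<bullet> x)" using R1 by simp
    then show ?thesis by (simp add: R_def l_def)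
  qed
  have large': "1 - sqpos (l x) \<le> 0" if "norm x > R" for x
    using large[OF that] by (simp add: sqpos_def)
  have bd: "norm (\<Psi> x) \<le> 4" for x
  proof (cases "l x \<le> 1")
    case True
    have m1: "max 0 (1 - sqpos (l x)) \<le> 1" using sqpos_nonneg[of "l x"] by auto
    have m2: "max 0 (l x) \<le> 1" using True by auto
    have "2 * norm x \<le> 1 + x \<bullet> x"
      using zero_le_power2[of "norm x - 1"] by (simp add: dot_square_norm power2_eq_square algebra_simps)
    then have m3: "(1 / (1 + x \<bullet> x)) * (2 * norm x) \<le> 1" using pos[of x] by simp
    have "norm (\<Psi> x) = 4 * (max 0 (1 - sqpos (l x)) * (max 0 (l x) * ((1 / (1 + x \<bullet> x)) * (2 * norm x))))"
      using pos[of x] unfolding \<Psi>_def by (simp add: abs_mult mult_ac)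
    also have "\<dots> \<le> 4 * (1 * (1 * 1))"
      using m1 m2 m3 pos[of x] by (intro mult_left_mono mult_mono) auto
    finally show ?thesis by simp
  next
    case False
    then have "1 - sqpos (l x) \<le> 0" by (simp add: sqpos_def)
    then show ?thesis by (simp add: \<Psi>_def)
  qed
  show thesis
  proof (rule that[OF C])
    fix x :: "real^'l"
    show "0 \<le> \<psi> x" "\<psi> x \<le> 1" by (auto simp: \<psi>_def cutoff_bounds)
    show "norm x \<le> r \<Longrightarrow> \<psi> x = 1" using small[of x] by (simp add: \<psi>_def cutoff_def l_def sqpos_def)
    show "norm x \<le> r \<Longrightarrow> \<Psi> x = 0" using small[of x] by (simp add: \<Psi>_def)
    show "norm x > R \<Longrightarrow> \<psi> x = 0" using large'[of x] by (simp add: \<psi>_def cutoff_def l_def sqpos_def[of "1 - _"])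
    show "norm x > R \<Longrightarrow> \<Psi> x = 0" using large'[of x] by (simp add: \<Psi>_def)
    show "norm (\<Psi> x) \<le> 4" by (rule bd)
  qed
qed

section \<open>The chain and its sensitivity\<close>

lemma linear_norm_le_entries:
  fixes F :: "real^'l \<Rightarrow> real^'l"
  assumes "linear F" and K: "\<And>i j. \<bar>F (axis i 1) $ j\<bar> \<le> K"
  shows "norm (F h) \<le> (real CARD('l) * real CARD('l) * K) * norm h"
proof -
  have "F h = (\<Sum>i\<in>UNIV. (h $ i) *\<^sub>R F (axis i 1))"
  proof -
    have "F h = F (\<Sum>i\<in>UNIV. (h $ i) *\<^sub>R axis i 1)"
      by (subst basis_expansion[of h, symmetric]) (simp add: scalar_mult_eq_scaleR)
    then show ?thesis using assms(1) by (simp add: linear_sum linear_cmul)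
  qed
  also have "norm \<dots> \<le> (\<Sum>i\<in>UNIV. norm ((h $ i) *\<^sub>R F (axis i 1)))" by (rule norm_sum)
  also have "\<dots> \<le> (\<Sum>i\<in>(UNIV::'l set). norm h * (real CARD('l) * K))"
  proof (rule sum_mono)
    fix i :: 'l
    have "norm (F (axis i 1)) \<le> (\<Sum>j\<in>UNIV. \<bar>F (axis i 1) $ j\<bar>)" by (rule norm_le_l1_cart)
    also have "\<dots> \<le> real CARD('l) * K" using sum_mono[of UNIV "\<lambda>j. \<bar>F (axis i 1) $ j\<bar>" "\<lambda>_. K"] K by simp
    finally have 1: "norm (F (axis i 1)) \<le> real CARD('l) * K" .
    show "norm ((h $ i) *\<^sub>R F (axis i 1)) \<le> norm h * (real CARD('l) * K)"
      using 1 component_le_norm_cart[of h i] by (auto intro!: mult_mono)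
  qed
  finally show ?thesis by (simp add: mult_ac)
qed

text \<open>The entries of \<open>nabla_x\<close> are those of the Jacobian up to transposition; a
  bound on them gives a crude bound on the operator norm, uniform in state and noise.\<close>

lemma smooth_dynamics_derivative:
  fixes a :: "real^'l \<Rightarrow> real^'m \<Rightarrow> real^'l"
  assumes "smooth_dynamics a"
  obtains a' :: "real^'m \<Rightarrow> real^'l \<Rightarrow> ((real^'l) \<Rightarrow>\<^sub>L (real^'l))" and L where
    "\<And>n x. ((\<lambda>x. a x n) has_derivative blinfun_apply (a' n x)) (at x)"
    "\<And>n. continuous_on UNIV (a' n)" "\<And>n x. norm (a' n x) \<le> L"
proof -
  from assms obtain K where K: "\<And>x n. norm (nabla_x a x n) \<le> K"
    by (auto simp: smooth_dynamics_def)
  from assms have "\<forall>n. \<exists>f'. (\<forall>x. ((\<lambda>x. a x n) has_derivative blinfun_apply (f' x)) (at x)) \<and> continuous_on UNIV f'"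
    by (auto simp: smooth_dynamics_def continuously_differentiable_def)
  then obtain a' where a': "\<And>n x. ((\<lambda>x. a x n) has_derivative blinfun_apply (a' n x)) (at x)"
    "\<And>n. continuous_on UNIV (a' n)" by metis
  have entry: "\<bar>blinfun_apply (a' n x) (axis i 1) $ j\<bar> \<le> K" for n x i j
  proof -
    have "((\<lambda>y. a y n $ j) has_derivative (\<lambda>h. blinfun_apply (a' n x) h $ j)) (at x)"
      using a'(1) by (rule bounded_linear.has_derivative[OF bounded_linear_vec_nth])
    from partial_eqI(2)[OF this, of i]
    have "nabla_x a x n $ i $ j = blinfun_apply (a' n x) (axis i 1) $ j" by (simp add: nabla_x_def)
    moreover have "\<bar>nabla_x a x n $ i $ j\<bar> \<le> norm (nabla_x a x n)"
      using component_le_norm_cart[of "nabla_x a x n $ i" j] Finite_Cartesian_Product.norm_nth_le[of "nabla_x a x n" i]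
      by simp
    ultimately show ?thesis using K[of x n] by simp
  qed
  have "norm (a' n x) \<le> real CARD('l) * real CARD('l) * K" for n x
  proof (rule norm_blinfun_bound)
    have "0 \<le> K" using norm_ge_zero K by (rule order_trans)
    then show "0 \<le> real CARD('l) * real CARD('l) * K" by simp
    show "norm (blinfun_apply (a' n x) h) \<le> (real CARD('l) * real CARD('l) * K) * norm h" for h
      by (intro linear_norm_le_entries entry) (simp add: bounded_linear.linear blinfun.bounded_linear_right)
  qed
  with a' show thesis by (rule that)
qed

lemma borel_measurable_vec_nth [measurable (raw)]:
  fixes f :: "'a \<Rightarrow> real^'l"
  assumes "f \<in> borel_measurable K"
  shows "(\<lambda>x. f x $ i) \<in> borel_measurable K"
  by (rule measurable_compose[OF assms borel_measurable_continuous_onI])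
    (simp add: linear_continuous_on bounded_linear_vec_nth)

locale noisy_chain = prob_space M for M :: "'w measure" +
  fixes a :: "real^'l \<Rightarrow> real^'m \<Rightarrow> real^'l" and N :: "nat \<Rightarrow> 'w \<Rightarrow> real^'m"
    and a' :: "real^'m \<Rightarrow> real^'l \<Rightarrow> ((real^'l) \<Rightarrow>\<^sub>L (real^'l))" and L :: real
  assumes iid: "iid_noise M N"
    and cont_a: "continuous_on UNIV (\<lambda>(x, n). a x n)"
    and deriv_a: "\<And>n x. ((\<lambda>x. a x n) has_derivative blinfun_apply (a' n x)) (at x)"
    and cont_a': "\<And>n. continuous_on UNIV (a' n)"
    and bound_a': "\<And>n x. norm (a' n x) \<le> L"
begin

abbreviation X :: "real^'l \<Rightarrow> nat \<Rightarrow> 'w \<Rightarrow> real^'l" where "X \<equiv> chain a N"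
abbreviation S :: "real^'l \<Rightarrow> nat \<Rightarrow> 'w \<Rightarrow> real^'l^'l" where "S \<equiv> sensitivity a N"
abbreviation P :: "nat \<Rightarrow> (real^'l \<Rightarrow> real) \<Rightarrow> real^'l \<Rightarrow> real" where "P \<equiv> P_op M a N"

lemma L_nonneg: "0 \<le> L"
  using bound_a'[of undefined undefined] norm_ge_zero order_trans by blast

section \<open>Measurability and the Markov property\<close>

lemma noise_measurable: "1 \<le> t \<Longrightarrow> N t \<in> borel_measurable M"
  using iid by (auto simp: iid_noise_def indep_vars_def)

lemma a_measurable: "(\<lambda>(x, n). a x n) \<in> borel \<Otimes>\<^sub>M borel \<rightarrow>\<^sub>M borel"
  unfolding borel_prod by (rule borel_measurable_continuous_onI[OF cont_a])

lemma chain_measurable_pair: "(\<lambda>(x, \<omega>). X x t \<omega>) \<in> borel \<Otimes>\<^sub>M M \<rightarrow>\<^sub>M borel"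
proof (induct t)
  case (Suc t)
  have "(\<lambda>z. N (Suc t) (snd z)) \<in> borel \<Otimes>\<^sub>M M \<rightarrow>\<^sub>M borel"
    by (rule measurable_compose[OF measurable_snd noise_measurable]) simp
  from measurable_compose[OF measurable_Pair[OF Suc this] a_measurable]
  show ?case by (simp add: case_prod_beta')
qed (simp add: case_prod_beta')

lemma chain_measurable_pair' [measurable (raw)]:
  assumes [measurable]: "f \<in> K \<rightarrow>\<^sub>M borel" "g \<in> K \<rightarrow>\<^sub>M M"
  shows "(\<lambda>z. X (f z) t (g z)) \<in> K \<rightarrow>\<^sub>M borel"
  using measurable_compose[OF measurable_Pair[OF assms] chain_measurable_pair[of t]] by simp

text \<open>With the coordinate map \<open>\<lambda>i g. g i\<close> in the place of the noise, X(t)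
  becomes a function of the vector of noises up to time s. Independence of blocks of noise can then
  be applied to it.\<close>

lemma chain_restrict:
  "t \<le> s \<Longrightarrow> chain a (\<lambda>i g. g i) x t (restrict (\<lambda>i. N i \<omega>) {Suc 0..s}) = X x t \<omega>"
  by (induct t) (simp_all add: restrict_def)

lemma chain_projection_measurable:
  "t \<le> s \<Longrightarrow> chain a (\<lambda>i g. g i) x t \<in> PiM {Suc 0..s} (\<lambda>_. borel) \<rightarrow>\<^sub>M borel"
proof (induct t)
  case 0
  show ?case by (simp add: measurable_const)
next
  case (Suc t)
  have t: "t \<le> s" "Suc t \<in> {Suc 0..s}" using Suc.prems by auto
  have "(\<lambda>g. (chain a (\<lambda>i g. g i) x t g, g (Suc t))) \<in> PiM {Suc 0..s} (\<lambda>_. borel) \<rightarrow>\<^sub>M borel \<Otimes>\<^sub>M borel"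
    by (rule measurable_Pair[OF Suc.hyps[OF t(1)] measurable_component_singleton[OF t(2)]])
  note m = measurable_compose[OF this a_measurable]
  have eq: "chain a (\<lambda>i g. g i) x (Suc t) = (\<lambda>g. case (chain a (\<lambda>i g. g i) x t g, g (Suc t)) of (x, n) \<Rightarrow> a x n)"
    by (simp add: fun_eq_iff)
  show ?case unfolding eq by (rule m)
qed

lemma noise_distr: "1 \<le> t \<Longrightarrow> distr M borel (N t) = distr M borel (N 1)"
  using iid unfolding iid_noise_def by blast

interpretation MM: pair_sigma_finite M M ..

text \<open>The first t noises form a block independent of the next one, so their joint law is a
  product and the next noise may be drawn from a second copy of the sample space.\<close>

lemma nn_integral_step:
  assumes [measurable]: "f \<in> borel_measurable borel"
  shows "(\<integral>\<^sup>+\<omega>. f (X x (Suc t) \<omega>) \<partial>M) = (\<integral>\<^sup>+\<omega>. \<integral>\<^sup>+\<omega>'. f (X (X x t \<omega>) 1 \<omega>') \<partial>M \<partial>M)"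
proof -
  note [measurable] = a_measurable noise_measurable[of "Suc t"] noise_measurable[of 1] noise_measurable[of "Suc 0"]
  define U where "U \<omega> = restrict (\<lambda>i. N i \<omega>) {Suc 0..t}" for \<omega>
  define U' where "U' \<omega> = restrict (\<lambda>i. N i \<omega>) {Suc t}" for \<omega>
  let ?K = "PiM {Suc 0..t} (\<lambda>_. borel) :: (nat \<Rightarrow> real^'m) measure"
  let ?K' = "PiM {Suc t} (\<lambda>_. borel) :: (nat \<Rightarrow> real^'m) measure"
  have "indep_vars (\<lambda>_. borel) N {1..}" using iid by (simp add: iid_noise_def)
  then have ind: "indep_var ?K U ?K' U'"
    unfolding U_def[abs_def] U'_def[abs_def] by (rule indep_var_restrict) auto
  have [measurable]: "U \<in> M \<rightarrow>\<^sub>M ?K" "U' \<in> M \<rightarrow>\<^sub>M ?K'"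
    by (rule indep_var_rv1[OF ind], rule indep_var_rv2[OF ind])
  \<comment> \<open>The product of the two laws is realised on the product of two copies of
    \<open>M\<close>, which brings in the independent sample point \<omega>'.\<close>
  have "distr M (?K \<Otimes>\<^sub>M ?K') (\<lambda>\<omega>. (U \<omega>, U' \<omega>)) = distr M ?K U \<Otimes>\<^sub>M distr M ?K' U'"
    using ind by (simp add: indep_var_distribution_eq)
  also have "\<dots> = distr (M \<Otimes>\<^sub>M M) (?K \<Otimes>\<^sub>M ?K') (\<lambda>(\<omega>, \<omega>'). (U \<omega>, U' \<omega>'))"
    by (intro pair_measure_distr prob_space_imp_sigma_finite prob_space_distr) measurable
  finally have eq: "distr M (?K \<Otimes>\<^sub>M ?K') (\<lambda>\<omega>. (U \<omega>, U' \<omega>)) = \<dots>" .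
  define F where "F z = f (a (chain a (\<lambda>i g. g i) x t (fst z)) (snd z (Suc t)))" for z
  have [measurable]: "F \<in> borel_measurable (?K \<Otimes>\<^sub>M ?K')"
  proof -
    note [measurable] = chain_projection_measurable[OF order_refl, of x t]
    have [measurable]: "(\<lambda>g. g (Suc t)) \<in> ?K' \<rightarrow>\<^sub>M borel"
      by (intro measurable_component_singleton) auto
    have "(\<lambda>z. (chain a (\<lambda>i g. g i) x t (fst z), snd z (Suc t))) \<in> ?K \<Otimes>\<^sub>M ?K' \<rightarrow>\<^sub>M borel \<Otimes>\<^sub>M borel"
      by measurable
    from measurable_compose[OF measurable_compose[OF this a_measurable] assms]
    show ?thesis by (simp add: F_def[abs_def])
  qed
  have am: "(\<lambda>z. f (a (u z) (v z))) \<in> borel_measurable K"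
    if "u \<in> K \<rightarrow>\<^sub>M borel" "v \<in> K \<rightarrow>\<^sub>M borel" for u v and K :: "'b measure"
    using measurable_compose[OF measurable_compose[OF measurable_Pair[OF that] a_measurable] assms] by simp
  \<comment> \<open>Identical distribution enters here: \<open>N (Suc t)\<close> is replaced by
    \<open>N 1\<close>, so that the last step becomes the first step of a restarted chain.\<close>
  have shift: "(\<integral>\<^sup>+\<omega>'. f (a y (N (Suc t) \<omega>')) \<partial>M) = (\<integral>\<^sup>+\<omega>'. f (a y (N 1 \<omega>')) \<partial>M)" for y
  proof -
    have [measurable]: "(\<lambda>n. f (a y n)) \<in> borel_measurable borel" by (rule am) auto
    have "(\<integral>\<^sup>+\<omega>'. f (a y (N (Suc t) \<omega>')) \<partial>M) = (\<integral>\<^sup>+n. f (a y n) \<partial>distr M borel (N (Suc t)))"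
      by (rule nn_integral_distr[symmetric]) auto
    also have "\<dots> = (\<integral>\<^sup>+\<omega>'. f (a y (N 1 \<omega>')) \<partial>M)"
      by (subst noise_distr) (auto intro!: nn_integral_distr)
    finally show ?thesis .
  qed
  have UF: "F (U \<omega>, U' \<omega>') = f (a (X x t \<omega>) (N (Suc t) \<omega>'))" for \<omega> \<omega>'
    unfolding F_def U_def U'_def fst_conv by (subst chain_restrict) auto
  have "(\<integral>\<^sup>+\<omega>. f (X x (Suc t) \<omega>) \<partial>M) = (\<integral>\<^sup>+\<omega>. F (U \<omega>, U' \<omega>) \<partial>M)"
    by (simp add: UF)
  also have "\<dots> = (\<integral>\<^sup>+z. F z \<partial>distr M (?K \<Otimes>\<^sub>M ?K') (\<lambda>\<omega>. (U \<omega>, U' \<omega>)))"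
    by (rule nn_integral_distr[symmetric]) measurable
  also have "\<dots> = (\<integral>\<^sup>+z. F (U (fst z), U' (snd z)) \<partial>(M \<Otimes>\<^sub>M M))"
    unfolding eq by (subst nn_integral_distr) (auto simp: case_prod_beta')
  also have "\<dots> = (\<integral>\<^sup>+\<omega>. \<integral>\<^sup>+\<omega>'. F (U \<omega>, U' \<omega>') \<partial>M \<partial>M)"
    by (subst nn_integral_fst[symmetric]) auto
  also have "\<dots> = (\<integral>\<^sup>+\<omega>. \<integral>\<^sup>+\<omega>'. f (a (X x t \<omega>) (N (Suc t) \<omega>')) \<partial>M \<partial>M)"
    by (simp add: UF)
  also have "\<dots> = (\<integral>\<^sup>+\<omega>. \<integral>\<^sup>+\<omega>'. f (a (X x t \<omega>) (N 1 \<omega>')) \<partial>M \<partial>M)"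
    by (simp only: shift)
  finally show ?thesis by simp
qed

text \<open>Induction peels off the last step: averaging over it replaces f by its one-step
  expectation g on both sides.\<close>

lemma nn_integral_markov:
  assumes "f \<in> borel_measurable borel"
  shows "(\<integral>\<^sup>+\<omega>. f (X x (s + t) \<omega>) \<partial>M) = (\<integral>\<^sup>+\<omega>. \<integral>\<^sup>+\<omega>'. f (X (X x s \<omega>) t \<omega>') \<partial>M \<partial>M)"
  using assms
proof (induct t arbitrary: f)
  case 0
  then show ?case by (simp add: emeasure_space_1)
next
  case (Suc t)
  note [measurable] = Suc.prems
  define g where "g y = (\<integral>\<^sup>+\<omega>'. f (X y 1 \<omega>') \<partial>M)" for y
  have g[measurable]: "g \<in> borel_measurable borel"
    unfolding g_def by measurable
  have step: "(\<integral>\<^sup>+\<omega>'. f (X y (Suc k) \<omega>') \<partial>M) = (\<integral>\<^sup>+\<omega>'. g (X y k \<omega>') \<partial>M)" for y k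
    using nn_integral_step[OF Suc.prems] by (simp add: g_def)
  show ?case
    using Suc.hyps[OF g] by (simp add: step del: chain.simps)
qed

text \<open>As an identity of laws the Markov property transfers integrability as well, so it
  reaches functions without a sign.\<close>

lemma distr_markov:
  "distr M borel (X x (s + t)) = distr (M \<Otimes>\<^sub>M M) borel (\<lambda>z. X (X x s (fst z)) t (snd z))"
proof (rule measure_eqI)
  fix A assume "A \<in> sets (distr M borel (X x (s + t)))"
  then have A[measurable]: "A \<in> sets borel" by simp
  have "emeasure (distr M borel (X x (s + t))) A = (\<integral>\<^sup>+y. indicator A y \<partial>distr M borel (X x (s + t)))"
    by simp
  also have "\<dots> = (\<integral>\<^sup>+\<omega>. indicator A (X x (s + t) \<omega>) \<partial>M)"
    by (rule nn_integral_distr) measurable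
  also have "\<dots> = (\<integral>\<^sup>+\<omega>. \<integral>\<^sup>+\<omega>'. indicator A (X (X x s \<omega>) t \<omega>') \<partial>M \<partial>M)"
    by (rule nn_integral_markov) measurable
  also have "\<dots> = (\<integral>\<^sup>+z. indicator A (X (X x s (fst z)) t (snd z)) \<partial>(M \<Otimes>\<^sub>M M))"
    by (subst nn_integral_fst[symmetric]) auto
  also have "\<dots> = (\<integral>\<^sup>+y. indicator A y \<partial>distr (M \<Otimes>\<^sub>M M) borel (\<lambda>z. X (X x s (fst z)) t (snd z)))"
    by (rule nn_integral_distr[symmetric]) measurable
  finally show "emeasure (distr M borel (X x (s + t))) A =
      emeasure (distr (M \<Otimes>\<^sub>M M) borel (\<lambda>z. X (X x s (fst z)) t (snd z))) A" by simp
qed simp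

lemma P_eq_expectation: "f \<in> borel_measurable borel \<Longrightarrow> P t f x = (\<integral>\<omega>. f (X x t \<omega>) \<partial>M)"
  unfolding P_op_def kernel_def by (rule integral_distr) measurable

lemma kernel_integrable_iff:
  fixes f :: "_ \<Rightarrow> real"
  shows "f \<in> borel_measurable borel \<Longrightarrow> integrable (kernel M a N t x) f \<longleftrightarrow> integrable M (\<lambda>\<omega>. f (X x t \<omega>))"
  unfolding kernel_def by (rule integrable_distr_eq) measurable

lemma P_measurable [measurable]:
  assumes [measurable]: "f \<in> borel_measurable borel"
  shows "P t f \<in> borel_measurable borel"
proof -
  have "(\<lambda>x. \<integral>\<omega>. f (X x t \<omega>) \<partial>M) \<in> borel_measurable borel" by measurable
  then show ?thesis using P_eq_expectation[OF assms] by (simp cong: measurable_cong)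
qed

lemma P_markov:
  assumes [measurable]: "f \<in> borel_measurable borel" and int: "integrable M (\<lambda>\<omega>. f (X x (s + t) \<omega>))"
  shows "P (s + t) f x = P s (P t f) x"
proof -
  have "integrable (distr M borel (X x (s + t))) f"
    using int by (subst integrable_distr_eq) auto
  then have int2: "integrable (M \<Otimes>\<^sub>M M) (\<lambda>z. f (X (X x s (fst z)) t (snd z)))"
    unfolding distr_markov by (subst (asm) integrable_distr_eq) auto
  have "P (s + t) f x = (\<integral>y. f y \<partial>distr (M \<Otimes>\<^sub>M M) borel (\<lambda>z. X (X x s (fst z)) t (snd z)))"
    by (simp add: P_op_def kernel_def distr_markov)
  also have "\<dots> = (\<integral>z. f (X (X x s (fst z)) t (snd z)) \<partial>(M \<Otimes>\<^sub>M M))"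
    by (rule integral_distr) measurable
  also have "\<dots> = (\<integral>\<omega>. \<integral>\<omega>'. f (X (X x s \<omega>) t \<omega>') \<partial>M \<partial>M)"
    using MM.integral_fst'[OF int2] by simp
  also have "\<dots> = P s (P t f) x"
    by (simp add: P_eq_expectation)
  finally show ?thesis .
qed

text \<open>By the chain rule each step contributes a factor of norm at most \<open>L\<close>. The
  resulting bound is deterministic and uniform in the initial state.\<close>

lemma chain_derivative:
  "\<exists>D. (\<forall>x. ((\<lambda>y. X y t \<omega>) has_derivative blinfun_apply (D x)) (at x)) \<and> continuous_on UNIV D \<and>
       (\<forall>x. norm (D x) \<le> L ^ t)"
proof (induct t)
  case 0
  show ?case
    by (intro exI[of _ "\<lambda>x. id_blinfun"]) (auto intro: has_derivative_ident norm_blinfun_id_le)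
next
  case (Suc t)
  then obtain D where D: "\<And>x. ((\<lambda>y. X y t \<omega>) has_derivative blinfun_apply (D x)) (at x)"
    "continuous_on UNIV D" "\<And>x. norm (D x) \<le> L ^ t" by auto
  define n where "n = N (Suc t) \<omega>"
  let ?D = "\<lambda>x. a' n (X x t \<omega>) o\<^sub>L D x"
  have cX: "continuous_on UNIV (\<lambda>y. X y t \<omega>)"
    using D(1) by (meson differentiable_def differentiable_imp_continuous_on differentiable_on_def has_derivative_at_withinI)
  have "((\<lambda>y. X y (Suc t) \<omega>) has_derivative blinfun_apply (?D x)) (at x)" for x
    using diff_chain_at[OF D(1)[of x] deriv_a[of n "X x t \<omega>"]]
    by (simp add: o_def n_def blinfun_compose.rep_eq)
  moreover have "continuous_on UNIV ?D"
    by (intro continuous_intros D continuous_on_compose2[OF cont_a' cX]) auto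
  moreover have "norm (?D x) \<le> L ^ Suc t" for x
    using norm_blinfun_compose[of "a' n (X x t \<omega>)" "D x"]
      mult_mono[OF bound_a'[of n "X x t \<omega>"] D(3)[of x] L_nonneg norm_ge_zero] by simp
  ultimately show ?case by (intro exI[of _ ?D] conjI allI)
qed

lemma chain_continuous: "continuous_on UNIV (\<lambda>x. X x t \<omega>)"
  using chain_derivative[of t \<omega>]
  by (meson differentiable_def differentiable_imp_continuous_on differentiable_on_def has_derivative_at_withinI)

lemma sensitivity_eq:
  assumes "((\<lambda>y. X y t \<omega>) has_derivative D) (at x)"
  shows "S x t \<omega> $ i $ j = D (axis j 1) $ i"
  using partial_eqI(2)[OF bounded_linear.has_derivative[OF bounded_linear_vec_nth, OF assms], of j i]
  by (simp add: sensitivity_def)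

lemma sensitivity_bound: "\<bar>S x t \<omega> $ i $ j\<bar> \<le> L ^ t"
proof -
  from chain_derivative[of t \<omega>] obtain D where
    D: "((\<lambda>y. X y t \<omega>) has_derivative blinfun_apply (D x)) (at x)" "norm (D x) \<le> L ^ t" by blast
  have "\<bar>D x (axis j 1) $ i\<bar> \<le> norm (D x (axis j 1))" by (rule component_le_norm_cart)
  also have "\<dots> \<le> norm (D x)" using norm_blinfun[of "D x" "axis j 1"] by simp
  finally show ?thesis using D by (simp add: sensitivity_eq[OF D(1)])
qed

lemma sensitivity_continuous: "continuous_on UNIV (\<lambda>x. S x t \<omega> $ i $ j)"
proof -
  from chain_derivative[of t \<omega>] obtain D where
    D: "\<And>x. ((\<lambda>y. X y t \<omega>) has_derivative blinfun_apply (D x)) (at x)" "continuous_on UNIV D" by blast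
  have "continuous_on UNIV (\<lambda>x. D x (axis j 1) $ i)" by (intro continuous_intros D)
  then show ?thesis by (simp add: sensitivity_eq[OF D(1)])
qed

text \<open>The sensitivity is a derivative in the initial state, hence a pointwise limit of
  difference quotients with increments 1/(n+1), each of which is jointly measurable.\<close>

lemma sensitivity_measurable_pair:
  "(\<lambda>z. S (fst z) t (snd z) $ i $ j) \<in> borel \<Otimes>\<^sub>M M \<rightarrow>\<^sub>M borel"
proof (rule borel_measurable_LIMSEQ_real)
  fix z :: "(real^'l) \<times> 'w"
  obtain x \<omega> where z: "z = (x, \<omega>)" by (cases z)
  define h where "h n = inverse (real (Suc n))" for n
  from chain_derivative[of t \<omega>] obtain D where
    D: "((\<lambda>y. X y t \<omega>) has_derivative blinfun_apply (D x)) (at x)" by blast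
  have "((\<lambda>s. X (x + s *\<^sub>R axis j 1) t \<omega> $ i) has_real_derivative S x t \<omega> $ i $ j) (at 0)"
    using has_partial_derivative[OF bounded_linear.has_derivative[OF bounded_linear_vec_nth, OF D], of j i] by (simp add: sensitivity_eq[OF D])
  then have "((\<lambda>s. (X (x + s *\<^sub>R axis j 1) t \<omega> $ i - X x t \<omega> $ i) / s) \<longlongrightarrow> S x t \<omega> $ i $ j) (at 0)"
    by (simp add: DERIV_def)
  moreover have "filterlim h (at 0) sequentially"
    unfolding filterlim_at h_def using LIMSEQ_inverse_real_of_nat by auto
  ultimately have "(\<lambda>n. (X (x + h n *\<^sub>R axis j 1) t \<omega> $ i - X x t \<omega> $ i) / h n) \<longlonglongrightarrow> S x t \<omega> $ i $ j"
    by (rule filterlim_compose)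
  then show "(\<lambda>n. (X (fst z + inverse (real (Suc n)) *\<^sub>R axis j 1) t (snd z) $ i - X (fst z) t (snd z) $ i) /
      inverse (real (Suc n))) \<longlonglongrightarrow> S (fst z) t (snd z) $ i $ j" by (simp add: z h_def)
next
  fix n :: nat
  show "(\<lambda>z. (X (fst z + inverse (real (Suc n)) *\<^sub>R axis j 1) t (snd z) $ i - X (fst z) t (snd z) $ i) /
      inverse (real (Suc n))) \<in> borel_measurable (borel \<Otimes>\<^sub>M M)" by measurable
qed

lemma sensitivity_measurable_pair' [measurable (raw)]:
  assumes [measurable]: "f \<in> K \<rightarrow>\<^sub>M borel" "g \<in> K \<rightarrow>\<^sub>M M"
  shows "(\<lambda>z. S (f z) t (g z) $ i $ j) \<in> K \<rightarrow>\<^sub>M borel"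
  using measurable_compose[OF measurable_Pair[OF assms] sensitivity_measurable_pair[of t i j]] by simp

text \<open>The sum is the component k of the transposed sensitivity applied to the gradient of f,
  that is, of the integrand of \<open>Q_op\<close>.\<close>

lemma has_derivative_along_chain:
  assumes "C1 f G"
  shows "((\<lambda>s. f (X (x + s *\<^sub>R axis k 1) t \<omega>)) has_real_derivative
     (\<Sum>j\<in>UNIV. S (x + u *\<^sub>R axis k 1) t \<omega> $ j $ k * G (X (x + u *\<^sub>R axis k 1) t \<omega>) $ j)) (at u)"
proof -
  let ?y = "x + u *\<^sub>R axis k 1"
  from chain_derivative[of t \<omega>] obtain D where
    D: "((\<lambda>y. X y t \<omega>) has_derivative blinfun_apply (D ?y)) (at ?y)" by blast
  have "((\<lambda>y. f (X y t \<omega>)) has_derivative (\<lambda>h. G (X ?y t \<omega>) \<bullet> D ?y h)) (at ?y)"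
    using diff_chain_at[OF D C1D(1)[OF assms]] by (simp add: o_def)
  note d = this
  have "partial k (\<lambda>y. f (X y t \<omega>)) ?y = (\<Sum>j\<in>UNIV. S ?y t \<omega> $ j $ k * G (X ?y t \<omega>) $ j)"
    using partial_eqI(2)[OF d, of k] by (simp add: inner_vec_def sensitivity_eq[OF D] mult.commute)
  with has_partial_shift[OF partial_eqI(1)[OF d]] show ?thesis by simp
qed

end

section \<open>Tightness and differentiation under the expectation\<close>

text \<open>A localised form of the theorem on uniform limits: the approximant and the neighbourhood
  may both depend on the error and on \<open>x0\<close>.\<close>

lemma isCont_approx:
  fixes F :: "'a::metric_space \<Rightarrow> real"
  assumes "\<And>e. e > 0 \<Longrightarrow> \<exists>G d. d > 0 \<and> isCont G x0 \<and> (\<forall>x\<in>ball x0 d. \<bar>F x - G x\<bar> \<le> e)"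
  shows "isCont F x0"
  unfolding continuous_at_eps_delta
proof (intro allI impI)
  fix e :: real assume e: "e > 0"
  then obtain G d where d: "d > 0" and G: "isCont G x0" and FG: "\<And>x. x \<in> ball x0 d \<Longrightarrow> \<bar>F x - G x\<bar> \<le> e/4"
    using assms[of "e/4"] by auto
  from G e obtain d' where d': "d' > 0" "\<And>x. dist x x0 < d' \<Longrightarrow> dist (G x) (G x0) < e/4"
    unfolding continuous_at_eps_delta by (metis divide_pos_pos zero_less_numeral)
  show "\<exists>d>0. \<forall>x'. dist x' x0 < d \<longrightarrow> dist (F x') (F x0) < e"
  proof (intro exI[of _ "min d d'"] conjI allI impI)
    fix x assume x: "dist x x0 < min d d'"
    then have "\<bar>F x - G x\<bar> \<le> e/4" "\<bar>F x0 - G x0\<bar> \<le> e/4" "\<bar>G x - G x0\<bar> < e/4"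
      using FG[of x] FG[of x0] d'(2)[of x] d(1) by (auto simp: dist_commute dist_real_def abs_minus_commute)
    then show "dist (F x) (F x0) < e" using e unfolding dist_real_def by linarith
  qed (use d d' in auto)
qed

lemma (in finite_measure) isCont_integral_bounded:
  fixes h :: "'b::metric_space \<Rightarrow> 'a \<Rightarrow> real"
  assumes "\<And>\<omega>. isCont (\<lambda>x. h x \<omega>) x0" and [measurable]: "\<And>x. h x \<in> borel_measurable M"
    and "\<And>x \<omega>. \<bar>h x \<omega>\<bar> \<le> B"
  shows "isCont (\<lambda>x. \<integral>\<omega>. h x \<omega> \<partial>M) x0"
  unfolding continuous_at_sequentially o_def
proof (intro allI impI)
  fix u :: "nat \<Rightarrow> 'b" assume u: "u \<longlonglongrightarrow> x0"
  show "(\<lambda>n. \<integral>\<omega>. h (u n) \<omega> \<partial>M) \<longlonglongrightarrow> (\<integral>\<omega>. h x0 \<omega> \<partial>M)"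
  proof (rule integral_dominated_convergence[where w="\<lambda>_. B"])
    show "AE \<omega> in M. (\<lambda>n. h (u n) \<omega>) \<longlonglongrightarrow> h x0 \<omega>"
      using isCont_tendsto_compose[OF assms(1) u] by auto
  qed (use assms(3) in auto)
qed

lemma compactly_supported_bounded:
  fixes f :: "real^'l \<Rightarrow> real"
  assumes "continuous_on UNIV f" and supp: "\<And>x. norm x > R \<Longrightarrow> f x = 0"
  obtains B where "0 \<le> B" "\<And>x. \<bar>f x\<bar> \<le> B"
proof -
  have "bounded (f ` cball 0 R)"
    using assms(1) by (intro compact_imp_bounded compact_continuous_image) (auto intro: continuous_on_subset)
  then obtain B where B: "B > 0" "\<And>x. x \<in> cball 0 R \<Longrightarrow> \<bar>f x\<bar> \<le> B"
    unfolding bounded_pos by auto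
  have "\<bar>f x\<bar> \<le> B" for x
    using B supp[of x] by (cases "norm x > R") auto
  with B(1) show thesis by (intro that[of B]) auto
qed

lemma integrable_vecI:
  fixes f :: "'a \<Rightarrow> real^'l"
  assumes "\<And>i. integrable K (\<lambda>x. f x $ i)"
  shows "integrable K f"
proof -
  have eq: "f = (\<lambda>x. \<Sum>i\<in>UNIV. f x $ i *\<^sub>R axis i 1)"
    using basis_expansion by (metis (no_types, lifting) scalar_mult_eq_scaleR sum.cong ext)
  have "integrable K (\<lambda>x. \<Sum>i\<in>UNIV. f x $ i *\<^sub>R axis i 1)"
    using assms by (intro Bochner_Integration.integrable_sum integrable_scaleR_left) auto
  then show ?thesis by (rule back_subst[of "integrable K", OF _ eq[symmetric]])
qed

section \<open>Uniform integrability along the chain and the gradient formula\<close>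

context noisy_chain
begin

text \<open>The tail is taken over states outside a ball and not over large values of
  \<open>f\<close>. A cutoff in space then leaves a compactly supported function, which is bounded
  when \<open>f\<close> is continuous.\<close>

definition tight :: "nat \<Rightarrow> (real^'l \<Rightarrow> real) \<Rightarrow> bool" where
  "tight t f \<longleftrightarrow> f \<in> borel_measurable borel \<and> (\<forall>x. integrable M (\<lambda>\<omega>. f (X x t \<omega>))) \<and>
     (\<forall>x0. \<forall>e>0. \<exists>R. \<exists>d>0. \<forall>x\<in>ball x0 d.
        (\<integral>\<omega>. \<bar>f (X x t \<omega>)\<bar> * indicator {y. R < norm y} (X x t \<omega>) \<partial>M) \<le> e)"

lemma tight_integrable: "tight t f \<Longrightarrow> integrable M (\<lambda>\<omega>. f (X x t \<omega>))"
  by (simp add: tight_def)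

lemma tight_abs: "tight t f \<Longrightarrow> tight t (\<lambda>x. \<bar>f x\<bar>)"
  by (auto simp: tight_def)

lemma weighted_expectation_integrable:
  assumes "tight t f" and [measurable]: "\<Phi> \<in> borel_measurable M" and K: "\<And>\<omega>. \<bar>\<Phi> \<omega>\<bar> \<le> K"
  shows "integrable M (\<lambda>\<omega>. \<Phi> \<omega> * f (X x t \<omega>))"
proof (rule Bochner_Integration.integrable_bound)
  note [measurable] = assms(1)[unfolded tight_def, THEN conjunct1]
  show "integrable M (\<lambda>\<omega>. K * f (X x t \<omega>))" using tight_integrable[OF assms(1)] by simp
  show "(\<lambda>\<omega>. \<Phi> \<omega> * f (X x t \<omega>)) \<in> borel_measurable M" by measurable
  have "\<bar>\<Phi> \<omega> * f (X x t \<omega>)\<bar> \<le> \<bar>K * f (X x t \<omega>)\<bar>" for \<omega>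
    using K[of \<omega>] by (auto simp: abs_mult intro!: mult_right_mono)
  then show "AE \<omega> in M. norm (\<Phi> \<omega> * f (X x t \<omega>)) \<le> norm (K * f (X x t \<omega>))" by simp
qed

text \<open>After the cutoff the integrand is bounded and dominated convergence applies; the part
  removed is at most \<open>K\<close> times a tail. The weight 1 yields continuity of P^t f, an
  entry of the sensitivity yields that of Q^t f.\<close>

lemma weighted_expectation_isCont:
  assumes t: "tight t f" and f: "continuous_on UNIV f"
    and \<Phi>: "\<And>\<omega>. continuous_on UNIV (\<lambda>x. \<Phi> x \<omega>)" and [measurable]: "\<And>x. \<Phi> x \<in> borel_measurable M"
    and K: "\<And>x \<omega>. \<bar>\<Phi> x \<omega>\<bar> \<le> K"
  shows "isCont (\<lambda>x. \<integral>\<omega>. \<Phi> x \<omega> * f (X x t \<omega>) \<partial>M) x0"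
proof (rule isCont_approx)
  note [measurable] = t[unfolded tight_def, THEN conjunct1]
  have K0: "K \<ge> 0" using K abs_ge_zero order_trans by blast
  fix e :: real assume e: "e > 0"
  \<comment> \<open>Adding 1 keeps the denominator positive when \<open>K\<close> is 0.\<close>
  define e1 where "e1 = e / (K + 1)"
  have e1: "e1 > 0" "K * e1 \<le> e"
    using e K0 by (auto simp: e1_def field_simps)
  with t obtain R d where d: "d > 0" and tail: "\<And>x. x \<in> ball x0 d \<Longrightarrow>
      (\<integral>\<omega>. \<bar>f (X x t \<omega>)\<bar> * indicator {y. R < norm y} (X x t \<omega>) \<partial>M) \<le> e1"
    unfolding tight_def by blast
  obtain \<psi> :: "real^'l \<Rightarrow> real" and \<Psi> R' where \<psi>: "C1 \<psi> \<Psi>" "\<And>x. 0 \<le> \<psi> x" "\<And>x. \<psi> x \<le> 1"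
    "\<And>x. norm x \<le> R \<Longrightarrow> \<psi> x = 1" "\<And>x. norm x > R' \<Longrightarrow> \<psi> x = 0"
    by (rule ex_cutoff[of R]) blast
  have c\<psi>: "continuous_on UNIV \<psi>" using C1_continuous[OF \<psi>(1)] .
  note [measurable] = borel_measurable_continuous_onI[OF c\<psi>]
  obtain B where B: "0 \<le> B" "\<And>x. \<bar>\<psi> x * f x\<bar> \<le> B"
    using compactly_supported_bounded[of "\<lambda>x. \<psi> x * f x" R'] c\<psi> f \<psi>(5)
    by (auto intro: continuous_on_mult)
  define G where "G x = (\<integral>\<omega>. \<Phi> x \<omega> * (\<psi> (X x t \<omega>) * f (X x t \<omega>)) \<partial>M)" for x
  have "isCont G x0"
    unfolding G_def
  proof (rule isCont_integral_bounded)
    show "isCont (\<lambda>x. \<Phi> x \<omega> * (\<psi> (X x t \<omega>) * f (X x t \<omega>))) x0" for \<omega>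
    proof -
      have "continuous_on UNIV (\<lambda>x. \<Phi> x \<omega> * (\<psi> (X x t \<omega>) * f (X x t \<omega>)))"
        by (intro continuous_on_mult \<Phi> continuous_on_compose2[OF c\<psi> chain_continuous]
            continuous_on_compose2[OF f chain_continuous]) auto
      then show ?thesis by (simp add: continuous_on_eq_continuous_at)
    qed
    show "\<bar>\<Phi> x \<omega> * (\<psi> (X x t \<omega>) * f (X x t \<omega>))\<bar> \<le> K * B" for x \<omega>
      unfolding abs_mult[of "\<Phi> x \<omega>"] by (rule mult_mono[OF K B(2) K0]) auto
  qed measurable
  moreover have "\<bar>(\<integral>\<omega>. \<Phi> x \<omega> * f (X x t \<omega>) \<partial>M) - G x\<bar> \<le> e" if x: "x \<in> ball x0 d" for x
  proof -
    have i1: "integrable M (\<lambda>\<omega>. \<Phi> x \<omega> * f (X x t \<omega>))"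
      by (rule weighted_expectation_integrable[OF t _ K]) measurable
    have i2: "integrable M (\<lambda>\<omega>. \<Phi> x \<omega> * (\<psi> (X x t \<omega>) * f (X x t \<omega>)))"
    proof (rule integrable_const_bound)
      show "AE \<omega> in M. norm (\<Phi> x \<omega> * (\<psi> (X x t \<omega>) * f (X x t \<omega>))) \<le> K * B"
        unfolding abs_mult[of "\<Phi> _ _"] real_norm_def using mult_mono[OF K B(2) K0] by auto
    qed measurable
    have i3: "integrable M (\<lambda>\<omega>. K * (\<bar>f (X x t \<omega>)\<bar> * indicator {y. R < norm y} (X x t \<omega>)))"
    proof (intro integrable_mult_right Bochner_Integration.integrable_bound[OF tight_integrable[OF tight_abs[OF t], of x]])
      show "AE \<omega> in M. norm (\<bar>f (X x t \<omega>)\<bar> * indicator {y. R < norm y} (X x t \<omega>)) \<le> norm \<bar>f (X x t \<omega>)\<bar>"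
        by (simp add: indicator_def)
    qed measurable
    have "(\<integral>\<omega>. \<Phi> x \<omega> * f (X x t \<omega>) \<partial>M) - G x
        = (\<integral>\<omega>. \<Phi> x \<omega> * f (X x t \<omega>) - \<Phi> x \<omega> * (\<psi> (X x t \<omega>) * f (X x t \<omega>)) \<partial>M)"
      unfolding G_def using i1 i2 by simp
    also have "\<bar>\<dots>\<bar> \<le> (\<integral>\<omega>. K * (\<bar>f (X x t \<omega>)\<bar> * indicator {y. R < norm y} (X x t \<omega>)) \<partial>M)"
    proof (rule order_trans[OF integral_abs_bound integral_mono])
      show "integrable M (\<lambda>\<omega>. \<bar>\<Phi> x \<omega> * f (X x t \<omega>) - \<Phi> x \<omega> * (\<psi> (X x t \<omega>) * f (X x t \<omega>))\<bar>)"
        using i1 i2 by simp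
      fix \<omega>
      have "\<bar>\<Phi> x \<omega> * f (X x t \<omega>) - \<Phi> x \<omega> * (\<psi> (X x t \<omega>) * f (X x t \<omega>))\<bar>
        = \<bar>\<Phi> x \<omega>\<bar> * (\<bar>f (X x t \<omega>)\<bar> * \<bar>1 - \<psi> (X x t \<omega>)\<bar>)"
        by (simp add: abs_mult[symmetric] algebra_simps)
      also have "\<dots> \<le> K * (\<bar>f (X x t \<omega>)\<bar> * indicator {y. R < norm y} (X x t \<omega>))"
        using K[of x \<omega>] K0 \<psi>(2-4)[of "X x t \<omega>"] by (intro mult_mono) (auto simp: indicator_def)
      finally show "\<bar>\<Phi> x \<omega> * f (X x t \<omega>) - \<Phi> x \<omega> * (\<psi> (X x t \<omega>) * f (X x t \<omega>))\<bar> \<le> \<dots>" .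
    qed (rule i3)
    also have "\<dots> \<le> K * e1" using tail[OF x] K0 by (simp add: mult_left_mono)
    finally show ?thesis using e1(2) by simp
  qed
  ultimately show "\<exists>G d. d > 0 \<and> isCont G x0 \<and> (\<forall>x\<in>ball x0 d. \<bar>(\<integral>\<omega>. \<Phi> x \<omega> * f (X x t \<omega>) \<partial>M) - G x\<bar> \<le> e)"
    using d by blast
qed

lemma P_continuous:
  assumes "tight t f" "continuous_on UNIV f"
  shows "continuous_on UNIV (P t f)"
proof -
  have "isCont (\<lambda>x. \<integral>\<omega>. 1 * f (X x t \<omega>) \<partial>M) x" for x
    by (rule weighted_expectation_isCont[where K=1, OF assms]) auto
  moreover have "P t f = (\<lambda>x. \<integral>\<omega>. 1 * f (X x t \<omega>) \<partial>M)"
    using P_eq_expectation[of f t] assms(1) by (auto simp: tight_def)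
  ultimately show ?thesis by (simp add: continuous_on_eq_continuous_at)
qed

lemma Q_comp_integrable:
  assumes "tight t f"
  shows "integrable M (\<lambda>\<omega>. S x t \<omega> $ j $ i * f (X x t \<omega>))"
  by (rule weighted_expectation_integrable[OF assms _ sensitivity_bound]) measurable

lemma Q_comp_continuous:
  assumes "tight t f" "continuous_on UNIV f"
  shows "continuous_on UNIV (Q_comp M a N t i j f)"
proof -
  have "isCont (\<lambda>x. \<integral>\<omega>. S x t \<omega> $ j $ i * f (X x t \<omega>) \<partial>M) x" for x
    by (rule weighted_expectation_isCont[OF assms sensitivity_continuous _ sensitivity_bound]) measurable
  then show ?thesis
    by (simp add: continuous_on_eq_continuous_at Q_comp_def[abs_def])
qed

lemma Q_op_eq:
  assumes "\<And>j. tight t (\<lambda>x. G x $ j)"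
  shows "integrable M (\<lambda>\<omega>. transpose (S x t \<omega>) *v G (X x t \<omega>))"
    "Q_op M a N t G x $ k = (\<Sum>j\<in>UNIV. Q_comp M a N t k j (\<lambda>x. G x $ j) x)"
proof -
  have comp: "(transpose (S x t \<omega>) *v G (X x t \<omega>)) $ i = (\<Sum>j\<in>UNIV. S x t \<omega> $ j $ i * G (X x t \<omega>) $ j)" for i \<omega>
    by (simp add: matrix_vector_mult_def transpose_def)
  show i: "integrable M (\<lambda>\<omega>. transpose (S x t \<omega>) *v G (X x t \<omega>))"
    by (rule integrable_vecI, unfold comp, intro Bochner_Integration.integrable_sum Q_comp_integrable[OF assms])
  show "Q_op M a N t G x $ k = (\<Sum>j\<in>UNIV. Q_comp M a N t k j (\<lambda>x. G x $ j) x)"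
    unfolding Q_op_def Q_comp_def
    using integral_bounded_linear[OF bounded_linear_vec_nth i, of k]
    unfolding comp by (simp add: Bochner_Integration.integral_sum Q_comp_integrable[OF assms])
qed

text \<open>The pathwise fundamental theorem of calculus along a coordinate line is averaged over
  the noise. Fubini only asks for an integrable bound along the line, and continuity of Q^t G then
  permits differentiating the resulting integral.\<close>

lemma C1_P:
  assumes C: "C1 f G" and tf: "tight t f" and tG: "\<And>j. tight t (\<lambda>x. G x $ j)"
  shows "C1 (P t f) (Q_op M a N t G)"
proof -
  note [measurable] = tf[unfolded tight_def, THEN conjunct1]
  have cG: "continuous_on UNIV (\<lambda>x. G x $ j)" for j
    using C1D(2)[OF C] by (intro continuous_intros)
  have [measurable]: "(\<lambda>x. G x $ j) \<in> borel_measurable borel" for j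
    by (rule borel_measurable_continuous_onI[OF cG])
  have cQ: "continuous_on UNIV (\<lambda>x. Q_op M a N t G x $ k)" for k
    unfolding Q_op_eq(2)[OF tG] using Q_comp_continuous[OF tG cG] by (intro continuous_on_sum) auto
  have der: "((\<lambda>s. P t f (x + s *\<^sub>R axis k 1)) has_real_derivative Q_op M a N t G x $ k) (at 0)" for x k
  proof -
    let ?y = "\<lambda>u. x + u *\<^sub>R axis k (1::real)"
    define \<phi> where "\<phi> u \<omega> = (\<Sum>j\<in>UNIV. S (?y u) t \<omega> $ j $ k * G (X (?y u) t \<omega>) $ j)" for u \<omega>
    define q where "q u = Q_op M a N t G (?y u) $ k" for u
    \<comment> \<open>This majorant of the expected absolute value of \<open>\<phi>\<close> is
      continuous in u by tightness of the components of G, hence integrable over bounded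
      intervals.\<close>
    define m where "m u = (\<Sum>j\<in>UNIV. L ^ t * (\<integral>\<omega>. \<bar>G (X (?y u) t \<omega>) $ j\<bar> \<partial>M))" for u
    have cy: "continuous_on UNIV ?y" by (intro continuous_intros)
    have cq: "continuous_on UNIV q" unfolding q_def by (rule continuous_on_compose2[OF cQ cy]) auto
    have q: "q u = (\<integral>\<omega>. \<phi> u \<omega> \<partial>M)" for u
      unfolding q_def Q_op_eq(2)[OF tG] Q_comp_def \<phi>_def
      by (rule Bochner_Integration.integral_sum[symmetric]) (rule Q_comp_integrable[OF tG])
    have cm: "continuous_on UNIV m"
    proof -
      have "continuous_on UNIV (\<lambda>x. P t (\<lambda>x. \<bar>G x $ j\<bar>) x)" for j
        by (intro P_continuous tight_abs tG continuous_on_rabs cG)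
      then have "continuous_on UNIV (\<lambda>u. P t (\<lambda>x. \<bar>G x $ j\<bar>) (?y u))" for j
        by (rule continuous_on_compose2[OF _ cy]) auto
      then show ?thesis unfolding m_def by (simp add: P_eq_expectation continuous_intros)
    qed
    have \<phi>i: "integrable M (\<phi> u)" for u
      unfolding \<phi>_def by (intro Bochner_Integration.integrable_sum Q_comp_integrable[OF tG])
    have \<phi>m: "(\<integral>\<omega>. \<bar>\<phi> u \<omega>\<bar> \<partial>M) \<le> m u" for u
    proof -
      have gi: "integrable M (\<lambda>\<omega>. L ^ t * \<bar>G (X (?y u) t \<omega>) $ j\<bar>)" for j
        using tight_integrable[OF tight_abs[OF tG]] by simp
      have "(\<integral>\<omega>. \<bar>\<phi> u \<omega>\<bar> \<partial>M) \<le> (\<integral>\<omega>. (\<Sum>j\<in>UNIV. L ^ t * \<bar>G (X (?y u) t \<omega>) $ j\<bar>) \<partial>M)"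
      proof (rule integral_mono)
        show "integrable M (\<lambda>\<omega>. \<bar>\<phi> u \<omega>\<bar>)" using \<phi>i by simp
        fix \<omega> show "\<bar>\<phi> u \<omega>\<bar> \<le> (\<Sum>j\<in>UNIV. L ^ t * \<bar>G (X (?y u) t \<omega>) $ j\<bar>)"
          unfolding \<phi>_def
          by (rule order_trans[OF sum_abs sum_mono]) (simp add: abs_mult mult_right_mono sensitivity_bound)
      qed (use gi in auto)
      also have "\<dots> = m u" unfolding m_def by (subst Bochner_Integration.integral_sum) (use gi in auto)
      finally show ?thesis .
    qed
    have \<phi>meas[measurable]: "(\<lambda>z. \<phi> (fst z) (snd z)) \<in> borel_measurable (lborel \<Otimes>\<^sub>M M)"
      unfolding \<phi>_def by measurable
    interpret LM: pair_sigma_finite lborel M ..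
    \<comment> \<open>Starting at -1 makes 0 an interior point of the interval of integration, so
      the derivative at 0 is two-sided.\<close>
    have main: "P t f (?y s) - P t f (?y (-1)) = integral {-1..s} q" if s: "-1 \<le> s" for s
    proof -
      define F where "F z = indicator {-1..s} (fst z) * \<phi> (fst z) (snd z)" for z
      have [measurable]: "F \<in> borel_measurable (lborel \<Otimes>\<^sub>M M)" unfolding F_def by measurable
      have iF: "integrable (lborel \<Otimes>\<^sub>M M) F"
      proof (rule LM.Fubini_integrable)
        show "AE u in lborel. integrable M (\<lambda>\<omega>. F (u, \<omega>))" using \<phi>i by (auto simp: F_def)
        show "integrable lborel (\<lambda>u. \<integral>\<omega>. norm (F (u, \<omega>)) \<partial>M)"
        proof (rule Bochner_Integration.integrable_bound)
          show "integrable lborel (\<lambda>u. indicator {-1..s} u *\<^sub>R m u)"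
            by (rule borel_integrable_compact) (auto intro: continuous_on_subset[OF cm])
          have "norm (\<integral>\<omega>. norm (F (u, \<omega>)) \<partial>M) \<le> norm (indicator {-1..s} u *\<^sub>R m u)" for u
            using \<phi>m[of u] by (auto simp: F_def abs_mult indicator_def)
          then show "AE u in lborel. norm (\<integral>\<omega>. norm (F (u, \<omega>)) \<partial>M) \<le> norm (indicator {-1..s} u *\<^sub>R m u)" by simp
        qed measurable
      qed measurable
      have FTC: "(\<integral>u. F (u, \<omega>) \<partial>lborel) = f (X (?y s) t \<omega>) - f (X (?y (-1)) t \<omega>)" for \<omega>
      proof -
        have "(\<integral>u. \<phi> u \<omega> * indicator {-1..s} u \<partial>lborel) = f (X (?y s) t \<omega>) - f (X (?y (-1)) t \<omega>)"
        proof (rule integral_FTC_Icc_real[OF s])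
          fix u
          show "DERIV (\<lambda>u. f (X (?y u) t \<omega>)) u :> \<phi> u \<omega>"
            unfolding \<phi>_def by (rule has_derivative_along_chain[OF C])
          have "continuous_on UNIV (\<lambda>u. \<phi> u \<omega>)" unfolding \<phi>_def
            by (intro continuous_on_sum continuous_on_mult continuous_on_compose2[OF sensitivity_continuous cy]
                continuous_on_compose2[OF cG] continuous_on_compose2[OF chain_continuous cy]) auto
          then show "isCont (\<lambda>u. \<phi> u \<omega>) u" by (simp add: continuous_on_eq_continuous_at)
        qed
        then show ?thesis by (simp add: F_def mult.commute)
      qed
      have "integral {-1..s} q = (LINT u:{-1..s}|lborel. q u)"
        by (rule set_borel_integral_eq_integral(2)[symmetric],
            rule borel_integrable_atLeastAtMost', rule continuous_on_subset[OF cq]) auto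
      also have "\<dots> = (\<integral>u. \<integral>\<omega>. F (u, \<omega>) \<partial>M \<partial>lborel)"
        by (simp add: set_lebesgue_integral_def q F_def)
      also have "\<dots> = (\<integral>\<omega>. \<integral>u. F (u, \<omega>) \<partial>lborel \<partial>M)"
        using LM.Fubini_integral[of "\<lambda>u \<omega>. F (u, \<omega>)"] iF by simp
      also have "\<dots> = P t f (?y s) - P t f (?y (-1))"
        unfolding FTC using tight_integrable[OF tf] by (simp add: P_eq_expectation)
      finally show ?thesis by simp
    qed
    have "((\<lambda>s. integral {-1..s} q) has_real_derivative q 0) (at 0 within {-1..1})"
      by (rule integral_has_real_derivative) (auto intro: continuous_on_subset[OF cq])
    then have "((\<lambda>s. integral {-1..s} q + P t f (?y (-1))) has_real_derivative q 0) (at 0)"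
      by (auto simp: at_within_Icc_at intro!: derivative_eq_intros)
    moreover have "\<forall>\<^sub>F s in nhds 0. P t f (?y s) = integral {-1..s} q + P t f (?y (-1))"
    proof -
      have "\<forall>\<^sub>F s in nhds (0::real). s \<in> {-1<..}" by (rule eventually_nhds_in_open) auto
      then show ?thesis
      proof (rule eventually_mono)
        fix s :: real assume "s \<in> {-1<..}"
        then show "P t f (?y s) = integral {-1..s} q + P t f (?y (-1))" using main[of s] by simp
      qed
    qed
    ultimately have "((\<lambda>s. P t f (?y s)) has_real_derivative q 0) (at 0)"
      using DERIV_cong_ev[OF refl _ refl] by fast
    then show ?thesis by (simp add: q_def)
  qed
  then have hp: "has_partial k (P t f) x" and pe: "partial k (P t f) x = Q_op M a N t G x $ k" for k x
    unfolding has_partial_def partial_def by (auto simp: real_differentiable_def DERIV_imp_deriv)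
  have "continuous_on UNIV (partial k (P t f))" for k
    using cQ[of k] by (simp add: pe[abs_def] cong: continuous_on_cong)
  then show ?thesis
    unfolding C1_iff using hp pe by (auto simp: grad_def vec_eq_iff fun_eq_iff)
qed

end

section \<open>Consequences of the drift condition\<close>

text \<open>Compact sublevel sets are bounded, so \<open>F\<close> tends to infinity. This converts
  the decay gained from \<open>W\<close> or \<open>V\<close> into smallness outside a ball.\<close>

lemma exp_neg_compact_sublevels:
  fixes F :: "real^'l \<Rightarrow> real"
  assumes "\<And>r. r \<ge> 0 \<Longrightarrow> compact {x. F x \<le> r}" and "\<gamma> > 0" "e > 0"
  obtains r where "\<And>x. norm x > r \<Longrightarrow> exp (- \<gamma> * F x) \<le> e"
proof -
  define R where "R = max 0 (- ln e / \<gamma>)"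
  have "bounded {x. F x \<le> R}" using assms(1)[of R] by (intro compact_imp_bounded) (auto simp: R_def)
  then obtain r where r: "\<And>x. F x \<le> R \<Longrightarrow> norm x \<le> r" by (auto simp: bounded_iff)
  show thesis
  proof (rule that[of r])
    fix x :: "real^'l" assume "norm x > r"
    then have "F x > R" using r[of x] by linarith
    then have "- ln e / \<gamma> \<le> F x" by (simp add: R_def)
    then have "- \<gamma> * F x \<le> ln e" using assms(2) by (simp add: field_simps)
    then have "exp (- \<gamma> * F x) \<le> exp (ln e)" by simp
    then show "exp (- \<gamma> * F x) \<le> e" using assms(3) by simp
  qed
qed

section \<open>Weighted norms as pointwise bounds\<close>

lemma wnorm_le_iff:
  assumes "\<And>x. w x > 0" "0 \<le> c"
  shows "wnorm w f \<le> ennreal c \<longleftrightarrow> (\<forall>x. \<bar>f x\<bar> \<le> c * w x)"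
proof -
  have "ennreal (\<bar>f x\<bar> / w x) \<le> ennreal c \<longleftrightarrow> \<bar>f x\<bar> \<le> c * w x" for x
    using assms(1)[of x] assms(2) by (simp add: ennreal_le_iff pos_divide_le_eq)
  then show ?thesis by (simp add: wnorm_def SUP_le_iff)
qed

lemma wnorm_finite:
  assumes "\<And>x. w x > 0" "wnorm w f < \<infinity>"
  obtains c where "0 \<le> c" "wnorm w f = ennreal c" "\<And>x. \<bar>f x\<bar> \<le> c * w x"
proof -
  obtain c where c: "0 \<le> c" "wnorm w f = ennreal c" using assms(2) by (cases "wnorm w f") auto
  then show thesis using wnorm_le_iff[of w c f] assms(1) that by auto
qed

lemma mem_L_inf_iff:
  assumes "\<And>x. w x > 0"
  shows "f \<in> L_inf w \<longleftrightarrow> f \<in> borel_measurable borel \<and> (\<exists>c\<ge>0. \<forall>x. \<bar>f x\<bar> \<le> c * w x)"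
proof (intro iffI conjI)
  assume "f \<in> L_inf w"
  then have fin: "wnorm w f < \<infinity>" by (simp add: L_inf_def)
  obtain c where "0 \<le> c" "\<And>x. \<bar>f x\<bar> \<le> c * w x"
    by (rule wnorm_finite[of w f, OF assms fin]) (rule that)
  then show "\<exists>c\<ge>0. \<forall>x. \<bar>f x\<bar> \<le> c * w x" by blast
next
  assume f: "f \<in> borel_measurable borel \<and> (\<exists>c\<ge>0. \<forall>x. \<bar>f x\<bar> \<le> c * w x)"
  then obtain c where "c \<ge> 0" "\<And>x. \<bar>f x\<bar> \<le> c * w x" by blast
  then have "wnorm w f \<le> ennreal c" using wnorm_le_iff[of w c f, OF assms] by blast
  from le_less_trans[OF this ennreal_less_top] f show "f \<in> L_inf w" by (simp add: L_inf_def)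
qed (simp add: L_inf_def)

lemma mem_L_inf0_iff:
  assumes "\<And>x. w x > 0"
  shows "f \<in> L_inf0 w \<longleftrightarrow> continuous_on UNIV f \<and> (\<exists>c\<ge>0. \<forall>x. \<bar>f x\<bar> \<le> c * w x)"
  unfolding L_inf0_def by (auto simp: mem_L_inf_iff[of w f] assms borel_measurable_continuous_onI)

lemma mem_L_inf1_iff:
  assumes w: "\<And>x. w x > 0"
  shows "f \<in> L_inf1 w \<longleftrightarrow> (\<exists>G. C1 f G \<and> (\<exists>c\<ge>0. \<forall>x. \<bar>f x\<bar> \<le> c * w x \<and> (\<forall>i. \<bar>G x $ i\<bar> \<le> c * w x)))"
proof
  assume f: "f \<in> L_inf1 w"
  then have C: "C1 f (grad f)"
    by (intro continuous_partials_imp_C1) (auto simp: L_inf1_def L_inf0_def)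
  from f obtain c where c: "c \<ge> 0" "\<And>x. \<bar>f x\<bar> \<le> c * w x"
    by (auto simp: L_inf1_def mem_L_inf0_iff[OF w])
  from f have "\<forall>i. \<exists>c\<ge>0. \<forall>x. \<bar>partial i f x\<bar> \<le> c * w x"
    by (auto simp: L_inf1_def mem_L_inf0_iff[OF w])
  then obtain d where d: "\<And>i. d i \<ge> 0" "\<And>i x. \<bar>partial i f x\<bar> \<le> d i * w x" by metis
  define m where "m = c + (\<Sum>i\<in>UNIV. d i)"
  have m: "c \<le> m" "d i \<le> m" for i
    using c(1) d(1) sum_nonneg_leq_bound[of UNIV d "\<Sum>i\<in>UNIV. d i" i] by (auto simp: m_def sum_nonneg intro: add_increasing)
  have "\<forall>x. \<bar>f x\<bar> \<le> m * w x \<and> (\<forall>i. \<bar>grad f x $ i\<bar> \<le> m * w x)"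
    using c(2) d(2) m w by (auto simp: grad_def less_imp_le intro!: order_trans[OF _ mult_right_mono[of _ m]])
  with C show "\<exists>G. C1 f G \<and> (\<exists>c\<ge>0. \<forall>x. \<bar>f x\<bar> \<le> c * w x \<and> (\<forall>i. \<bar>G x $ i\<bar> \<le> c * w x))"
    using m(1) c(1) by (intro exI[of _ "grad f"] conjI exI[of _ m]) auto
next
  assume "\<exists>G. C1 f G \<and> (\<exists>c\<ge>0. \<forall>x. \<bar>f x\<bar> \<le> c * w x \<and> (\<forall>i. \<bar>G x $ i\<bar> \<le> c * w x))"
  then obtain G c where C: "C1 f G" and c: "c \<ge> 0" "\<And>x. \<bar>f x\<bar> \<le> c * w x" "\<And>x i. \<bar>G x $ i\<bar> \<le> c * w x" by blast
  have "partial i f \<in> L_inf0 w" for i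
    using C c unfolding mem_L_inf0_iff[OF w] by (auto simp: C1_iff C1_partial(2)[OF C])
  then show "f \<in> L_inf1 w"
    using C c C1_continuous[OF C] by (auto simp: L_inf1_def mem_L_inf0_iff[OF w] C1_partial[OF C])
qed

text \<open>(A2) only fixes integrals of the density over Borel sets, so nonnegativity has to be
  derived. Over the set where \<open>q\<close> is negative the integral is a measure, hence
  nonnegative, and that set must be null.\<close>

lemma kernel_eq_density:
  fixes K :: "(real^'l) measure" and q :: "real^'l \<Rightarrow> real"
  assumes K: "finite_measure K" "sets K = sets borel"
    and q: "\<And>A. A \<in> sets borel \<Longrightarrow> set_integrable lborel A q \<and> measure K A = (LINT y:A|lborel. q y)"
  shows "AE y in lborel. 0 \<le> q y" "K = density lborel (\<lambda>y. ennreal (q y))"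
proof -
  interpret K: finite_measure K by fact
  have iq: "integrable lborel q" using q[of UNIV] by (simp add: set_integrable_def)
  then have [measurable]: "q \<in> borel_measurable borel" by auto
  define A where "A = {y. q y < 0}"
  have A[measurable]: "A \<in> sets borel" unfolding A_def by measurable
  have "(\<integral>y. - (indicator A y * q y) \<partial>lborel) = 0"
  proof (rule antisym)
    have "0 \<le> (LINT y:A|lborel. q y)" using q[OF A] measure_nonneg[of K A] by simp
    then show "(\<integral>y. - (indicator A y * q y) \<partial>lborel) \<le> 0"
      by (simp add: set_lebesgue_integral_def)
    show "0 \<le> (\<integral>y. - (indicator A y * q y) \<partial>lborel)"
      by (rule integral_nonneg_AE) (auto simp: A_def indicator_def)
  qed
  then have "AE y in lborel. - (indicator A y * q y) = 0"
    using q[OF A] by (subst (asm) integral_nonneg_eq_0_iff_AE) (auto simp: A_def indicator_def set_integrable_def)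
  then show nn: "AE y in lborel. 0 \<le> q y"
    by eventually_elim (auto simp: A_def indicator_def split: if_splits)
  show "K = density lborel (\<lambda>y. ennreal (q y))"
  proof (rule measure_eqI)
    fix A assume "A \<in> sets K"
    then have A[measurable]: "A \<in> sets borel" using K by simp
    have "emeasure (density lborel (\<lambda>y. ennreal (q y))) A = (\<integral>\<^sup>+y. ennreal (q y) * indicator A y \<partial>lborel)"
      by (rule emeasure_density) auto
    also have "\<dots> = (\<integral>\<^sup>+y. ennreal (indicator A y * q y) \<partial>lborel)"
      by (intro nn_integral_cong) (auto simp: indicator_def)
    also have "\<dots> = ennreal (\<integral>y. indicator A y * q y \<partial>lborel)"
      using q[OF A] nn by (intro nn_integral_eq_integral) (auto simp: set_integrable_def)
    also have "\<dots> = emeasure K A"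
      using q[OF A] by (simp add: K.emeasure_eq_measure set_lebesgue_integral_def)
    finally show "emeasure K A = emeasure (density lborel (\<lambda>y. ennreal (q y))) A" by simp
  qed (use K in simp)
qed

text \<open>(DV3) is taken in exponentiated form, with the contribution of the compact set bounded
  by a constant \<open>B\<close>. Extended integrals allow it to be iterated before integrability is
  known. The gradient of the density joins in \<open>smooth_dv3_chain\<close>.\<close>

locale dv3_chain = noisy_chain M a N a' L
  for M :: "'w measure" and a :: "real^'l \<Rightarrow> real^'m \<Rightarrow> real^'l" and N a' L +
  fixes V W :: "real^'l \<Rightarrow> real" and \<delta> B :: real and t0 :: nat and p :: "(real^'l) \<times> (real^'l) \<Rightarrow> real"
  assumes V_pos: "\<And>x. V x > 0" and cont_V: "continuous_on UNIV V"
    and V_sub: "\<And>r. r \<ge> 0 \<Longrightarrow> compact {x. V x \<le> r}"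
    and W_ge1: "\<And>x. W x \<ge> 1" and cont_W: "continuous_on UNIV W"
    and W_sub: "\<And>r. r \<ge> 0 \<Longrightarrow> compact {x. W x \<le> r}"
    and \<delta>: "\<delta> > 0" and B: "B \<ge> 0"
    and drift: "\<And>x. (\<integral>\<^sup>+\<omega>. ennreal (exp (V (X x 1 \<omega>))) \<partial>M) \<le> ennreal (exp (V x + B - \<delta> * W x))"
    and t0: "t0 \<ge> 1" and cont_p: "continuous_on UNIV p"
    and density: "\<And>x A. A \<in> sets borel \<Longrightarrow> set_integrable lborel A (\<lambda>y. p (x, y)) \<and>
           measure (kernel M a N t0 x) A = (LINT y:A|lborel. p (x, y))"
begin

section \<open>Iterated drift and local control of the tails\<close>

lemma V_measurable [measurable]: "V \<in> borel_measurable borel"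
  by (rule borel_measurable_continuous_onI[OF cont_V])

lemma W_measurable [measurable]: "W \<in> borel_measurable borel"
  by (rule borel_measurable_continuous_onI[OF cont_W])

lemma p_measurable [measurable]: "p \<in> borel_measurable borel"
  by (rule borel_measurable_continuous_onI[OF cont_p])

lemma W_pos: "W x > 0"
  using W_ge1[of x] by linarith

lemma drift_weak: "(\<integral>\<^sup>+\<omega>. ennreal (exp (V (X x t \<omega>))) \<partial>M) \<le> ennreal (exp (V x + real t * B))"
proof (induct t arbitrary: x)
  case 0
  then show ?case by (simp add: emeasure_space_1)
next
  case (Suc t)
  have "(\<integral>\<^sup>+\<omega>. ennreal (exp (V (X x (1 + t) \<omega>))) \<partial>M)
     = (\<integral>\<^sup>+\<omega>. \<integral>\<^sup>+\<omega>'. ennreal (exp (V (X (X x 1 \<omega>) t \<omega>'))) \<partial>M \<partial>M)"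
    by (rule nn_integral_markov) measurable
  also have "\<dots> \<le> (\<integral>\<^sup>+\<omega>. ennreal (exp (V (X x 1 \<omega>) + real t * B)) \<partial>M)"
    by (rule nn_integral_mono) (rule Suc)
  also have "\<dots> = ennreal (exp (real t * B)) * (\<integral>\<^sup>+\<omega>. ennreal (exp (V (X x 1 \<omega>))) \<partial>M)"
    by (subst nn_integral_cmult[symmetric]) (auto simp: exp_add ennreal_mult[symmetric] mult.commute simp del: chain.simps)
  also have "\<dots> \<le> ennreal (exp (real t * B)) * ennreal (exp (V x + B - \<delta> * W x))"
    by (rule mult_left_mono[OF drift]) simp
  also have "\<dots> \<le> ennreal (exp (V x + real (Suc t) * B))"
    using \<delta> W_pos[of x] by (auto simp: ennreal_mult[symmetric] exp_add[symmetric] algebra_simps intro!: ennreal_leI)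
  finally show ?case by simp
qed

text \<open>The gain in \<open>W\<close> has to appear at the initial state, so it is kept for the
  first step only; the later steps are estimated by \<open>drift_weak\<close>.\<close>

lemma drift_iterated:
  assumes "t \<ge> 1"
  shows "(\<integral>\<^sup>+\<omega>. ennreal (exp (V (X x t \<omega>))) \<partial>M) \<le> ennreal (exp (V x + real t * B - \<delta> * W x))"
proof -
  obtain k where t: "t = 1 + k" using assms by (metis le_Suc_ex)
  have "(\<integral>\<^sup>+\<omega>. ennreal (exp (V (X x t \<omega>))) \<partial>M)
     = (\<integral>\<^sup>+\<omega>. \<integral>\<^sup>+\<omega>'. ennreal (exp (V (X (X x 1 \<omega>) k \<omega>'))) \<partial>M \<partial>M)"
    unfolding t by (rule nn_integral_markov) measurable
  also have "\<dots> \<le> (\<integral>\<^sup>+\<omega>. ennreal (exp (V (X x 1 \<omega>) + real k * B)) \<partial>M)"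
    by (rule nn_integral_mono) (rule drift_weak)
  also have "\<dots> = ennreal (exp (real k * B)) * (\<integral>\<^sup>+\<omega>. ennreal (exp (V (X x 1 \<omega>))) \<partial>M)"
    by (subst nn_integral_cmult[symmetric]) (auto simp: exp_add ennreal_mult[symmetric] mult.commute simp del: chain.simps)
  also have "\<dots> \<le> ennreal (exp (real k * B)) * ennreal (exp (V x + B - \<delta> * W x))"
    by (rule mult_left_mono[OF drift]) simp
  also have "\<dots> = ennreal (exp (V x + real t * B - \<delta> * W x))"
    by (simp add: t ennreal_mult[symmetric] exp_add[symmetric] algebra_simps)
  finally show ?thesis .
qed

lemma exp_V_integrable: "integrable M (\<lambda>\<omega>. exp (V (X x t \<omega>)))"
  using drift_weak[of x t]
  by (intro integrableI_bounded) (auto intro: le_less_trans)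

lemma exp_V_expectation_weak: "(\<integral>\<omega>. exp (V (X x t \<omega>)) \<partial>M) \<le> exp (V x + real t * B)"
  using drift_weak[of x t] by (subst (asm) nn_integral_eq_integral[OF exp_V_integrable]) auto

lemma exp_V_expectation: "t \<ge> 1 \<Longrightarrow> (\<integral>\<omega>. exp (V (X x t \<omega>)) \<partial>M) \<le> exp (V x + real t * B - \<delta> * W x)"
  using drift_iterated[of t x] by (subst (asm) nn_integral_eq_integral[OF exp_V_integrable]) auto

text \<open>Convexity of the exponential plays the role of Jensen's inequality for \<open>s \<mapsto> s\<^sup>\<eta>\<close>.\<close>

lemma weight_expectation:
  assumes \<eta>: "0 < \<eta>" "\<eta> \<le> 1" and t: "t \<ge> 1"
  shows "integrable M (\<lambda>\<omega>. exp (\<eta> * V (X x t \<omega>)))"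
    "(\<integral>\<omega>. exp (\<eta> * V (X x t \<omega>)) \<partial>M) \<le> exp (real t * B) * exp (\<eta> * V x) * exp (- (\<eta> * \<delta>) * W x)"
proof -
  \<comment> \<open>By \<open>exp_V_expectation\<close>, \<open>exp c\<close> bounds the expectation
    of \<open>exp V\<close> after t steps. Centred at this c, the convexity bound integrates to
    exactly \<open>exp (\<eta> * c)\<close>.\<close>
  define c where "c = V x + real t * B - \<delta> * W x"
  have le: "exp (\<eta> * V y) \<le> exp (\<eta> * c) * (\<eta> * (exp (V y) * exp (- c)) + (1 - \<eta>))" for y
  proof -
    have "exp ((1 - \<eta>) *\<^sub>R 0 + \<eta> *\<^sub>R (V y - c)) \<le> (1 - \<eta>) * exp 0 + \<eta> * exp (V y - c)"
      using convex_onD[OF exp_convex, of \<eta> 0 "V y - c"] \<eta> by simp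
    then have "exp (\<eta> * (V y - c)) \<le> \<eta> * (exp (V y) * exp (- c)) + (1 - \<eta>)"
      by (simp add: exp_diff exp_minus divide_inverse)
    then have "exp (\<eta> * c) * exp (\<eta> * (V y - c)) \<le> exp (\<eta> * c) * (\<eta> * (exp (V y) * exp (- c)) + (1 - \<eta>))"
      by (rule mult_left_mono) simp
    then show ?thesis by (simp add: exp_add[symmetric] algebra_simps)
  qed
  have bi: "integrable M (\<lambda>\<omega>. exp (\<eta> * c) * (\<eta> * (exp (V (X x t \<omega>)) * exp (- c)) + (1 - \<eta>)))"
    using exp_V_integrable by simp
  show i: "integrable M (\<lambda>\<omega>. exp (\<eta> * V (X x t \<omega>)))"
  proof (rule Bochner_Integration.integrable_bound[OF bi])
    show "AE \<omega> in M. norm (exp (\<eta> * V (X x t \<omega>))) \<le> norm (exp (\<eta> * c) * (\<eta> * (exp (V (X x t \<omega>)) * exp (- c)) + (1 - \<eta>)))"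
      using order_trans[OF le abs_ge_self] by simp
  qed measurable
  have "(\<integral>\<omega>. exp (\<eta> * V (X x t \<omega>)) \<partial>M)
      \<le> (\<integral>\<omega>. exp (\<eta> * c) * (\<eta> * (exp (V (X x t \<omega>)) * exp (- c)) + (1 - \<eta>)) \<partial>M)"
    by (rule integral_mono[OF i bi le])
  also have "\<dots> = exp (\<eta> * c) * (\<eta> * ((\<integral>\<omega>. exp (V (X x t \<omega>)) \<partial>M) * exp (- c)) + (1 - \<eta>))"
    using exp_V_integrable by (simp add: prob_space)
  also have "\<dots> \<le> exp (\<eta> * c) * (\<eta> * (exp c * exp (- c)) + (1 - \<eta>))"
    using exp_V_expectation[OF t, of x] \<eta>
    by (intro mult_left_mono add_right_mono mult_right_mono) (auto simp: c_def)
  also have "\<dots> = exp (\<eta> * c)" by (simp add: exp_add[symmetric])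
  \<comment> \<open>Rounding \<open>\<eta> * (t * B)\<close> up to \<open>t * B\<close> makes the
    constant independent of \<eta>.\<close>
  also have "\<dots> \<le> exp (real t * B + \<eta> * V x - \<eta> * \<delta> * W x)"
    using mult_right_mono[of \<eta> 1 "real t * B"] \<eta> B by (simp add: c_def algebra_simps)
  finally show "(\<integral>\<omega>. exp (\<eta> * V (X x t \<omega>)) \<partial>M) \<le> exp (real t * B) * exp (\<eta> * V x) * exp (- (\<eta> * \<delta>) * W x)"
    by (simp add: exp_add[symmetric] algebra_simps)
qed

lemma dominated_integrable:
  assumes [measurable]: "f \<in> borel_measurable borel" and f: "\<And>x. \<bar>f x\<bar> \<le> c * exp (V x)"
  shows "integrable M (\<lambda>\<omega>. f (X x t \<omega>))"
proof (rule Bochner_Integration.integrable_bound)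
  show "integrable M (\<lambda>\<omega>. c * exp (V (X x t \<omega>)))" using exp_V_integrable by simp
  show "AE \<omega> in M. norm (f (X x t \<omega>)) \<le> norm (c * exp (V (X x t \<omega>)))"
    using order_trans[OF f abs_ge_self] by simp
qed measurable

lemma weight_le_exp_V: "\<eta> \<le> 1 \<Longrightarrow> exp (\<eta> * V x) \<le> exp (V x)"
  using V_pos[of x] mult_right_mono[of \<eta> 1 "V x"] by simp

lemma weight_ge_1: "0 < \<eta> \<Longrightarrow> 1 \<le> exp (\<eta> * V x)"
  using V_pos[of x] by simp

lemma weighted_dominated:
  assumes "\<eta> \<le> 1" "0 \<le> c" "\<And>x. \<bar>f x\<bar> \<le> c * exp (\<eta> * V x)"
  shows "\<bar>f x\<bar> \<le> c * exp (V x)"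
  using assms(3)[of x] mult_left_mono[OF weight_le_exp_V[OF assms(1), of x] assms(2)] by linarith

lemma exp_V_locally_bounded: "\<exists>d>0. \<forall>x\<in>ball x0 d. exp (V x) \<le> exp (V x0) + 1"
proof -
  have "isCont (\<lambda>x. exp (V x)) x0"
    using cont_V by (auto simp: continuous_on_eq_continuous_at intro: continuous_intros)
  then obtain d where d: "d > 0" "\<And>x. dist x x0 < d \<Longrightarrow> dist (exp (V x)) (exp (V x0)) < 1"
    unfolding continuous_at_eps_delta by (metis zero_less_one)
  have "exp (V x) \<le> exp (V x0) + 1" if "x \<in> ball x0 d" for x
    using d(2)[of x] that unfolding mem_ball dist_real_def by (simp add: dist_commute abs_less_iff)
  with d(1) show ?thesis by blast
qed

text \<open>Outside a large ball f is a small multiple of \<open>exp V\<close>, whose expectation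
  after t steps is bounded for initial states near \<open>x0\<close>.\<close>

lemma tail_expectation_small:
  assumes [measurable]: "f \<in> borel_measurable borel" and c: "\<And>x. \<bar>f x\<bar> \<le> c * exp (V x)"
    and small: "\<forall>e>0. \<exists>r. \<forall>x. norm x > r \<longrightarrow> \<bar>f x\<bar> \<le> e * exp (V x)" and e: "e > 0"
  shows "\<exists>R. \<exists>d>0. \<forall>r\<ge>R. \<forall>x\<in>ball x0 d. (\<integral>\<omega>. \<bar>f (X x t \<omega>)\<bar> * indicator {y. r < norm y} (X x t \<omega>) \<partial>M) \<le> e"
proof -
  obtain d where d: "d > 0" "\<And>x. x \<in> ball x0 d \<Longrightarrow> exp (V x) \<le> exp (V x0) + 1"
    using exp_V_locally_bounded by blast
  define e1 where "e1 = e / (exp (real t * B) * (exp (V x0) + 1))"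
  have pos: "exp (real t * B) * (exp (V x0) + 1) > 0" by (intro mult_pos_pos) (auto simp: add_pos_pos)
  have e1: "e1 > 0" "e1 * (exp (real t * B) * (exp (V x0) + 1)) = e"
    using e pos by (auto simp: e1_def)
  obtain R where R: "\<And>x. norm x > R \<Longrightarrow> \<bar>f x\<bar> \<le> e1 * exp (V x)" using small e1(1) by blast
  have "(\<integral>\<omega>. \<bar>f (X x t \<omega>)\<bar> * indicator {y. r < norm y} (X x t \<omega>) \<partial>M) \<le> e"
    if r: "r \<ge> R" and x: "x \<in> ball x0 d" for r x
  proof -
    have "(\<integral>\<omega>. \<bar>f (X x t \<omega>)\<bar> * indicator {y. r < norm y} (X x t \<omega>) \<partial>M) \<le> (\<integral>\<omega>. e1 * exp (V (X x t \<omega>)) \<partial>M)"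
    proof (rule integral_mono)
      show "integrable M (\<lambda>\<omega>. e1 * exp (V (X x t \<omega>)))" using exp_V_integrable by simp
      show "integrable M (\<lambda>\<omega>. \<bar>f (X x t \<omega>)\<bar> * indicator {y. r < norm y} (X x t \<omega>))"
        by (rule dominated_integrable[of "\<lambda>y. \<bar>f y\<bar> * indicator {y. r < norm y} y" c])
          (auto simp: indicator_def intro: order_trans[OF abs_ge_zero] c)
      show "\<bar>f (X x t \<omega>)\<bar> * indicator {y. r < norm y} (X x t \<omega>) \<le> e1 * exp (V (X x t \<omega>))" for \<omega>
        using R[of "X x t \<omega>"] r e1(1) by (auto simp: indicator_def)
    qed
    also have "\<dots> \<le> e1 * (exp (real t * B) * (exp (V x0) + 1))"
    proof -
      have "(\<integral>\<omega>. exp (V (X x t \<omega>)) \<partial>M) \<le> exp (real t * B) * exp (V x)"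
        using exp_V_expectation_weak[of x t] by (simp add: exp_add mult.commute)
      also have "\<dots> \<le> exp (real t * B) * (exp (V x0) + 1)" by (rule mult_left_mono[OF d(2)[OF x]]) simp
      finally show ?thesis using e1(1) by (simp add: mult_left_mono)
    qed
    finally show ?thesis using e1(2) by simp
  qed
  with d(1) show ?thesis by blast
qed

lemma tight_small:
  assumes "f \<in> borel_measurable borel" "\<And>x. \<bar>f x\<bar> \<le> c * exp (V x)"
    and "\<forall>e>0. \<exists>r. \<forall>x. norm x > r \<longrightarrow> \<bar>f x\<bar> \<le> e * exp (V x)"
  shows "tight t f"
  unfolding tight_def
proof (intro conjI allI impI)
  fix x0 :: "real^'l" and e :: real assume "e > 0"
  from tail_expectation_small[OF assms this, of x0 t]
  show "\<exists>R. \<exists>d>0. \<forall>x\<in>ball x0 d. (\<integral>\<omega>. \<bar>f (X x t \<omega>)\<bar> * indicator {y. R < norm y} (X x t \<omega>) \<partial>M) \<le> e"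
    by (elim ex_forward conj_forward) auto
qed (use assms(1) dominated_integrable[OF assms(1,2)] in auto)

section \<open>Smoothing by the density and uniform integrability\<close>

lemma kernel_density:
  "AE y in lborel. 0 \<le> p (x, y)"
  "distr M borel (X x t0) = density lborel (\<lambda>y. ennreal (p (x, y)))"
proof -
  have "finite_measure (kernel M a N t0 x)" "sets (kernel M a N t0 x) = sets borel"
    by (auto simp: kernel_def intro: finite_measure_distr)
  from kernel_eq_density[OF this density] show "AE y in lborel. 0 \<le> p (x, y)"
    "distr M borel (X x t0) = density lborel (\<lambda>y. ennreal (p (x, y)))"
    unfolding kernel_def by blast+
qed

lemma P_t0_density:
  assumes [measurable]: "h \<in> borel_measurable borel"
  shows "P t0 h x = (\<integral>y. p (x, y) * h y \<partial>lborel)"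
proof -
  have "P t0 h x = (\<integral>y. p (x, y) *\<^sub>R h y \<partial>lborel)"
    unfolding P_op_def kernel_def kernel_density(2)
    by (rule integral_density) (use kernel_density(1) in measurable)
  then show ?thesis by simp
qed

text \<open>The dependence on the initial state sits entirely in the continuous density, so h may be
  rough. Its bounded support keeps the pair (x, y) in a compact set, where p is bounded and
  dominated convergence applies.\<close>

lemma P_t0_isCont:
  assumes [measurable]: "h \<in> borel_measurable borel" and b: "\<And>y. \<bar>h y\<bar> \<le> b" and supp: "\<And>y. norm y > r \<Longrightarrow> h y = 0"
  shows "isCont (P t0 h) x0"
  unfolding continuous_at_sequentially o_def
proof (intro allI impI)
  fix u :: "nat \<Rightarrow> real^'l" assume u: "u \<longlonglongrightarrow> x0"
  have b0: "0 \<le> b" using b abs_ge_zero order_trans by blast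
  from u have "Bseq u" by (intro convergent_imp_Bseq) (auto simp: convergent_def)
  then obtain K where K: "\<And>n. norm (u n) \<le> K" by (auto simp: Bseq_def)
  have "bounded (p ` (cball 0 K \<times> cball 0 r))"
    by (intro compact_imp_bounded compact_continuous_image compact_Times continuous_on_subset[OF cont_p]) auto
  then obtain C where C: "\<And>x y. norm x \<le> K \<Longrightarrow> norm y \<le> r \<Longrightarrow> \<bar>p (x, y)\<bar> \<le> C"
    unfolding bounded_iff by fastforce
  show "(\<lambda>n. P t0 h (u n)) \<longlonglongrightarrow> P t0 h x0"
    unfolding P_t0_density[OF assms(1)]
  proof (rule integral_dominated_convergence[where w="\<lambda>y. indicator (cball 0 r) y * (C * b)"])
    show "integrable lborel (\<lambda>y. indicator (cball 0 r) y * (C * b))"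
      by (intro integrable_mult_left integrable_real_indicator) (auto intro!: emeasure_bounded_finite[unfolded infinity_ennreal_def])
    have cp: "isCont p z" for z using cont_p continuous_on_eq_continuous_at[OF open_UNIV, of p] by blast
    show "AE y in lborel. (\<lambda>n. p (u n, y) * h y) \<longlonglongrightarrow> p (x0, y) * h y"
      by (intro AE_I2 tendsto_mult tendsto_const isCont_tendsto_compose[OF cp] tendsto_Pair u)
    fix n
    have "\<bar>p (u n, y) * h y\<bar> \<le> indicator (cball 0 r) y * (C * b)" for y
    proof (cases "norm y > r")
      case False
      then have C': "\<bar>p (u n, y)\<bar> \<le> C" using C[OF K] by simp
      moreover have "0 \<le> C" using C' abs_ge_zero order_trans by blast
      ultimately have "\<bar>p (u n, y)\<bar> * \<bar>h y\<bar> \<le> C * b" using b[of y] by (intro mult_mono) auto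
      then show ?thesis using False by (simp add: abs_mult)
    qed (simp add: supp)
    then show "AE y in lborel. norm (p (u n, y) * h y) \<le> indicator (cball 0 r) y * (C * b)" by simp
  qed measurable
qed

lemma exp_V_bounded_on_cball: obtains b where "b > 0" "\<And>y. norm y \<le> r \<Longrightarrow> exp (V y) \<le> b"
proof -
  have "bounded ((\<lambda>y. exp (V y)) ` cball 0 r)"
    by (intro compact_imp_bounded compact_continuous_image) (auto intro!: continuous_intros continuous_on_subset[OF cont_V])
  then obtain b where "b > 0" "\<forall>x\<in>(\<lambda>y. exp (V y)) ` cball 0 r. norm x \<le> b"
    unfolding bounded_pos by blast
  then show thesis by (intro that[of b]) auto
qed

text \<open>One step of the chain makes a function dominated by \<open>exp V\<close> negligible against \<open>exp V\<close> at
  infinity; the remaining \<open>t0\<close> steps smooth what is left on a ball.\<close>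

lemma P_strong_Feller:
  assumes [measurable]: "f \<in> borel_measurable borel" and c: "0 \<le> c" "\<And>x. \<bar>f x\<bar> \<le> c * exp (V x)"
    and t: "t \<ge> t0 + 1"
  shows "isCont (P t f) x0"
proof -
  \<comment> \<open>At least one step is reserved for the decay, which explains
    \<open>t0 + 1\<close> in place of \<open>t0\<close>.\<close>
  obtain s where s: "t = t0 + s" "s \<ge> 1" using t by (metis add_le_cancel_left le_Suc_ex le_add1 add.assoc)
  define g where "g = P s f"
  have [measurable]: "g \<in> borel_measurable borel" unfolding g_def by measurable
  define c' where "c' = c * exp (real s * B)"
  have c': "c' \<ge> 0" using c by (simp add: c'_def)
  have g: "\<bar>g x\<bar> \<le> c' * exp (V x) * exp (- \<delta> * W x)" for x
  proof -
    have "\<bar>g x\<bar> \<le> (\<integral>\<omega>. c * exp (V (X x s \<omega>)) \<partial>M)"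
      unfolding g_def P_eq_expectation[OF assms(1)]
      by (rule order_trans[OF integral_abs_bound integral_mono])
        (use dominated_integrable[OF assms(1) c(2)] exp_V_integrable c(2) in auto)
    also have "\<dots> \<le> c * exp (V x + real s * B - \<delta> * W x)"
      using exp_V_expectation[OF s(2), of x] c(1) by (simp add: mult_left_mono)
    finally show ?thesis by (simp add: c'_def exp_diff exp_add exp_minus divide_inverse mult_ac)
  qed
  have g1: "\<bar>g x\<bar> \<le> c' * exp (V x)" for x
  proof -
    have "c' * exp (V x) * exp (- \<delta> * W x) \<le> c' * exp (V x) * 1"
      using c' \<delta> W_pos[of x] by (intro mult_left_mono) auto
    then show ?thesis using g[of x] by simp
  qed
  have g2: "\<forall>e>0. \<exists>r. \<forall>x. norm x > r \<longrightarrow> \<bar>g x\<bar> \<le> e * exp (V x)"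
  proof (intro allI impI)
    fix e :: real assume e: "e > 0"
    have e': "e / (c' + 1) > 0" using e c' by simp
    obtain r where r: "\<And>x. norm x > r \<Longrightarrow> exp (- \<delta> * W x) \<le> e / (c' + 1)"
      using exp_neg_compact_sublevels[OF W_sub \<delta> e'] by blast
    have "\<bar>g x\<bar> \<le> e * exp (V x)" if "norm x > r" for x
    proof -
      have "\<bar>g x\<bar> \<le> exp (V x) * (c' * exp (- \<delta> * W x))" using g[of x] by (simp add: mult_ac)
      also have "c' * exp (- \<delta> * W x) \<le> (c' + 1) * (e / (c' + 1))"
        using r[OF that] c' by (intro mult_mono) auto
      also have "\<dots> = e" using c' by simp
      finally show ?thesis by (simp add: mult_left_mono mult.commute)
    qed
    then show "\<exists>r. \<forall>x. norm x > r \<longrightarrow> \<bar>g x\<bar> \<le> e * exp (V x)" by blast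
  qed
  have Pt: "P t f x = P t0 g x" for x
    unfolding s(1) g_def by (rule P_markov[OF assms(1) dominated_integrable[OF assms(1) c(2)]])
  show ?thesis
  proof (rule isCont_approx)
    fix e :: real assume e: "e > 0"
    from tail_expectation_small[OF \<open>g \<in> borel_measurable borel\<close> g1 g2 e, of x0 t0] obtain R d where d: "d > 0" and
      tails: "\<forall>r\<ge>R. \<forall>x\<in>ball x0 d. (\<integral>\<omega>. \<bar>g (X x t0 \<omega>)\<bar> * indicator {y. r < norm y} (X x t0 \<omega>) \<partial>M) \<le> e"
      by blast
    have tail: "(\<integral>\<omega>. \<bar>g (X x t0 \<omega>)\<bar> * indicator {y. R < norm y} (X x t0 \<omega>) \<partial>M) \<le> e" if "x \<in> ball x0 d" for x
      using tails[rule_format, OF order_refl that] .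
    \<comment> \<open>A sharp cutoff is enough, because the density smooths any bounded measurable
      function of bounded support.\<close>
    define h where "h y = g y * indicator {y. norm y \<le> R} y" for y
    have [measurable]: "h \<in> borel_measurable borel" unfolding h_def by measurable
    obtain b where b: "b > 0" "\<And>y. norm y \<le> R \<Longrightarrow> exp (V y) \<le> b" using exp_V_bounded_on_cball[of R] by blast
    have "\<bar>h y\<bar> \<le> c' * b" for y
      using g1[of y] mult_left_mono[OF b(2) c', of y] c' b(1) by (auto simp: h_def indicator_def)
    then have "isCont (P t0 h) x0" by (rule P_t0_isCont[of h _ R, rotated]) (auto simp: h_def)
    moreover have "\<bar>P t f x - P t0 h x\<bar> \<le> e" if "x \<in> ball x0 d" for x
    proof -
      have ig: "integrable M (\<lambda>\<omega>. g (X x t0 \<omega>))" by (rule dominated_integrable[OF _ g1]) measurable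
      have ih: "integrable M (\<lambda>\<omega>. h (X x t0 \<omega>))"
        by (rule dominated_integrable[of h c']) (use g1 c' in \<open>auto simp: h_def indicator_def\<close>)
      have "P t f x - P t0 h x = (\<integral>\<omega>. g (X x t0 \<omega>) - h (X x t0 \<omega>) \<partial>M)"
        unfolding Pt using ig ih by (simp add: P_eq_expectation)
      also have "\<bar>\<dots>\<bar> \<le> (\<integral>\<omega>. \<bar>g (X x t0 \<omega>) - h (X x t0 \<omega>)\<bar> \<partial>M)" by (rule integral_abs_bound)
      also have "\<dots> = (\<integral>\<omega>. \<bar>g (X x t0 \<omega>)\<bar> * indicator {y. R < norm y} (X x t0 \<omega>) \<partial>M)"
        by (rule Bochner_Integration.integral_cong) (auto simp: h_def indicator_def)
      also have "\<dots> \<le> e" by (rule tail[OF that])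
      finally show ?thesis .
    qed
    ultimately show "\<exists>G d. d > 0 \<and> isCont G x0 \<and> (\<forall>x\<in>ball x0 d. \<bar>P t f x - G x\<bar> \<le> e)" using d by blast
  qed
qed

text \<open>At \<open>x0\<close> itself the tail expectations tend to 0 by dominated convergence.
  For a fixed radius the tail expectation is continuous in the initial state, although the tail
  function has a jump at the sphere, so smallness persists nearby.\<close>

lemma tight_large_time:
  assumes [measurable]: "f \<in> borel_measurable borel" and c: "0 \<le> c" "\<And>x. \<bar>f x\<bar> \<le> c * exp (V x)"
    and t: "t \<ge> t0 + 1"
  shows "tight t f"
  unfolding tight_def
proof (intro conjI allI impI)
  show int: "integrable M (\<lambda>\<omega>. f (X x t \<omega>))" for x by (rule dominated_integrable[OF assms(1) c(2)])
  fix x0 :: "real^'l" and e :: real assume e: "e > 0"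
  define F where "F R y = \<bar>f y\<bar> * indicator {y. R < norm y} y" for R :: real and y :: "real^'l"
  have [measurable]: "F R \<in> borel_measurable borel" for R unfolding F_def by measurable
  have F: "\<bar>F R y\<bar> \<le> c * exp (V y)" for R y using c(2)[of y] c(1) by (auto simp: F_def indicator_def)
  have "(\<lambda>n. \<integral>\<omega>. F (real n) (X x0 t \<omega>) \<partial>M) \<longlonglongrightarrow> (\<integral>\<omega>. 0 \<partial>M)"
  proof (rule integral_dominated_convergence[where w="\<lambda>\<omega>. c * exp (V (X x0 t \<omega>))"])
    show "integrable M (\<lambda>\<omega>. c * exp (V (X x0 t \<omega>)))" using exp_V_integrable by simp
    have "(\<lambda>n. F (real n) y) \<longlonglongrightarrow> 0" for y
    proof (rule tendsto_eventually)
      show "\<forall>\<^sub>F n in sequentially. F (real n) y = 0"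
        using eventually_ge_at_top[of "nat \<lceil>norm y\<rceil>"]
      proof eventually_elim
        fix n assume "nat \<lceil>norm y\<rceil> \<le> n"
        then have "norm y \<le> real n" by linarith
        then show "F (real n) y = 0" by (simp add: F_def)
      qed
    qed
    then show "AE \<omega> in M. (\<lambda>n. F (real n) (X x0 t \<omega>)) \<longlonglongrightarrow> 0" by simp
  qed (use F in auto)
  then have "(\<lambda>n. P t (F (real n)) x0) \<longlonglongrightarrow> 0" by (simp add: P_eq_expectation)
  then have "\<forall>\<^sub>F n in sequentially. P t (F (real n)) x0 < e / 2"
    by (rule order_tendstoD(2)) (use e in simp)
  then obtain n where n: "P t (F (real n)) x0 < e / 2"
    unfolding eventually_sequentially by blast
  have "isCont (P t (F (real n))) x0" by (rule P_strong_Feller[OF _ c(1) F t]) measurable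
  then obtain d where d: "d > 0" "\<And>x. dist x x0 < d \<Longrightarrow> dist (P t (F (real n)) x) (P t (F (real n)) x0) < e / 2"
    unfolding continuous_at_eps_delta using half_gt_zero[OF e] by blast
  have "P t (F (real n)) x \<le> e" if "x \<in> ball x0 d" for x
  proof -
    have "\<bar>P t (F (real n)) x - P t (F (real n)) x0\<bar> < e / 2"
      using d(2)[of x] that by (simp add: dist_commute dist_real_def abs_minus_commute)
    with n show ?thesis by linarith
  qed
  then show "\<exists>R. \<exists>d>0. \<forall>x\<in>ball x0 d. (\<integral>\<omega>. \<bar>f (X x t \<omega>)\<bar> * indicator {y. R < norm y} (X x t \<omega>) \<partial>M) \<le> e"
    using d(1) by (intro exI[of _ "real n"] exI[of _ d]) (simp add: P_eq_expectation F_def)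
qed simp

text \<open>Two kinds of decay are meant: \<open>F = V\<close> with
  \<open>\<gamma> = 1 - \<eta>\<close> for weights below \<open>exp V\<close>, and
  \<open>F = W\<close> with \<open>\<gamma> = \<eta> * \<delta>\<close> for functions that already
  carry the gain of one step.\<close>

lemma tight_decaying:
  assumes "f \<in> borel_measurable borel" and c: "0 \<le> c" "\<And>x. \<bar>f x\<bar> \<le> c * exp (V x) * exp (- \<gamma> * F x)"
    and F: "\<And>r. r \<ge> 0 \<Longrightarrow> compact {x. F x \<le> r}" "\<And>x. 0 \<le> F x" and \<gamma>: "\<gamma> > 0"
  shows "tight t f"
proof (rule tight_small[OF assms(1)])
  fix x
  have "c * exp (V x) * exp (- \<gamma> * F x) \<le> c * exp (V x) * 1"
    using c(1) \<gamma> F(2)[of x] by (intro mult_left_mono) auto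
  then show "\<bar>f x\<bar> \<le> c * exp (V x)" using c(2)[of x] by simp
next
  show "\<forall>e>0. \<exists>r. \<forall>x. norm x > r \<longrightarrow> \<bar>f x\<bar> \<le> e * exp (V x)"
  proof (intro allI impI)
    fix e :: real assume e: "e > 0"
    then have e': "e / (c + 1) > 0" using c by simp
    obtain r where r: "\<And>x. norm x > r \<Longrightarrow> exp (- \<gamma> * F x) \<le> e / (c + 1)"
      using exp_neg_compact_sublevels[OF F(1) \<gamma> e'] by blast
    have "\<bar>f x\<bar> \<le> e * exp (V x)" if "norm x > r" for x
    proof -
      have "\<bar>f x\<bar> \<le> exp (V x) * (c * exp (- \<gamma> * F x))" using c(2)[of x] by (simp add: mult_ac)
      also have "c * exp (- \<gamma> * F x) \<le> (c + 1) * (e / (c + 1))"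
        using r[OF that] c by (intro mult_mono) auto
      also have "\<dots> = e" using c by simp
      finally show ?thesis by (simp add: mult_left_mono mult.commute)
    qed
    then show "\<exists>r. \<forall>x. norm x > r \<longrightarrow> \<bar>f x\<bar> \<le> e * exp (V x)" by blast
  qed
qed

text \<open>Here the two parts of the theorem separate: for \<eta> < 1 the weight is itself
  negligible against \<open>exp V\<close>, whatever the time, while \<eta> = 1 relies on the
  smoothing after \<open>t0 + 1\<close> steps.\<close>

lemma tight_weighted:
  assumes f: "f \<in> borel_measurable borel" and c: "0 \<le> c" "\<And>x. \<bar>f x\<bar> \<le> c * exp (\<eta> * V x)"
    and \<eta>: "\<eta> \<le> 1" and good: "\<eta> < 1 \<or> t \<ge> t0 + 1"
  shows "tight t f"
proof (cases "\<eta> < 1")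
  case True
  show ?thesis
  proof (rule tight_decaying[OF f c(1) _ V_sub])
    show "\<bar>f x\<bar> \<le> c * exp (V x) * exp (- (1 - \<eta>) * V x)" for x
      using c(2)[of x] by (simp add: mult.assoc exp_add[symmetric] algebra_simps)
  qed (use True V_pos less_imp_le in auto)
next
  case False
  then show ?thesis using good weighted_dominated[OF \<eta> c] by (intro tight_large_time[OF f c(1)]) auto
qed

section \<open>Weighted bounds and mapping properties\<close>

lemma P_bound:
  assumes \<eta>: "0 < \<eta>" "\<eta> \<le> 1" and t: "t \<ge> 1" and [measurable]: "f \<in> borel_measurable borel"
    and c: "0 \<le> c" "\<And>x. \<bar>f x\<bar> \<le> c * exp (\<eta> * V x)"
  shows "\<bar>P t f x\<bar> \<le> c * exp (real t * B) * exp (\<eta> * V x) * exp (- (\<eta> * \<delta>) * W x)"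
proof -
  have "\<bar>P t f x\<bar> \<le> (\<integral>\<omega>. c * exp (\<eta> * V (X x t \<omega>)) \<partial>M)"
    unfolding P_eq_expectation[OF assms(4)]
    by (rule order_trans[OF integral_abs_bound integral_mono])
      (use dominated_integrable[OF assms(4) weighted_dominated[OF \<eta>(2) c]] weight_expectation(1)[OF \<eta> t] c(2) in auto)
  also have "\<dots> \<le> c * (exp (real t * B) * exp (\<eta> * V x) * exp (- (\<eta> * \<delta>) * W x))"
    using weight_expectation(2)[OF \<eta> t, of x] c(1) by (simp add: mult_left_mono)
  finally show ?thesis by (simp add: mult.assoc)
qed

lemma Q_comp_bound:
  assumes \<eta>: "0 < \<eta>" "\<eta> \<le> 1" and t: "t \<ge> 1" and [measurable]: "f \<in> borel_measurable borel"
    and c: "0 \<le> c" "\<And>x. \<bar>f x\<bar> \<le> c * exp (\<eta> * V x)"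
  shows "\<bar>Q_comp M a N t i j f x\<bar> \<le> L ^ t * (c * exp (real t * B) * exp (\<eta> * V x) * exp (- (\<eta> * \<delta>) * W x))"
proof -
  have if1: "integrable M (\<lambda>\<omega>. f (X x t \<omega>))"
    by (rule dominated_integrable[OF assms(4) weighted_dominated[OF \<eta>(2) c]])
  have "\<bar>Q_comp M a N t i j f x\<bar> \<le> (\<integral>\<omega>. L ^ t * \<bar>f (X x t \<omega>)\<bar> \<partial>M)"
    unfolding Q_comp_def
  proof (rule order_trans[OF integral_abs_bound integral_mono])
    show i: "integrable M (\<lambda>\<omega>. L ^ t * \<bar>f (X x t \<omega>)\<bar>)" using if1 by simp
    show le: "\<bar>S x t \<omega> $ j $ i * f (X x t \<omega>)\<bar> \<le> L ^ t * \<bar>f (X x t \<omega>)\<bar>" for \<omega>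
      by (simp add: abs_mult mult_right_mono sensitivity_bound)
    show "integrable M (\<lambda>\<omega>. \<bar>S x t \<omega> $ j $ i * f (X x t \<omega>)\<bar>)"
    proof (rule Bochner_Integration.integrable_bound[OF i])
      show "AE \<omega> in M. norm \<bar>S x t \<omega> $ j $ i * f (X x t \<omega>)\<bar> \<le> norm (L ^ t * \<bar>f (X x t \<omega>)\<bar>)"
        using order_trans[OF le abs_ge_self] by simp
    qed measurable
  qed
  also have "\<dots> = L ^ t * P t (\<lambda>x. \<bar>f x\<bar>) x" by (simp add: P_eq_expectation)
  also have "\<dots> \<le> L ^ t * \<bar>P t (\<lambda>x. \<bar>f x\<bar>) x\<bar>" using L_nonneg by (intro mult_left_mono) auto
  also have "\<dots> \<le> L ^ t * (c * exp (real t * B) * exp (\<eta> * V x) * exp (- (\<eta> * \<delta>) * W x))"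
    by (intro mult_left_mono P_bound[OF \<eta> t _ c(1)]) (use c(2) L_nonneg in auto)
  finally show ?thesis .
qed

lemma Q_op_bound:
  assumes \<eta>: "0 < \<eta>" "\<eta> \<le> 1" and t: "t \<ge> 1" and T: "\<And>j. tight t (\<lambda>x. G x $ j)"
    and c: "0 \<le> c" "\<And>x j. \<bar>G x $ j\<bar> \<le> c * exp (\<eta> * V x)"
  shows "\<bar>Q_op M a N t G x $ k\<bar> \<le>
    real CARD('l) * L ^ t * (c * exp (real t * B) * exp (\<eta> * V x) * exp (- (\<eta> * \<delta>) * W x))"
proof -
  have m: "(\<lambda>x. G x $ j) \<in> borel_measurable borel" for j using T[of j] by (simp add: tight_def)
  have "\<bar>Q_op M a N t G x $ k\<bar> \<le> (\<Sum>j\<in>UNIV. \<bar>Q_comp M a N t k j (\<lambda>x. G x $ j) x\<bar>)"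
    unfolding Q_op_eq(2)[OF T] by (rule sum_abs)
  also have "\<dots> \<le> (\<Sum>j\<in>(UNIV::'l set). L ^ t * (c * exp (real t * B) * exp (\<eta> * V x) * exp (- (\<eta> * \<delta>) * W x)))"
    by (rule sum_mono) (rule Q_comp_bound[OF \<eta> t m c])
  finally show ?thesis by (simp add: mult.assoc)
qed

lemma decay_le_1: "0 < \<eta> \<Longrightarrow> exp (- (\<eta> * \<delta>) * W x) \<le> 1"
  using \<delta> W_pos[of x] by simp

text \<open>Tightness provides convergence of the integrals, continuity and differentiability; the
  weighted bounds provide finite norms, after their decay factor has been replaced by 1.\<close>

lemma mapping_properties:
  assumes \<eta>: "0 < \<eta>" "\<eta> \<le> 1" and t: "t \<ge> 1" and good: "\<eta> < 1 \<or> t \<ge> t0 + 1"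
  defines "w \<equiv> \<lambda>x. exp (\<eta> * V x)"
  shows "k \<in> {0, 1} \<Longrightarrow> P_maps M a N t w k" "Q_maps M a N t w i j" "grad_P_eq_Q_grad M a N t w"
proof -
  have w: "w x > 0" for x by (simp add: w_def)
  have drop_decay: "c * w x * exp (- (\<eta> * \<delta>) * W x) \<le> c * w x" if "c \<ge> 0" for c x
    using mult_left_mono[OF decay_le_1[OF \<eta>(1), of x], of "c * w x"] that w[of x] by simp
  have tw: "tight t f" if "continuous_on UNIV f" "0 \<le> c" "\<And>x. \<bar>f x\<bar> \<le> c * w x" for f c
    using tight_weighted[OF borel_measurable_continuous_onI[OF that(1)] that(2), of \<eta> t] that(3) \<eta>(2) good
    by (simp add: w_def)
  have Pb: "\<bar>P t f x\<bar> \<le> c * exp (real t * B) * w x"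
    if "continuous_on UNIV f" "0 \<le> c" "\<And>x. \<bar>f x\<bar> \<le> c * w x" for f c x
    using P_bound[OF \<eta> t borel_measurable_continuous_onI[OF that(1)] that(2), of x] that(3)
      drop_decay[of "c * exp (real t * B)" x] that(2) unfolding w_def by fastforce
  have kint: "integrable (kernel M a N t x) f" if "tight t f" for f x
    using that by (subst kernel_integrable_iff) (auto simp: tight_def)
  have 0: "(\<forall>x. integrable (kernel M a N t x) f) \<and> P t f \<in> L_inf0 w" if "f \<in> L_inf0 w" for f
  proof -
    from that obtain c where c: "continuous_on UNIV f" "0 \<le> c" "\<And>x. \<bar>f x\<bar> \<le> c * w x"
      by (auto simp: mem_L_inf0_iff[OF w])
    show ?thesis
      using kint[OF tw[OF c]] P_continuous[OF tw[OF c] c(1)] Pb[OF c] c(2)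
      by (auto simp: mem_L_inf0_iff[OF w] intro!: exI[of _ "c * exp (real t * B)"])
  qed
  have 1: "(\<forall>x. integrable (kernel M a N t x) f) \<and> P t f \<in> L_inf1 w \<and>
      C1 (P t f) (Q_op M a N t (grad f)) \<and> (\<forall>j. tight t (\<lambda>x. grad f x $ j))" if f: "f \<in> L_inf1 w" for f
  proof -
    from f obtain G c where C: "C1 f G" and c: "0 \<le> c" "\<And>x. \<bar>f x\<bar> \<le> c * w x" "\<And>x i. \<bar>G x $ i\<bar> \<le> c * w x"
      by (auto simp: mem_L_inf1_iff[OF w])
    have G: "grad f = G" by (rule C1_partial(3)[OF C])
    have cf: "continuous_on UNIV f" by (rule C1_continuous[OF C])
    have cG: "continuous_on UNIV (\<lambda>x. G x $ j)" for j
      using C1D(2)[OF C] by (intro continuous_intros)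
    have tG: "tight t (\<lambda>x. G x $ j)" for j by (rule tw[OF cG c(1) c(3)])
    have C': "C1 (P t f) (Q_op M a N t G)" by (rule C1_P[OF C tw[OF cf c(1,2)] tG])
    define K where "K = real CARD('l) * L ^ t * (c * exp (real t * B))"
    have K: "0 \<le> K" using c(1) L_nonneg by (simp add: K_def)
    have Qb: "\<bar>Q_op M a N t G x $ k\<bar> \<le> K * w x" for x k
    proof -
      have "\<bar>Q_op M a N t G x $ k\<bar> \<le> K * w x * exp (- (\<eta> * \<delta>) * W x)"
        using Q_op_bound[OF \<eta> t tG c(1), of x k] c(3) by (simp add: w_def K_def mult.assoc)
      also have "\<dots> \<le> K * w x" by (rule drop_decay[OF K])
      finally show ?thesis .
    qed
    have "P t f \<in> L_inf1 w"
      unfolding mem_L_inf1_iff[OF w]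
    proof (intro exI conjI)
      show "C1 (P t f) (Q_op M a N t G)" by fact
      show "0 \<le> max K (c * exp (real t * B))" using K by simp
      show "\<forall>x. \<bar>P t f x\<bar> \<le> max K (c * exp (real t * B)) * w x \<and>
          (\<forall>i. \<bar>Q_op M a N t G x $ i\<bar> \<le> max K (c * exp (real t * B)) * w x)"
        using order_trans[OF Pb[OF cf c(1,2)] mult_right_mono[OF max.cobounded2 less_imp_le[OF w]]]
          order_trans[OF Qb mult_right_mono[OF max.cobounded1 less_imp_le[OF w]]] by blast
    qed
    then show ?thesis using kint[OF tw[OF cf c(1,2)]] C' tG by (simp add: G)
  qed
  show "P_maps M a N t w k" if "k \<in> {0, 1}"
    using 0 1 that by (auto simp: P_maps_def Lk_def)
  show "Q_maps M a N t w i j"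
    unfolding Q_maps_def
  proof (intro ballI conjI allI)
    fix f assume "f \<in> L_inf0 w"
    then obtain c where c: "continuous_on UNIV f" "0 \<le> c" "\<And>x. \<bar>f x\<bar> \<le> c * w x"
      by (auto simp: mem_L_inf0_iff[OF w])
    show "integrable M (\<lambda>\<omega>. S x t \<omega> $ j $ i * f (X x t \<omega>))" for x by (rule Q_comp_integrable[OF tw[OF c]])
    define K where "K = L ^ t * (c * exp (real t * B))"
    have K: "0 \<le> K" using c(2) L_nonneg by (simp add: K_def)
    have "\<bar>Q_comp M a N t i j f x\<bar> \<le> K * w x" for x
    proof -
      have "\<bar>Q_comp M a N t i j f x\<bar> \<le> K * w x * exp (- (\<eta> * \<delta>) * W x)"
        using Q_comp_bound[OF \<eta> t borel_measurable_continuous_onI[OF c(1)] c(2), of i j x] c(3)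
        by (simp add: w_def K_def mult.assoc)
      also have "\<dots> \<le> K * w x" by (rule drop_decay[OF K])
      finally show ?thesis .
    qed
    then show "Q_comp M a N t i j f \<in> L_inf0 w"
      using Q_comp_continuous[OF tw[OF c] c(1)] K by (auto simp: mem_L_inf0_iff[OF w])
  qed
  show "grad_P_eq_Q_grad M a N t w"
    unfolding grad_P_eq_Q_grad_def
  proof (intro ballI conjI allI)
    fix f assume f: "f \<in> L_inf1 w"
    note C = 1[OF f]
    show "integrable (kernel M a N t x) f" for x using C by blast
    show "has_partial i (P t f) x" for i x using C C1_partial(1) by blast
    show "integrable M (\<lambda>\<omega>. transpose (S x t \<omega>) *v grad f (X x t \<omega>))" for x
      by (rule Q_op_eq(1)) (use C in blast)
    show "grad (P t f) = Q_op M a N t (grad f)" using C C1_partial(3) by blast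
  qed
qed

end

section \<open>Approximation by operators of finite rank\<close>

lemma C1_cmult: "C1 f F \<Longrightarrow> C1 (\<lambda>x. f x * c) (\<lambda>x. c *\<^sub>R F x)"
  using C1_mult[OF _ C1_const, of f F c] by simp

lemma C1_lipschitz:
  assumes "C1 f G" and "\<And>x. norm (G x) \<le> e"
  shows "\<bar>f x - f y\<bar> \<le> e * norm (x - y)"
proof -
  have "norm (f x - f y) \<le> e * norm (x - y)"
  proof (rule differentiable_bound[of UNIV f "\<lambda>x h. G x \<bullet> h"])
    show "onorm (\<lambda>h. G x \<bullet> h) \<le> e" for x
    proof (rule onorm_bound)
      show "0 \<le> e" using assms(2) norm_ge_zero order_trans by blast
      show "norm (G x \<bullet> h) \<le> e * norm h" for h
        using Cauchy_Schwarz_ineq2[of "G x" h] mult_right_mono[OF assms(2), of "norm h" x] by simp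
    qed
  qed (use C1D(1)[OF assms(1)] in auto)
  then show ?thesis by simp
qed

text \<open>Difference quotients along an axis obey the Lipschitz bound, and so does their limit.
  This gives gradient estimates for functions known only through their increments.\<close>

lemma C1_gradient_bound:
  assumes "C1 f G" and lip: "\<And>x y. \<bar>f x - f y\<bar> \<le> m * norm (x - y)"
  shows "\<bar>G x $ k\<bar> \<le> m"
proof -
  have "((\<lambda>s. f (x + s *\<^sub>R axis k 1)) has_real_derivative G x $ k) (at 0)"
    using has_partial_derivative[OF C1D(1)[OF assms(1)], of x k] by (simp add: inner_axis)
  then have "((\<lambda>s. (f (x + s *\<^sub>R axis k 1) - f x) / s) \<longlongrightarrow> G x $ k) (at 0)"
    by (simp add: DERIV_def)
  then have "((\<lambda>s. \<bar>(f (x + s *\<^sub>R axis k 1) - f x) / s\<bar>) \<longlongrightarrow> \<bar>G x $ k\<bar>) (at 0)"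
    by (rule tendsto_rabs)
  then show ?thesis
  proof (rule tendsto_upperbound)
    have "\<bar>(f (x + s *\<^sub>R axis k 1) - f x) / s\<bar> \<le> m" if "s \<noteq> 0" for s
      using lip[of "x + s *\<^sub>R axis k 1" x] that by (simp add: pos_divide_le_eq)
    then show "\<forall>\<^sub>F s in at 0. \<bar>(f (x + s *\<^sub>R axis k 1) - f x) / s\<bar> \<le> m"
      by (auto simp: eventually_at_filter)
  qed simp
qed

text \<open>A finite cover of the compact ball by small balls is made disjoint. A node
  \<open>z i\<close> may fall into an earlier cell and \<open>A i\<close> may be empty, so the bound
  on the norm of \<open>z i\<close> is a separate claim.\<close>

lemma finite_measurable_partition:
  fixes R d :: real
  assumes "d > 0"
  obtains n :: nat and z :: "nat \<Rightarrow> real^'l" and A where "\<And>i. i < n \<Longrightarrow> A i \<in> sets borel"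
    "\<And>i y. i < n \<Longrightarrow> y \<in> A i \<Longrightarrow> dist (z i) y < d" "\<And>i y. i < n \<Longrightarrow> y \<in> A i \<Longrightarrow> norm y \<le> R"
    "\<And>i. i < n \<Longrightarrow> norm (z i) \<le> R"
    "\<And>y. norm y \<le> R \<Longrightarrow> (\<Sum>i<n. indicator (A i) y) = (1::real)"
proof -
  obtain F where F: "finite F" "F \<subseteq> cball (0::real^'l) R" "cball 0 R \<subseteq> (\<Union>z\<in>F. ball z d)"
    by (rule compactE_image[of "cball (0::real^'l) R" "cball 0 R" "\<lambda>z. ball z d"]) (use assms in auto)
  then obtain n :: nat and z where z: "F = z ` {i. i < n}" using finite_conv_nat_seg_image by metis
  define U where "U = disjointed (\<lambda>i. ball (z i) d)"
  define A where "A i = cball 0 R \<inter> U i" for i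
  have cover: "\<exists>i<n. y \<in> A i" if y: "norm y \<le> R" for y
  proof -
    have "y \<in> (\<Union>i\<in>{0..<n}. ball (z i) d)" using F(3) y unfolding z by fastforce
    then have "y \<in> (\<Union>i\<in>{0..<n}. U i)" unfolding U_def finite_UN_disjointed_eq .
    then show ?thesis using y by (auto simp: A_def)
  qed
  have disj: "i = j" if "y \<in> A i" "y \<in> A j" for i j y
    using disjoint_family_disjointed[of "\<lambda>i. ball (z i) d"] that
    by (auto simp: A_def U_def disjoint_family_on_def)
  show thesis
  proof (rule that[of n A z])
    show "A i \<in> sets borel" for i unfolding A_def U_def disjointed_def by measurable
    show "dist (z i) y < d" if "y \<in> A i" for i y
      using that disjointed_subset[of "\<lambda>i. ball (z i) d" i] by (auto simp: A_def U_def)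
    show "norm y \<le> R" if "y \<in> A i" for i y using that by (simp add: A_def)
    show "norm (z i) \<le> R" if "i < n" for i using F(2) that by (auto simp: z)
    fix y assume "norm (y::real^'l) \<le> R"
    then obtain i where i: "i < n" "y \<in> A i" using cover by blast
    have "(\<Sum>j<n. indicator (A j) y) = (\<Sum>j<n. if j = i then 1 else (0::real))"
      by (rule sum.cong) (use disj i in \<open>auto simp: indicator_def\<close>)
    then show "(\<Sum>j<n. indicator (A j) y) = (1::real)" using i by simp
  qed
qed

text \<open>The hypothesis compares products, so \<open>u\<close> needs to be small only where
  \<rho> is nonzero, in the application inside a single cell.\<close>

lemma weighted_sum_integral_bound:
  fixes u \<rho> :: "nat \<Rightarrow> 'a \<Rightarrow> real"
  assumes le: "\<And>i y. i < n \<Longrightarrow> \<bar>u i y * \<rho> i y\<bar> \<le> e * \<bar>\<rho> i y\<bar>"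
    and iu: "\<And>i. i < n \<Longrightarrow> integrable K (\<lambda>y. u i y * \<rho> i y)" and i\<rho>: "\<And>i. i < n \<Longrightarrow> integrable K (\<rho> i)"
    and m: "(\<Sum>i<n. \<integral>y. \<bar>\<rho> i y\<bar> \<partial>K) \<le> m" and e: "0 \<le> e"
  shows "\<bar>\<Sum>i<n. \<integral>y. u i y * \<rho> i y \<partial>K\<bar> \<le> e * m"
proof -
  have "\<bar>\<Sum>i<n. \<integral>y. u i y * \<rho> i y \<partial>K\<bar> \<le> (\<Sum>i<n. \<bar>\<integral>y. u i y * \<rho> i y \<partial>K\<bar>)" by (rule sum_abs)
  also have "\<dots> \<le> (\<Sum>i<n. e * (\<integral>y. \<bar>\<rho> i y\<bar> \<partial>K))"
  proof (rule sum_mono)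
    fix i assume "i \<in> {..<n}"
    then have i: "i < n" by simp
    have "\<bar>\<integral>y. u i y * \<rho> i y \<partial>K\<bar> \<le> (\<integral>y. \<bar>u i y * \<rho> i y\<bar> \<partial>K)" by (rule integral_abs_bound)
    also have "\<dots> \<le> (\<integral>y. e * \<bar>\<rho> i y\<bar> \<partial>K)"
      by (rule integral_mono) (use iu[OF i] i\<rho>[OF i] le[OF i] in auto)
    finally show "\<bar>\<integral>y. u i y * \<rho> i y \<partial>K\<bar> \<le> e * (\<integral>y. \<bar>\<rho> i y\<bar> \<partial>K)" by simp
  qed
  also have "\<dots> = e * (\<Sum>i<n. \<integral>y. \<bar>\<rho> i y\<bar> \<partial>K)" by (simp add: sum_distrib_left)
  also have "\<dots> \<le> e * m" using m e by (rule mult_left_mono)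
  finally show ?thesis .
qed

lemma compactly_supported_integrable:
  fixes f :: "real^'l \<Rightarrow> real"
  assumes [measurable]: "f \<in> borel_measurable borel" and b: "\<And>y. \<bar>f y\<bar> \<le> b" and supp: "\<And>y. norm y > R \<Longrightarrow> f y = 0"
  shows "integrable lborel f"
proof (rule Bochner_Integration.integrable_bound)
  show "integrable lborel (\<lambda>y. indicator (cball 0 R) y * b :: real)"
    by (intro integrable_mult_left integrable_real_indicator)
      (auto intro!: emeasure_bounded_finite[unfolded infinity_ennreal_def])
  show "AE y in lborel. norm (f y) \<le> norm (indicator (cball 0 R) y * b)"
  proof (rule AE_I2)
    fix y show "norm (f y) \<le> norm (indicator (cball 0 R) y * b)"
      using b[of y] supp[of y] by (cases "norm y > R") (auto simp: indicator_def)
  qed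
qed measurable

section \<open>Measures transported by the chain and a common growth constant\<close>

context dv3_chain
begin

text \<open>\<open>K\<close> is the law after s steps when the initial state is spread according to
  the unnormalised density q. Integrating f against it equals integrating P^s f against q, which
  turns such a functional of f into a measure.\<close>

lemma transported_measure:
  fixes q :: "real^'l \<Rightarrow> real" and s :: nat
  assumes [measurable]: "q \<in> borel_measurable borel" and q: "\<And>y. 0 \<le> q y" "\<And>y. q y \<le> 1" "\<And>y. norm y > R \<Longrightarrow> q y = 0"
  defines "K \<equiv> distr (density lborel (\<lambda>y. ennreal (q y)) \<Otimes>\<^sub>M M) borel (\<lambda>z. X (fst z) s (snd z))"
  shows "finite_measure K" "sets K = sets borel"
    and "f \<in> borel_measurable borel \<Longrightarrow> 0 \<le> c \<Longrightarrow> (\<And>x. \<bar>f x\<bar> \<le> c * exp (V x)) \<Longrightarrow>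
      integrable K f \<and> (\<integral>x. f x \<partial>K) = (\<integral>y. q y * P s f y \<partial>lborel)"
proof -
  define D where "D = density lborel (\<lambda>y. ennreal (q y))"
  have qi: "integrable lborel q"
    by (rule compactly_supported_integrable[where b=1 and R=R]) (use q in auto)
  have "emeasure D (space D) = (\<integral>\<^sup>+y. ennreal (q y) \<partial>lborel)"
    unfolding D_def by (simp add: emeasure_density)
  also have "\<dots> < \<infinity>" using nn_integral_eq_integral[OF qi] q by simp
  finally have "finite_measure D" by (intro finite_measureI) auto
  then interpret D: finite_measure D .
  interpret DM: pair_sigma_finite D M ..
  have [measurable_cong]: "sets D = sets borel" by (simp add: D_def)
  have K: "K = distr (D \<Otimes>\<^sub>M M) borel (\<lambda>z. X (fst z) s (snd z))" by (simp add: K_def D_def)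
  have m: "(\<lambda>z. X (fst z) s (snd z)) \<in> D \<Otimes>\<^sub>M M \<rightarrow>\<^sub>M borel" by measurable
  show "finite_measure K" unfolding K
    by (intro finite_measure.finite_measure_distr finite_measure_pair_measure m D.finite_measure_axioms finite_measure_axioms)
  show "sets K = sets borel" by (simp add: K)
  assume [measurable]: "f \<in> borel_measurable borel" and c: "0 \<le> c" "\<And>x. \<bar>f x\<bar> \<le> c * exp (V x)"
  have fi: "integrable M (\<lambda>\<omega>. f (X y s \<omega>))" for y
    by (rule dominated_integrable[OF _ c(2)]) measurable
  have int: "integrable (D \<Otimes>\<^sub>M M) (\<lambda>z. f (X (fst z) s (snd z)))"
  proof (rule DM.Fubini_integrable)
    show "AE y in D. integrable M (\<lambda>\<omega>. f (X (fst (y, \<omega>)) s (snd (y, \<omega>))))" using fi by simp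
    define h where "h y = (\<integral>\<omega>. norm (f (X y s \<omega>)) \<partial>M)" for y
    have [measurable]: "h \<in> borel_measurable borel" unfolding h_def by measurable
    \<comment> \<open>Since q lives on a ball, where \<open>exp V\<close> is bounded, the iterated
      integral needed for Fubini is finite.\<close>
    obtain b where b: "b > 0" "\<And>y. norm y \<le> R \<Longrightarrow> exp (V y) \<le> b" using exp_V_bounded_on_cball[of R] by blast
    have hb: "h y \<le> c * exp (real s * B) * exp (V y)" for y
    proof -
      have "h y \<le> (\<integral>\<omega>. c * exp (V (X y s \<omega>)) \<partial>M)"
        unfolding h_def by (rule integral_mono) (use fi exp_V_integrable c(2) in auto)
      also have "\<dots> \<le> c * exp (V y + real s * B)"
        using exp_V_expectation_weak[of y s] c(1) by (simp add: mult_left_mono)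
      finally show ?thesis by (simp add: exp_add mult_ac)
    qed
    have h0: "0 \<le> h y" for y unfolding h_def by (rule integral_nonneg_AE) simp
    have "integrable lborel (\<lambda>y. q y * h y)"
    proof (rule compactly_supported_integrable)
      show "\<bar>q y * h y\<bar> \<le> c * exp (real s * B) * b" for y
      proof (cases "norm y > R")
        case False
        have "q y * h y \<le> 1 * h y" using q h0 by (intro mult_right_mono) auto
        also have "\<dots> \<le> c * exp (real s * B) * b"
          using hb[of y] mult_left_mono[OF b(2), of y "c * exp (real s * B)"] False c(1) by simp
        finally show ?thesis using q h0 by simp
      qed (use q b c in auto)
      show "norm y > R \<Longrightarrow> q y * h y = 0" for y using q by simp
    qed measurable
    then have "integrable D h" unfolding D_def
      by (subst integrable_density) (use q in auto)
    then show "integrable D (\<lambda>y. \<integral>\<omega>. norm (f (X (fst (y, \<omega>)) s (snd (y, \<omega>)))) \<partial>M)"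
      by (simp add: h_def[abs_def])
  qed measurable
  have "(\<integral>x. f x \<partial>K) = (\<integral>z. f (X (fst z) s (snd z)) \<partial>(D \<Otimes>\<^sub>M M))"
    unfolding K by (rule integral_distr[OF m]) measurable
  also have "\<dots> = (\<integral>y. P s f y \<partial>D)"
    using DM.integral_fst'[OF int] by (simp add: P_eq_expectation)
  also have "\<dots> = (\<integral>y. q y * P s f y \<partial>lborel)"
    unfolding D_def by (subst integral_density) (use q in auto)
  finally show "integrable K f \<and> (\<integral>x. f x \<partial>K) = (\<integral>y. q y * P s f y \<partial>lborel)"
    unfolding K using int by (subst integrable_distr_eq[OF m]) auto
qed

text \<open>One constant for all times up to t: the summand 1 covers P, the other summand covers the
  sum over components in Q. Taking \<open>max 1 L\<close> makes the powers monotone in time.\<close>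

definition growth :: "nat \<Rightarrow> real" where
  "growth t = exp (real t * B) * (1 + real CARD('l) * max 1 L ^ t)"

lemma growth_pos: "growth t > 0"
  by (auto simp: growth_def intro!: mult_pos_pos add_pos_nonneg)

lemma growth_bounds:
  assumes "u \<le> t"
  shows "exp (real u * B) \<le> growth t" "real CARD('l) * L ^ u * exp (real u * B) \<le> growth t"
proof -
  have e: "exp (real u * B) \<le> exp (real t * B)" using assms B by (simp add: mult_right_mono)
  have "L ^ u \<le> max 1 L ^ u" using L_nonneg by (intro power_mono) auto
  also have "\<dots> \<le> max 1 L ^ t" using assms by (intro power_increasing) auto
  finally have l: "L ^ u \<le> max 1 L ^ t" .
  have "exp (real u * B) * 1 \<le> growth t" unfolding growth_def
    using e by (intro mult_mono) auto
  then show "exp (real u * B) \<le> growth t" by simp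
  have "exp (real u * B) * (real CARD('l) * L ^ u) \<le> growth t" unfolding growth_def
    using e l L_nonneg by (intro mult_mono) (auto intro: add_increasing)
  then show "real CARD('l) * L ^ u * exp (real u * B) \<le> growth t" by (simp add: mult_ac)
qed

lemma P_growth:
  assumes \<eta>: "0 < \<eta>" "\<eta> \<le> 1" and u: "1 \<le> u" "u \<le> t" and f: "f \<in> borel_measurable borel"
    and c: "0 \<le> c" "\<And>x. \<bar>f x\<bar> \<le> c * exp (\<eta> * V x)"
  shows "\<bar>P u f x\<bar> \<le> c * growth t * exp (\<eta> * V x) * exp (- (\<eta> * \<delta>) * W x)"
proof -
  have "\<bar>P u f x\<bar> \<le> c * exp (real u * B) * exp (\<eta> * V x) * exp (- (\<eta> * \<delta>) * W x)"
    by (rule P_bound[OF \<eta> u(1) f c])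
  also have "\<dots> \<le> c * growth t * exp (\<eta> * V x) * exp (- (\<eta> * \<delta>) * W x)"
    using growth_bounds(1)[OF u(2)] c(1) by (intro mult_right_mono mult_left_mono) auto
  finally show ?thesis .
qed

lemma Q_growth:
  assumes \<eta>: "0 < \<eta>" "\<eta> \<le> 1" and u: "1 \<le> u" "u \<le> t" and T: "\<And>j. tight u (\<lambda>x. G x $ j)"
    and c: "0 \<le> c" "\<And>x j. \<bar>G x $ j\<bar> \<le> c * exp (\<eta> * V x)"
  shows "\<bar>Q_op M a N u G x $ k\<bar> \<le> c * growth t * exp (\<eta> * V x) * exp (- (\<eta> * \<delta>) * W x)"
proof -
  have "\<bar>Q_op M a N u G x $ k\<bar> \<le>
      real CARD('l) * L ^ u * (c * exp (real u * B) * exp (\<eta> * V x) * exp (- (\<eta> * \<delta>) * W x))"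
    by (rule Q_op_bound[OF \<eta> u(1) T c])
  also have "\<dots> = c * (real CARD('l) * L ^ u * exp (real u * B)) * exp (\<eta> * V x) * exp (- (\<eta> * \<delta>) * W x)"
    by (simp add: mult_ac)
  also have "\<dots> \<le> c * growth t * exp (\<eta> * V x) * exp (- (\<eta> * \<delta>) * W x)"
    using growth_bounds(2)[OF u(2)] c(1) by (intro mult_right_mono mult_left_mono) auto
  finally show ?thesis .
qed

end

text \<open>\<open>J\<close> is the gradient of the density in the initial state. Its joint
  continuity yields uniform continuity on products of balls, on which the choice of the mesh
  rests.\<close>

locale smooth_dv3_chain = dv3_chain M a N a' L V W \<delta> B t0 p
  for M :: "'w measure" and a :: "real^'l \<Rightarrow> real^'m \<Rightarrow> real^'l" and N a' L V W \<delta> B t0 p +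
  fixes J :: "(real^'l) \<times> (real^'l) \<Rightarrow> real^'l"
  assumes cont_J: "continuous_on UNIV J"
    and deriv_p: "\<And>x y. ((\<lambda>x. p (x, y)) has_derivative (\<lambda>h. J (x, y) \<bullet> h)) (at x)"
begin

lemma C1_p: "C1 (\<lambda>x. p (x, y)) (\<lambda>x. J (x, y))"
  by (rule C1I[OF deriv_p]) (auto intro!: continuous_on_compose2[OF cont_J] continuous_intros)

text \<open>With \<open>s = t - t0\<close>, the error is split into the part of \<open>P t f\<close> outside a large ball, the
  contribution of the tail of \<open>P s f\<close>, and the error of replacing the density \<open>p (x, \<cdot>)\<close> by a step
  function on a ball.  The last part is only estimated through its Lipschitz constant in \<open>x\<close>, which
  bounds its gradient without differentiating under the integral.\<close>

lemma finite_rank_approximation: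
  assumes \<eta>: "0 < \<eta>" "\<eta> \<le> 1" and t: "t \<ge> 2 * t0 + 1" and \<epsilon>: "\<epsilon> > 0"
    and w_def: "w = (\<lambda>x. exp (\<eta> * V x))"
  obtains n :: nat and \<sigma> \<Sigma> b and K :: "nat \<Rightarrow> (real^'l) measure" where
    "\<And>i. i < n \<Longrightarrow> C1 (\<sigma> i) (\<Sigma> i)" "0 \<le> b" "\<And>i x. i < n \<Longrightarrow> \<bar>\<sigma> i x\<bar> \<le> b * w x"
    "\<And>i x k. i < n \<Longrightarrow> \<bar>\<Sigma> i x $ k\<bar> \<le> b * w x"
    "\<And>i. i < n \<Longrightarrow> finite_measure (K i)" "\<And>i. i < n \<Longrightarrow> sets (K i) = sets borel"
    "\<And>i. i < n \<Longrightarrow> integrable (K i) w"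
    "\<forall>f c. continuous_on UNIV f \<longrightarrow> 0 \<le> c \<longrightarrow> (\<forall>x. \<bar>f x\<bar> \<le> c * w x) \<longrightarrow>
      (\<forall>x. \<bar>P t f x - (\<Sum>i<n. \<sigma> i x * (\<integral>y. f y \<partial>K i))\<bar> \<le> \<epsilon> * c * w x)"
    "\<forall>f G c. C1 f G \<longrightarrow> 0 \<le> c \<longrightarrow> (\<forall>x. \<bar>f x\<bar> \<le> c * w x) \<longrightarrow> (\<forall>x k. \<bar>G x $ k\<bar> \<le> c * w x) \<longrightarrow>
      (\<exists>H. C1 (\<lambda>x. P t f x - (\<Sum>i<n. \<sigma> i x * (\<integral>y. f y \<partial>K i))) H \<and> (\<forall>x k. \<bar>H x $ k\<bar> \<le> \<epsilon> * c * w x))"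
proof -
  \<comment> \<open>From \<open>t \<ge> 2 * t0 + 1\<close> follows \<open>s \<ge> t0 + 1\<close>:
    P^s f is then continuous, and of class C^1 when f is, even at \<eta> = 1.\<close>
  define s where "s = t - t0"
  have s: "t = t0 + s" "1 \<le> s" "s \<le> t" "t0 \<le> t" "s \<ge> t0 + 1" "1 \<le> t" "t \<ge> t0 + 1"
    using t t0 by (auto simp: s_def)
  define D where "D x = exp (- (\<eta> * \<delta>) * W x)" for x
  have D: "0 \<le> D x" "D x \<le> 1" for x using decay_le_1[OF \<eta>(1)] by (auto simp: D_def)
  have w: "1 \<le> w x" for x using weight_ge_1[OF \<eta>(1)] by (simp add: w_def)
  have w0: "0 \<le> w x" for x using w[of x] by linarith
  have cw: "continuous_on UNIV w" unfolding w_def by (intro continuous_intros cont_V)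
  have wv: "c * w x \<le> c * exp (V x)" if "0 \<le> c" for c x
    unfolding w_def by (rule mult_left_mono[OF weight_le_exp_V[OF \<eta>(2)] that])
  define \<Gamma> where "\<Gamma> = growth t"
  have \<Gamma>: "\<Gamma> > 0" by (simp add: \<Gamma>_def growth_pos)
  \<comment> \<open>Half of the error goes to the two cutoffs. In the gradient of the first, 5 is 1
    from the function plus 4 from the cutoff; in the second, 9 is 5 from the gradient of the tail
    plus 4 from the outer cutoff. The square reflects two applications of the growth bound.\<close>
  define e1 where "e1 = \<epsilon> / (2 * (5 * \<Gamma> + 9 * \<Gamma>\<^sup>2))"
  have e1: "0 < e1" "(5 * \<Gamma> + 9 * \<Gamma>\<^sup>2) * e1 = \<epsilon> / 2"
  proof -
    define Z where "Z = 5 * \<Gamma> + 9 * \<Gamma>\<^sup>2"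
    have "Z > 0" unfolding Z_def using \<Gamma> by (intro add_pos_pos) auto
    then show "0 < e1" "(5 * \<Gamma> + 9 * \<Gamma>\<^sup>2) * e1 = \<epsilon> / 2"
      using \<epsilon> unfolding e1_def Z_def[symmetric] by auto
  qed
  obtain r where r: "\<And>x. norm x > r \<Longrightarrow> D x \<le> e1"
    using exp_neg_compact_sublevels[OF W_sub _ e1(1), of "\<eta> * \<delta>"] \<eta>(1) \<delta> unfolding D_def by (metis mult_pos_pos)
  obtain \<psi> :: "real^'l \<Rightarrow> real" and \<Psi> R where \<psi>: "C1 \<psi> \<Psi>" "\<And>x. 0 \<le> \<psi> x" "\<And>x. \<psi> x \<le> 1"
    "\<And>x. norm x \<le> r \<Longrightarrow> \<psi> x = 1" "\<And>x. norm x \<le> r \<Longrightarrow> \<Psi> x = 0"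
    "\<And>x. norm x > R \<Longrightarrow> \<psi> x = 0" "\<And>x. norm x > R \<Longrightarrow> \<Psi> x = 0" "\<And>x. norm (\<Psi> x) \<le> 4"
    by (rule ex_cutoff[of r]) blast
  have \<Psi>4: "\<bar>\<Psi> x $ k\<bar> \<le> 4" for x k using component_le_norm_cart[of "\<Psi> x" k] \<psi>(8)[of x] by linarith
  have c\<psi>: "continuous_on UNIV \<psi>" by (rule C1_continuous[OF \<psi>(1)])
  have [measurable]: "\<psi> \<in> borel_measurable borel" by (rule borel_measurable_continuous_onI[OF c\<psi>])
  have C1m\<psi>: "C1 (\<lambda>x. 1 - \<psi> x) (\<lambda>x. - \<Psi> x)" using C1_diff[OF C1_const \<psi>(1), of 1] by simp
  define I where "I = (\<integral>y. \<psi> y * w y \<partial>lborel)"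
  have \<psi>w: "integrable lborel (\<lambda>y. \<psi> y * w y)"
  proof -
    have c: "continuous_on UNIV (\<lambda>y. \<psi> y * w y)" by (intro continuous_on_mult c\<psi> cw)
    obtain b where "0 \<le> b" and b: "\<And>y. \<bar>\<psi> y * w y\<bar> \<le> b"
      using compactly_supported_bounded[OF c, of R] \<psi>(6) by auto
    show ?thesis
      by (rule compactly_supported_integrable[OF borel_measurable_continuous_onI[OF c] b, where R=R]) (use \<psi>(6) in auto)
  qed
  have I: "0 \<le> I" unfolding I_def by (rule integral_nonneg_AE) (use \<psi>(2) w0 in auto)
  \<comment> \<open>The other half goes to the step function; \<open>I\<close> bounds the mass it is
    integrated against, up to the factor \<open>c * \<Gamma>\<close>, and the added 1 keeps the
    denominator positive.\<close>
  define e2 where "e2 = \<epsilon> / (2 * (\<Gamma> * I + 1))"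
  have e2: "0 < e2" "e2 * (\<Gamma> * I) \<le> \<epsilon> / 2"
  proof -
    have pos: "0 < \<Gamma> * I + 1" using \<Gamma> I by (intro add_nonneg_pos) auto
    then show "0 < e2" using \<epsilon> by (simp add: e2_def)
    have "e2 * (\<Gamma> * I) \<le> e2 * (\<Gamma> * I + 1)" using \<open>0 < e2\<close> by simp
    also have "\<dots> = \<epsilon> / 2"
    proof -
      have "\<epsilon> / (2 * Z) * Z = \<epsilon> / 2" if "Z > 0" for Z using that by simp
      from this[OF pos] show ?thesis unfolding e2_def .
    qed
    finally show "e2 * (\<Gamma> * I) \<le> \<epsilon> / 2" .
  qed
  \<comment> \<open>The density cut off in its first variable; \<open>H\<close> below is its
    gradient in that variable. The second variable is restricted separately, through the
    cells.\<close>
  define \<kappa> where "\<kappa> = (\<lambda>(x, y). \<psi> x * p (x, y))"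
  define H where "H = (\<lambda>(x, y). \<psi> x *\<^sub>R J (x, y) + p (x, y) *\<^sub>R \<Psi> x)"
  have c\<kappa>: "continuous_on UNIV \<kappa>"
    unfolding \<kappa>_def case_prod_beta'
    by (intro continuous_intros continuous_on_compose2[OF c\<psi>] continuous_on_compose2[OF cont_p]) auto
  have cH: "continuous_on UNIV H"
    unfolding H_def case_prod_beta'
    by (intro continuous_intros continuous_on_compose2[OF c\<psi>] continuous_on_compose2[OF cont_p]
        continuous_on_compose2[OF cont_J] continuous_on_compose2[OF C1D(2)[OF \<psi>(1)]]) auto
  have C1\<kappa>: "C1 (\<lambda>x. \<kappa> (x, y)) (\<lambda>x. H (x, y))" for y
    using C1_mult[OF \<psi>(1) C1_p, of y] by (simp add: \<kappa>_def H_def)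
  have \<kappa>0: "\<kappa> (x, y) = 0" "H (x, y) = 0" if "norm x > R" for x y
    using \<psi>(6,7)[OF that] by (auto simp: \<kappa>_def H_def)
  let ?B = "cball (0::real^'l) R"
  have "uniformly_continuous_on (?B \<times> ?B) \<kappa>" "uniformly_continuous_on (?B \<times> ?B) H"
    by (auto intro!: compact_uniformly_continuous compact_Times intro: continuous_on_subset[OF c\<kappa>] continuous_on_subset[OF cH])
  then obtain d1 d2 where d12: "d1 > 0" "d2 > 0"
    "\<And>z z'. z \<in> ?B \<times> ?B \<Longrightarrow> z' \<in> ?B \<times> ?B \<Longrightarrow> dist z z' < d1 \<Longrightarrow> dist (\<kappa> z) (\<kappa> z') < e2"
    "\<And>z z'. z \<in> ?B \<times> ?B \<Longrightarrow> z' \<in> ?B \<times> ?B \<Longrightarrow> dist z z' < d2 \<Longrightarrow> dist (H z) (H z') < e2"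
    unfolding uniformly_continuous_on_def using e2(1) by (metis dist_commute)
  define d where "d = min d1 d2"
  have d: "d > 0" using d12 by (simp add: d_def)
  \<comment> \<open>Both functions vanish for large x, so uniform continuity on the compact product
    extends to every x. This makes the later Lipschitz estimate global.\<close>
  have close: "\<bar>\<kappa> (x, y) - \<kappa> (x, y')\<bar> \<le> e2" "norm (H (x, y) - H (x, y')) \<le> e2"
    if "norm y \<le> R" "norm y' \<le> R" "dist y' y < d" for x y y'
  proof -
    have "\<bar>\<kappa> (x, y) - \<kappa> (x, y')\<bar> \<le> e2 \<and> norm (H (x, y) - H (x, y')) \<le> e2"
    proof (cases "norm x > R")
      case True then show ?thesis using \<kappa>0[OF True] e2(1) by simp
    next
      case False
      have "dist (x, y) (x, y') < d" using that(3) by (simp add: dist_Pair_Pair dist_commute)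
      then show ?thesis
        using d12(3,4)[of "(x, y)" "(x, y')"] that(1,2) False by (simp add: d_def dist_norm)
    qed
    then show "\<bar>\<kappa> (x, y) - \<kappa> (x, y')\<bar> \<le> e2" "norm (H (x, y) - H (x, y')) \<le> e2" by auto
  qed
  obtain n :: nat and z :: "nat \<Rightarrow> real^'l" and A where
    A [measurable]: "\<And>i. i < n \<Longrightarrow> A i \<in> sets borel" and
    Az: "\<And>i y. i < n \<Longrightarrow> y \<in> A i \<Longrightarrow> dist (z i) y < d" and
    AR: "\<And>i y. i < n \<Longrightarrow> y \<in> A i \<Longrightarrow> norm y \<le> R" and
    zR: "\<And>i. i < n \<Longrightarrow> norm (z i) \<le> R" and
    A1: "\<And>y. norm y \<le> R \<Longrightarrow> (\<Sum>i<n. indicator (A i) y) = (1::real)"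
    using finite_measurable_partition[OF d, of R thesis] by blast
  define \<sigma> where "\<sigma> i x = \<kappa> (x, z i)" for i x
  define \<Sigma> where "\<Sigma> i x = H (x, z i)" for i x
  \<comment> \<open>The cells carry the smooth cutoff as a weight, so that together they reproduce
    \<psi>, and the complementary part of P^s f is the differentiable function
    \<open>tail f\<close>.\<close>
  define q where "q i y = indicator (A i) y * \<psi> y" for i y
  define K where "K i = distr (density lborel (\<lambda>y. ennreal (q i y)) \<Otimes>\<^sub>M M) borel (\<lambda>z. X (fst z) s (snd z))" for i
  have q: "q i \<in> borel_measurable borel" "\<And>y. 0 \<le> q i y" "\<And>y. q i y \<le> 1" "\<And>y. norm y > R \<Longrightarrow> q i y = 0"
    if "i < n" for i
    using A[OF that] \<psi>(2,3,6) by (auto simp: q_def[abs_def] indicator_def)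
  have q_sum: "(\<Sum>i<n. q i y) = \<psi> y" for y
    using A1[of y] \<psi>(6)[of y] by (cases "norm y > R") (auto simp: q_def sum_distrib_right[symmetric])
  have Kint: "integrable (K i) f \<and> (\<integral>x. f x \<partial>K i) = (\<integral>y. q i y * P s f y \<partial>lborel)"
    if "i < n" "f \<in> borel_measurable borel" "0 \<le> c" "\<And>x. \<bar>f x\<bar> \<le> c * w x" for i f c
    unfolding K_def
    by (rule transported_measure(3)[OF q[OF that(1)] that(2,3)])
      (auto simp: w_def intro: weighted_dominated[OF \<eta>(2) that(3) that(4)[unfolded w_def]])
  have tw: "tight u f" if "f \<in> borel_measurable borel" "0 \<le> c" "\<And>x. \<bar>f x\<bar> \<le> c * w x" "u \<ge> t0 + 1" for u f c
    using tight_weighted[OF that(1,2), of \<eta> u] that(3,4) \<eta>(2) by (simp add: w_def)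
  have tD: "tight u f" if "f \<in> borel_measurable borel" "0 \<le> c" "\<And>x. \<bar>f x\<bar> \<le> c * w x * D x" for u f c
  proof (rule tight_decaying[OF that(1,2) _ W_sub])
    show "\<bar>f x\<bar> \<le> c * exp (V x) * exp (- (\<eta> * \<delta>) * W x)" for x
      using that(3)[of x] mult_right_mono[OF wv[OF that(2), of x] D(1)[of x]] by (simp add: D_def)
  qed (use \<eta>(1) \<delta> W_pos less_imp_le in auto)
  have P_g: "\<bar>P u f x\<bar> \<le> c * \<Gamma> * w x * D x"
    if "1 \<le> u" "u \<le> t" "f \<in> borel_measurable borel" "0 \<le> c" "\<And>x. \<bar>f x\<bar> \<le> c * w x" for u f c x
    unfolding w_def D_def \<Gamma>_def by (rule P_growth[OF \<eta> that(1-4)]) (use that(5) in \<open>simp add: w_def\<close>)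
  have Q_g: "\<bar>Q_op M a N u G x $ k\<bar> \<le> c * \<Gamma> * w x * D x"
    if "1 \<le> u" "u \<le> t" "\<And>j. tight u (\<lambda>x. G x $ j)" "0 \<le> c" "\<And>x j. \<bar>G x $ j\<bar> \<le> c * w x" for u G c x k
    unfolding w_def D_def \<Gamma>_def by (rule Q_growth[OF \<eta> that(1-4)]) (use that(5) in \<open>simp add: w_def\<close>)
  \<comment> \<open>Where \<open>1 - \<psi>\<close> is nonzero, x lies outside the ball of radius r,
    and there the decay factor \<open>D\<close> is at most \<open>e1\<close>.\<close>
  have cut: "\<bar>(1 - \<psi> x) * y\<bar> \<le> m * e1 * w x" if "\<bar>y\<bar> \<le> m * w x * D x" "0 \<le> m" for x y m
  proof (cases "norm x \<le> r")
    case True then show ?thesis using \<psi>(4) that(2) e1(1) w0 by simp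
  next
    case False
    have "\<bar>(1 - \<psi> x) * y\<bar> \<le> 1 * \<bar>y\<bar>"
      unfolding abs_mult using \<psi>(2,3)[of x] by (intro mult_right_mono) auto
    also have "\<dots> \<le> m * w x * D x" using that(1) by simp
    also have "\<dots> \<le> m * w x * e1" using False r[of x] that(2) w0[of x] by (intro mult_left_mono) auto
    finally show ?thesis by (simp add: mult_ac)
  qed
  have grad_cut: "\<bar>(1 - \<psi> x) * u - y * \<Psi> x $ k\<bar> \<le> 5 * m * e1 * w x" "\<bar>(1 - \<psi> x) * u - y * \<Psi> x $ k\<bar> \<le> 5 * m * w x * D x"
    if y: "\<bar>y\<bar> \<le> m * w x * D x" and u: "\<bar>u\<bar> \<le> m * w x * D x" and m: "0 \<le> m" for x y u m k
  proof -
    have 1: "\<bar>(1 - \<psi> x) * u - y * \<Psi> x $ k\<bar> \<le> 5 * m * w x * D x"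
    proof -
      have "\<bar>(1 - \<psi> x) * u - y * \<Psi> x $ k\<bar> \<le> \<bar>1 - \<psi> x\<bar> * \<bar>u\<bar> + \<bar>y\<bar> * \<bar>\<Psi> x $ k\<bar>"
        by (rule order_trans[OF abs_triangle_ineq4]) (simp add: abs_mult)
      also have "\<dots> \<le> 1 * (m * w x * D x) + (m * w x * D x) * 4"
        using \<psi>(2,3)[of x] y u \<Psi>4[of x k] D(1)[of x] w0[of x] m by (intro add_mono mult_mono) auto
      finally show ?thesis by (simp add: mult_ac)
    qed
    then show "\<bar>(1 - \<psi> x) * u - y * \<Psi> x $ k\<bar> \<le> 5 * m * w x * D x" .
    show "\<bar>(1 - \<psi> x) * u - y * \<Psi> x $ k\<bar> \<le> 5 * m * e1 * w x"
    proof (cases "norm x \<le> r")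
      case True then show ?thesis using \<psi>(4,5) m e1(1) w0 by simp
    next
      case False
      have "5 * m * w x * D x \<le> 5 * m * w x * e1" using False r[of x] m w0[of x] by (intro mult_left_mono) auto
      with 1 show ?thesis by (simp add: mult_ac)
    qed
  qed
  define T where "T f x = (\<Sum>i<n. \<sigma> i x * (\<integral>y. f y \<partial>K i))" for f x
  define tail where "tail f y = (1 - \<psi> y) * P s f y" for f y
  \<comment> \<open>\<open>E1\<close> is lost to the cutoff of P^t f, \<open>E2\<close> to that of
    P^s f. With \<open>E3\<close> defined as the remainder, its differentiability follows from that
    of the other terms; an integral formula is needed only for its size and its Lipschitz
    constant.\<close>
  define E1 where "E1 f x = (1 - \<psi> x) * P t f x" for f x
  define E2 where "E2 f x = \<psi> x * P t0 (tail f) x" for f x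
  define E3 where "E3 f x = P t f x - T f x - E1 f x - E2 f x" for f x
  define \<rho> where "\<rho> f i y = q i y * P s f y" for f i y
  have main: "tail f \<in> borel_measurable borel" "\<And>x. \<bar>P s f x\<bar> \<le> c * \<Gamma> * w x * D x" "\<And>x. \<bar>P t f x\<bar> \<le> c * \<Gamma> * w x * D x"
    "\<And>x. \<bar>tail f x\<bar> \<le> c * \<Gamma> * e1 * w x" "\<And>x. \<bar>E1 f x\<bar> \<le> c * \<Gamma> * e1 * w x"
    "\<And>x. \<bar>P t0 (tail f) x\<bar> \<le> c * \<Gamma> * e1 * \<Gamma> * w x"
    "\<And>x. \<bar>E3 f x\<bar> \<le> e2 * (c * \<Gamma> * I)" "\<And>x x'. \<bar>E3 f x - E3 f x'\<bar> \<le> e2 * (c * \<Gamma> * I) * norm (x - x')"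
    if f: "continuous_on UNIV f" and c: "0 \<le> c" and fc: "\<And>x. \<bar>f x\<bar> \<le> c * w x" for f c
  proof -
    have fm[measurable]: "f \<in> borel_measurable borel" by (rule borel_measurable_continuous_onI[OF f])
    have c\<Gamma>: "0 \<le> c * \<Gamma>" using c \<Gamma> by simp
    show tm[measurable]: "tail f \<in> borel_measurable borel" unfolding tail_def by measurable
    show Ps: "\<bar>P s f x\<bar> \<le> c * \<Gamma> * w x * D x" for x by (rule P_g[OF s(2,3) fm c fc])
    show Pt: "\<bar>P t f x\<bar> \<le> c * \<Gamma> * w x * D x" for x by (rule P_g[OF s(6) order_refl fm c fc])
    show tail: "\<bar>tail f x\<bar> \<le> c * \<Gamma> * e1 * w x" for x unfolding tail_def by (rule cut[OF Ps c\<Gamma>])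
    show "\<bar>E1 f x\<bar> \<le> c * \<Gamma> * e1 * w x" for x unfolding E1_def by (rule cut[OF Pt c\<Gamma>])
    show "\<bar>P t0 (tail f) x\<bar> \<le> c * \<Gamma> * e1 * \<Gamma> * w x" for x
    proof -
      have "\<bar>P t0 (tail f) x\<bar> \<le> c * \<Gamma> * e1 * \<Gamma> * w x * D x"
        by (rule P_g[OF t0 s(4) tm _ tail]) (use c\<Gamma> e1(1) in simp)
      also have "\<dots> \<le> c * \<Gamma> * e1 * \<Gamma> * w x * 1"
        using c\<Gamma> e1(1) \<Gamma> w0[of x] D(2)[of x] by (intro mult_left_mono) auto
      finally show ?thesis by simp
    qed
    have wD: "c * \<Gamma> * w x * D x \<le> c * \<Gamma> * w x" for x
      using mult_left_mono[OF D(2)[of x], of "c * \<Gamma> * w x"] c\<Gamma> w0[of x] by simp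
    have Psw: "\<bar>P s f x\<bar> \<le> c * \<Gamma> * w x" for x using Ps[of x] wD[of x] by linarith
    have cPs: "continuous_on UNIV (P s f)" by (rule P_continuous[OF tw[OF fm c fc s(5)] f])
    have Psv: "\<bar>P s f x\<bar> \<le> c * \<Gamma> * exp (V x)" for x
      using Psw[of x] wv[OF c\<Gamma>, of x] by linarith
    have \<rho>m: "\<rho> f i \<in> borel_measurable borel" if "i < n" for i
      using q(1)[OF that] unfolding \<rho>_def by measurable
    obtain b where "0 \<le> b" and b: "\<And>y. \<bar>\<psi> y * P s f y\<bar> \<le> b"
      using compactly_supported_bounded[of "\<lambda>y. \<psi> y * P s f y" R] \<psi>(6) c\<psi> cPs by (auto intro: continuous_on_mult)
    have \<rho>b: "\<bar>\<rho> f i y\<bar> \<le> \<bar>\<psi> y * P s f y\<bar>" for i y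
      by (simp add: \<rho>_def q_def indicator_def)
    have \<rho>i: "integrable lborel (\<rho> f i)" if "i < n" for i
      by (rule compactly_supported_integrable[OF \<rho>m[OF that] order_trans[OF \<rho>b b], where R=R])
        (use q(4)[OF that] in \<open>simp add: \<rho>_def\<close>)
    have \<rho>_supp: "y \<in> A i" if "\<rho> f i y \<noteq> 0" for i y using that by (auto simp: \<rho>_def q_def indicator_def split: if_splits)
    have p\<rho>i: "integrable lborel (\<lambda>y. p (x, y) * \<rho> f i y)" if "i < n" for i x
    proof -
      have cp: "continuous_on UNIV (\<lambda>y. p (x, y) * (\<psi> y * P s f y))"
        by (intro continuous_on_mult c\<psi> cPs continuous_on_compose2[OF cont_p]) (auto intro!: continuous_intros)
      obtain b' where "0 \<le> b'" and b': "\<And>y. \<bar>p (x, y) * (\<psi> y * P s f y)\<bar> \<le> b'"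
        using compactly_supported_bounded[OF cp, of R] \<psi>(6) by auto
      show ?thesis
      proof (rule compactly_supported_integrable[where R=R and b=b'])
        show "(\<lambda>y. p (x, y) * \<rho> f i y) \<in> borel_measurable borel"
          using \<rho>m[OF that] by measurable
        show "\<bar>p (x, y) * \<rho> f i y\<bar> \<le> b'" for y
          using b'[of y] mult_left_mono[OF \<rho>b[of i y], of "\<bar>p (x, y)\<bar>"] by (simp add: abs_mult)
      qed (use q(4)[OF that] in \<open>simp add: \<rho>_def\<close>)
    qed
    \<comment> \<open>The cells add up to \<psi>, so the total mass is bounded independently of
      their number. This lets the mesh depend on \<open>e2\<close>, which was fixed before the
      partition.\<close>
    have \<rho>_mass: "(\<Sum>i<n. \<integral>y. \<bar>\<rho> f i y\<bar> \<partial>lborel) \<le> c * \<Gamma> * I"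
    proof -
      have "(\<Sum>i<n. \<integral>y. \<bar>\<rho> f i y\<bar> \<partial>lborel) = (\<integral>y. (\<Sum>i<n. \<bar>\<rho> f i y\<bar>) \<partial>lborel)"
        by (rule Bochner_Integration.integral_sum[symmetric]) (use \<rho>i in auto)
      also have "\<dots> \<le> (\<integral>y. c * \<Gamma> * (\<psi> y * w y) \<partial>lborel)"
      proof (rule integral_mono)
        show "integrable lborel (\<lambda>y. \<Sum>i<n. \<bar>\<rho> f i y\<bar>)" using \<rho>i by auto
        show "integrable lborel (\<lambda>y. c * \<Gamma> * (\<psi> y * w y))" using \<psi>w by simp
        fix y
        have "(\<Sum>i<n. \<bar>\<rho> f i y\<bar>) = (\<Sum>i<n. q i y * \<bar>P s f y\<bar>)"
          by (rule sum.cong) (use q(2) in \<open>auto simp: \<rho>_def abs_mult\<close>)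
        also have "\<dots> = \<psi> y * \<bar>P s f y\<bar>" by (simp add: sum_distrib_right[symmetric] q_sum)
        also have "\<dots> \<le> \<psi> y * (c * \<Gamma> * w y)" by (rule mult_left_mono[OF Psw \<psi>(2)])
        finally show "(\<Sum>i<n. \<bar>\<rho> f i y\<bar>) \<le> c * \<Gamma> * (\<psi> y * w y)" by (simp add: mult_ac)
      qed
      also have "\<dots> = c * \<Gamma> * I" by (simp add: I_def)
      finally show ?thesis .
    qed
    define \<theta> where "\<theta> x i y = \<kappa> (x, y) - \<kappa> (x, z i)" for x i y
    have \<theta>i: "integrable lborel (\<lambda>y. \<theta> x i y * \<rho> f i y)" if "i < n" for x i
      using p\<rho>i[OF that, of x] \<rho>i[OF that] by (simp add: \<theta>_def \<kappa>_def left_diff_distrib mult.assoc)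
    have E3: "E3 f x = (\<Sum>i<n. \<integral>y. \<theta> x i y * \<rho> f i y \<partial>lborel)" for x
    proof -
      have i1: "integrable M (\<lambda>\<omega>. P s f (X x t0 \<omega>))"
        by (rule dominated_integrable[OF _ Psv]) measurable
      have i2: "integrable M (\<lambda>\<omega>. tail f (X x t0 \<omega>))"
      proof (rule dominated_integrable[OF tm])
        show "\<bar>tail f x\<bar> \<le> c * \<Gamma> * e1 * exp (V x)" for x
          using tail[of x] wv[of "c * \<Gamma> * e1" x] c\<Gamma> e1(1) by simp
      qed
      have "P t f x = P t0 (P s f) x"
        unfolding s(1) by (rule P_markov[OF fm tight_integrable[OF tw[OF fm c fc]]]) (use s in simp)
      also have "\<dots> = P t0 (tail f) x + P t0 (\<lambda>y. \<psi> y * P s f y) x"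
      proof -
        have "P t0 (\<lambda>y. \<psi> y * P s f y) x = (\<integral>\<omega>. P s f (X x t0 \<omega>) - tail f (X x t0 \<omega>) \<partial>M)"
          by (simp add: P_eq_expectation tail_def algebra_simps)
        also have "\<dots> = P t0 (P s f) x - P t0 (tail f) x"
          using i1 i2 by (simp add: P_eq_expectation)
        finally show ?thesis by simp
      qed
      also have "P t0 (\<lambda>y. \<psi> y * P s f y) x = (\<integral>y. (\<Sum>i<n. p (x, y) * \<rho> f i y) \<partial>lborel)"
        by (subst P_t0_density) (auto simp: \<rho>_def sum_distrib_left[symmetric] sum_distrib_right[symmetric] q_sum)
      also have "\<dots> = (\<Sum>i<n. \<integral>y. p (x, y) * \<rho> f i y \<partial>lborel)"
        by (rule Bochner_Integration.integral_sum) (use p\<rho>i in auto)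
      finally have Ptf: "P t f x = P t0 (tail f) x + (\<Sum>i<n. \<integral>y. p (x, y) * \<rho> f i y \<partial>lborel)" .
      have "E3 f x = \<psi> x * (P t f x - P t0 (tail f) x) - T f x"
        by (simp add: E3_def E1_def E2_def algebra_simps)
      also have "\<dots> = \<psi> x * (\<Sum>i<n. \<integral>y. p (x, y) * \<rho> f i y \<partial>lborel) - T f x" by (simp add: Ptf)
      also have "\<dots> = (\<Sum>i<n. \<psi> x * (\<integral>y. p (x, y) * \<rho> f i y \<partial>lborel) - \<kappa> (x, z i) * (\<integral>y. \<rho> f i y \<partial>lborel))"
        using Kint[OF _ fm c fc] by (simp add: T_def \<sigma>_def \<rho>_def sum_subtractf sum_distrib_left)
      also have "\<dots> = (\<Sum>i<n. \<integral>y. \<theta> x i y * \<rho> f i y \<partial>lborel)"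
      proof (rule sum.cong[OF refl])
        fix i assume "i \<in> {..<n}"
        then have i: "i < n" by simp
        have "(\<integral>y. \<theta> x i y * \<rho> f i y \<partial>lborel) = (\<integral>y. \<psi> x * (p (x, y) * \<rho> f i y) - \<kappa> (x, z i) * \<rho> f i y \<partial>lborel)"
          by (simp add: \<theta>_def \<kappa>_def left_diff_distrib mult.assoc)
        also have "\<dots> = \<psi> x * (\<integral>y. p (x, y) * \<rho> f i y \<partial>lborel) - \<kappa> (x, z i) * (\<integral>y. \<rho> f i y \<partial>lborel)"
          using p\<rho>i[OF i, of x] \<rho>i[OF i] by simp
        finally show "\<psi> x * (\<integral>y. p (x, y) * \<rho> f i y \<partial>lborel) - \<kappa> (x, z i) * (\<integral>y. \<rho> f i y \<partial>lborel)
          = (\<integral>y. \<theta> x i y * \<rho> f i y \<partial>lborel)" by simp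
      qed
      finally show ?thesis .
    qed
    have near: "norm y \<le> R" "norm (z i) \<le> R" "dist (z i) y < d" if "i < n" "\<rho> f i y \<noteq> 0" for i y
      using AR[OF that(1) \<rho>_supp[OF that(2)]] zR[OF that(1)] Az[OF that(1) \<rho>_supp[OF that(2)]] by auto
    show "\<bar>E3 f x\<bar> \<le> e2 * (c * \<Gamma> * I)" for x
      unfolding E3
    proof (rule weighted_sum_integral_bound[OF _ \<theta>i \<rho>i \<rho>_mass])
      fix i y assume i: "i < n"
      have "\<bar>\<theta> x i y\<bar> \<le> e2" if "\<rho> f i y \<noteq> 0"
        unfolding \<theta>_def by (rule close(1)[OF near[OF i that]])
      then show "\<bar>\<theta> x i y * \<rho> f i y\<bar> \<le> e2 * \<bar>\<rho> f i y\<bar>"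
        unfolding abs_mult by (cases "\<rho> f i y = 0") (auto intro: mult_right_mono)
    qed (use e2(1) in auto)
    show "\<bar>E3 f x - E3 f x'\<bar> \<le> e2 * (c * \<Gamma> * I) * norm (x - x')" for x x'
    proof -
      have "E3 f x - E3 f x' = (\<Sum>i<n. \<integral>y. (\<theta> x i y - \<theta> x' i y) * \<rho> f i y \<partial>lborel)"
        unfolding E3 sum_subtractf[symmetric] using \<theta>i by (intro sum.cong) (auto simp: left_diff_distrib)
      also have "\<bar>\<dots>\<bar> \<le> (e2 * norm (x - x')) * (c * \<Gamma> * I)"
      proof (rule weighted_sum_integral_bound[OF _ _ \<rho>i \<rho>_mass])
        fix i y assume i: "i < n"
        show "integrable lborel (\<lambda>y. (\<theta> x i y - \<theta> x' i y) * \<rho> f i y)"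
          using \<theta>i[OF i] by (simp add: left_diff_distrib)
        \<comment> \<open>As a function of x, \<open>\<theta>\<close> has gradient
          \<open>H (x, y) - H (x, z i)\<close>, of norm at most \<open>e2\<close> for every
          x.\<close>
        have "\<bar>\<theta> x i y - \<theta> x' i y\<bar> \<le> e2 * norm (x - x')" if "\<rho> f i y \<noteq> 0"
          unfolding \<theta>_def
          by (rule C1_lipschitz[OF C1_diff[OF C1\<kappa> C1\<kappa>]]) (rule close(2)[OF near[OF i that]])
        then show "\<bar>(\<theta> x i y - \<theta> x' i y) * \<rho> f i y\<bar> \<le> e2 * norm (x - x') * \<bar>\<rho> f i y\<bar>"
          unfolding abs_mult by (cases "\<rho> f i y = 0") (auto intro: mult_right_mono)
      qed (use e2(1) in auto)
      finally show ?thesis by (simp add: mult_ac)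
    qed
  qed
  \<comment> \<open>The bound on the third term carries no weight; it is absorbed because
    \<open>w\<close> is at least 1.\<close>
  have total: "A1' + A2' + A3' \<le> \<epsilon> * c * w x"
    if "0 \<le> c" "A1' \<le> 5 * (c * \<Gamma>) * e1 * w x" "A2' \<le> 9 * (c * \<Gamma> * e1 * \<Gamma>) * w x" "A3' \<le> e2 * (c * \<Gamma> * I)"
    for A1' A2' A3' c x
  proof -
    have "5 * (c * \<Gamma>) * e1 * w x + 9 * (c * \<Gamma> * e1 * \<Gamma>) * w x = ((5 * \<Gamma> + 9 * \<Gamma>\<^sup>2) * e1) * c * w x"
      by (simp add: algebra_simps power2_eq_square)
    then have 1: "A1' + A2' \<le> \<epsilon> / 2 * c * w x" using that(2,3) unfolding e1(2) by linarith
    have "e2 * (c * \<Gamma> * I) = e2 * (\<Gamma> * I) * c" by simp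
    also have "\<dots> \<le> \<epsilon> / 2 * c" using e2(2) that(1) by (rule mult_right_mono)
    also have "\<dots> \<le> \<epsilon> / 2 * c * w x" using mult_left_mono[OF w[of x], of "\<epsilon> / 2 * c"] \<epsilon> that(1) by simp
    finally show ?thesis using 1 that(4) by linarith
  qed
  have decomposition: "P t f x - T f x = E1 f x + E2 f x + E3 f x" for f x by (simp add: E3_def)
  have bound0: "\<bar>P t f x - T f x\<bar> \<le> \<epsilon> * c * w x"
    if f: "continuous_on UNIV f" and c: "0 \<le> c" and fc: "\<And>x. \<bar>f x\<bar> \<le> c * w x" for f c x
  proof -
    note m = main[OF f c fc]
    have c\<Gamma>: "0 \<le> c * \<Gamma>" using c \<Gamma> by simp
    have nn: "0 \<le> c * \<Gamma> * e1 * w x" "0 \<le> c * \<Gamma> * e1 * \<Gamma> * w x"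
      using c\<Gamma> e1(1) w0[of x] \<Gamma> by auto
    have "\<bar>E2 f x\<bar> \<le> 1 * \<bar>P t0 (tail f) x\<bar>"
      unfolding E2_def abs_mult using \<psi>(2,3)[of x] by (intro mult_right_mono) auto
    \<comment> \<open>The factors 5 and 9 are those of the gradients; for the functions themselves
      they are generous, and one budget serves both norms.\<close>
    then have "\<bar>E2 f x\<bar> \<le> 9 * (c * \<Gamma> * e1 * \<Gamma>) * w x" using m(6)[of x] nn by linarith
    moreover have "\<bar>E1 f x\<bar> \<le> 5 * (c * \<Gamma>) * e1 * w x" using m(5)[of x] nn by linarith
    ultimately have "\<bar>E1 f x\<bar> + \<bar>E2 f x\<bar> + \<bar>E3 f x\<bar> \<le> \<epsilon> * c * w x"
      using m(7)[of x] by (intro total[OF c])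
    then show ?thesis unfolding decomposition by linarith
  qed
  have C1T: "C1 (T f) (\<lambda>x. \<Sum>i<n. (\<integral>y. f y \<partial>K i) *\<^sub>R \<Sigma> i x)" for f
    unfolding T_def[abs_def] by (rule C1_sum, rule C1_cmult) (simp add: \<sigma>_def[abs_def] \<Sigma>_def[abs_def] C1\<kappa>)
  have bound1: "\<exists>H. C1 (\<lambda>x. P t f x - T f x) H \<and> (\<forall>x k. \<bar>H x $ k\<bar> \<le> \<epsilon> * c * w x)"
    if C: "C1 f G" and c: "0 \<le> c" and fc: "\<And>x. \<bar>f x\<bar> \<le> c * w x" and Gc: "\<And>x k. \<bar>G x $ k\<bar> \<le> c * w x" for f G c
  proof -
    have f: "continuous_on UNIV f" by (rule C1_continuous[OF C])
    have fm: "f \<in> borel_measurable borel" by (rule borel_measurable_continuous_onI[OF f])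
    have Gm: "(\<lambda>x. G x $ k) \<in> borel_measurable borel" for k
      using C1D(2)[OF C] by (intro borel_measurable_continuous_onI continuous_intros)
    note m = main[OF f c fc]
    have c\<Gamma>: "0 \<le> c * \<Gamma>" using c \<Gamma> by simp
    have ce: "0 \<le> c * \<Gamma> * e1" using c\<Gamma> e1(1) by simp
    have tG: "tight u (\<lambda>x. G x $ k)" if "u \<ge> t0 + 1" for u k by (rule tw[OF Gm c Gc that])
    define Qs where "Qs = Q_op M a N s G"
    define Qt where "Qt = Q_op M a N t G"
    have Cs: "C1 (P s f) Qs" unfolding Qs_def by (rule C1_P[OF C tw[OF fm c fc s(5)] tG[OF s(5)]])
    have Ct: "C1 (P t f) Qt" unfolding Qt_def by (rule C1_P[OF C tw[OF fm c fc s(7)] tG[OF s(7)]])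
    have Qsb: "\<bar>Qs x $ k\<bar> \<le> c * \<Gamma> * w x * D x" for x k
      unfolding Qs_def by (rule Q_g[OF s(2,3) tG[OF s(5)] c Gc])
    have Qtb: "\<bar>Qt x $ k\<bar> \<le> c * \<Gamma> * w x * D x" for x k
      unfolding Qt_def by (rule Q_g[OF s(6) order_refl tG[OF s(7)] c Gc])
    define Gt where "Gt x = (1 - \<psi> x) *\<^sub>R Qs x - P s f x *\<^sub>R \<Psi> x" for x
    have Ctail: "C1 (tail f) Gt"
      using C1_mult[OF C1m\<psi> Cs] by (simp add: tail_def[abs_def] Gt_def[abs_def])
    have Gtk: "Gt x $ k = (1 - \<psi> x) * Qs x $ k - P s f x * \<Psi> x $ k" for x k by (simp add: Gt_def)
    have Gt1: "\<bar>Gt x $ k\<bar> \<le> 5 * (c * \<Gamma>) * e1 * w x" and Gt2: "\<bar>Gt x $ k\<bar> \<le> 5 * (c * \<Gamma>) * w x * D x" for x k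
      unfolding Gtk by (rule grad_cut[OF m(2) Qsb c\<Gamma>])+
    have Gtm: "(\<lambda>x. Gt x $ k) \<in> borel_measurable borel" for k
      using C1D(2)[OF Ctail] by (intro borel_measurable_continuous_onI continuous_intros)
    \<comment> \<open>Time \<open>t0\<close> is too short for \<open>tw\<close>, so tightness comes
      from the decay factor kept in \<open>Gt2\<close>. The small constant in \<open>Gt1\<close> is
      used afterwards for the size.\<close>
    have tGt: "tight t0 (\<lambda>x. Gt x $ k)" for k
      by (rule tD[OF Gtm _ Gt2]) (use c\<Gamma> in simp)
    have ttail: "tight t0 (tail f)"
    proof (rule tD[OF m(1) c\<Gamma>])
      show "\<bar>tail f x\<bar> \<le> c * \<Gamma> * w x * D x" for x
        using m(2)[of x] mult_right_mono[of "\<bar>1 - \<psi> x\<bar>" 1 "\<bar>P s f x\<bar>"] \<psi>(2,3)[of x]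
        by (simp add: tail_def abs_mult)
    qed
    define Q0 where "Q0 = Q_op M a N t0 Gt"
    have C0: "C1 (P t0 (tail f)) Q0" unfolding Q0_def by (rule C1_P[OF Ctail ttail tGt])
    have Q0b: "\<bar>Q0 x $ k\<bar> \<le> 5 * (c * \<Gamma>) * e1 * \<Gamma> * w x" for x k
    proof -
      have "\<bar>Q0 x $ k\<bar> \<le> 5 * (c * \<Gamma>) * e1 * \<Gamma> * w x * D x"
        unfolding Q0_def by (rule Q_g[OF t0 s(4) tGt _ Gt1]) (use c\<Gamma> e1(1) in simp)
      also have "\<dots> \<le> 5 * (c * \<Gamma>) * e1 * \<Gamma> * w x * 1"
        using c\<Gamma> e1(1) \<Gamma> w0[of x] D(2)[of x] by (intro mult_left_mono) auto
      finally show ?thesis by simp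
    qed
    define H1 where "H1 x = (1 - \<psi> x) *\<^sub>R Qt x - P t f x *\<^sub>R \<Psi> x" for x
    define H2 where "H2 x = \<psi> x *\<^sub>R Q0 x + P t0 (tail f) x *\<^sub>R \<Psi> x" for x
    have CE1: "C1 (E1 f) H1"
      using C1_mult[OF C1m\<psi> Ct] by (simp add: E1_def[abs_def] H1_def[abs_def])
    have CE2: "C1 (E2 f) H2"
      using C1_mult[OF \<psi>(1) C0] by (simp add: E2_def[abs_def] H2_def[abs_def])
    have CPT: "C1 (\<lambda>x. P t f x - T f x) (\<lambda>x. Qt x - (\<Sum>i<n. (\<integral>y. f y \<partial>K i) *\<^sub>R \<Sigma> i x))"
      by (rule C1_diff[OF Ct C1T])
    \<comment> \<open>This field is merely the difference of known gradients; its bound comes from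
      the Lipschitz estimate for \<open>E3\<close>.\<close>
    define H3 where "H3 x = Qt x - (\<Sum>i<n. (\<integral>y. f y \<partial>K i) *\<^sub>R \<Sigma> i x) - H1 x - H2 x" for x
    have CE3: "C1 (E3 f) H3"
      unfolding E3_def[abs_def] H3_def[abs_def] by (rule C1_diff[OF C1_diff[OF CPT CE1] CE2])
    have H1b: "\<bar>H1 x $ k\<bar> \<le> 5 * (c * \<Gamma>) * e1 * w x" for x k
      unfolding H1_def using grad_cut(1)[OF m(3) Qtb c\<Gamma>] by simp
    have H2b: "\<bar>H2 x $ k\<bar> \<le> 9 * (c * \<Gamma> * e1 * \<Gamma>) * w x" for x k
    proof -
      have "\<bar>H2 x $ k\<bar> \<le> \<bar>\<psi> x\<bar> * \<bar>Q0 x $ k\<bar> + \<bar>P t0 (tail f) x\<bar> * \<bar>\<Psi> x $ k\<bar>"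
        unfolding H2_def by (simp add: abs_mult[symmetric] abs_triangle_ineq)
      also have "\<dots> \<le> 1 * (5 * (c * \<Gamma>) * e1 * \<Gamma> * w x) + (c * \<Gamma> * e1 * \<Gamma> * w x) * 4"
        using \<psi>(2,3)[of x] Q0b[of x k] m(6)[of x] \<Psi>4[of x k] ce \<Gamma> w0[of x]
        by (intro add_mono mult_mono) auto
      finally show ?thesis by (simp add: algebra_simps)
    qed
    have H3b: "\<bar>H3 x $ k\<bar> \<le> e2 * (c * \<Gamma> * I)" for x k
      by (rule C1_gradient_bound[OF CE3 m(8)])
    show ?thesis
    proof (intro exI conjI allI)
      show "C1 (\<lambda>x. P t f x - T f x) (\<lambda>x. Qt x - (\<Sum>i<n. (\<integral>y. f y \<partial>K i) *\<^sub>R \<Sigma> i x))" by (rule CPT)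
      fix x k
      have "(Qt x - (\<Sum>i<n. (\<integral>y. f y \<partial>K i) *\<^sub>R \<Sigma> i x)) $ k = H1 x $ k + H2 x $ k + H3 x $ k"
        by (simp add: H3_def)
      moreover have "\<bar>H1 x $ k\<bar> + \<bar>H2 x $ k\<bar> + \<bar>H3 x $ k\<bar> \<le> \<epsilon> * c * w x"
        by (rule total[OF c H1b H2b H3b])
      ultimately show "\<bar>(Qt x - (\<Sum>i<n. (\<integral>y. f y \<partial>K i) *\<^sub>R \<Sigma> i x)) $ k\<bar> \<le> \<epsilon> * c * w x" by linarith
    qed
  qed
  have "\<exists>b\<ge>0. \<forall>i<n. \<forall>x. \<bar>\<sigma> i x\<bar> \<le> b \<and> (\<forall>k. \<bar>\<Sigma> i x $ k\<bar> \<le> b)"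
  proof -
    have "bounded (\<kappa> ` (?B \<times> ?B) )" "bounded (H ` (?B \<times> ?B))"
      by (auto intro!: compact_imp_bounded compact_continuous_image compact_Times intro: continuous_on_subset[OF c\<kappa>] continuous_on_subset[OF cH])
    then obtain b1 b2 where b: "0 < b1" "0 < b2" "\<And>z. z \<in> ?B \<times> ?B \<Longrightarrow> norm (\<kappa> z) \<le> b1" "\<And>z. z \<in> ?B \<times> ?B \<Longrightarrow> norm (H z) \<le> b2"
      unfolding bounded_pos by auto
    have "\<bar>\<sigma> i x\<bar> \<le> b1 + b2 \<and> (\<forall>k. \<bar>\<Sigma> i x $ k\<bar> \<le> b1 + b2)" if i: "i < n" for i x
    proof (cases "norm x > R")
      case True then show ?thesis using \<kappa>0[OF True] b by (simp add: \<sigma>_def \<Sigma>_def)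
    next
      case False
      then have "(x, z i) \<in> ?B \<times> ?B" using zR[OF i] by simp
      from b(3)[OF this] order_trans[OF component_le_norm_cart b(4)[OF this]] b(1,2) show ?thesis
        by (auto simp: \<sigma>_def \<Sigma>_def intro: add_increasing add_increasing2)
    qed
    then show ?thesis using b(1,2) by (intro exI[of _ "b1 + b2"]) auto
  qed
  then obtain b where b: "0 \<le> b" "\<And>i x. i < n \<Longrightarrow> \<bar>\<sigma> i x\<bar> \<le> b" "\<And>i x k. i < n \<Longrightarrow> \<bar>\<Sigma> i x $ k\<bar> \<le> b" by blast
  have bw: "b \<le> b * w x" for x using mult_left_mono[OF w[of x] b(1)] by simp
  show thesis
  proof (rule that[of n \<sigma> \<Sigma> b K])
    show "C1 (\<sigma> i) (\<Sigma> i)" for i by (simp add: \<sigma>_def[abs_def] \<Sigma>_def[abs_def] C1\<kappa>)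
    show "0 \<le> b" by fact
    show "\<bar>\<sigma> i x\<bar> \<le> b * w x" if "i < n" for i x using b(2)[OF that] bw order_trans by blast
    show "\<bar>\<Sigma> i x $ k\<bar> \<le> b * w x" if "i < n" for i x k using b(3)[OF that] bw order_trans by blast
    show "finite_measure (K i)" if "i < n" for i
      unfolding K_def by (rule transported_measure(1)[OF q[OF that]])
    show "sets (K i) = sets borel" for i by (simp add: K_def)
    show "integrable (K i) w" if "i < n" for i
      using Kint[OF that borel_measurable_continuous_onI[OF cw], of 1] w0 by simp
    show "\<forall>f c. continuous_on UNIV f \<longrightarrow> 0 \<le> c \<longrightarrow> (\<forall>x. \<bar>f x\<bar> \<le> c * w x) \<longrightarrow>
      (\<forall>x. \<bar>P t f x - (\<Sum>i<n. \<sigma> i x * (\<integral>y. f y \<partial>K i))\<bar> \<le> \<epsilon> * c * w x)"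
      using bound0 by (auto simp: T_def)
    show "\<forall>f G c. C1 f G \<longrightarrow> 0 \<le> c \<longrightarrow> (\<forall>x. \<bar>f x\<bar> \<le> c * w x) \<longrightarrow> (\<forall>x k. \<bar>G x $ k\<bar> \<le> c * w x) \<longrightarrow>
      (\<exists>H. C1 (\<lambda>x. P t f x - (\<Sum>i<n. \<sigma> i x * (\<integral>y. f y \<partial>K i))) H \<and> (\<forall>x k. \<bar>H x $ k\<bar> \<le> \<epsilon> * c * w x))"
      using bound1 by (simp add: T_def)
  qed
qed

end

section \<open>Separability\<close>

text \<open>For a positive measure the supremum over Borel subsets of \<open>A\<close> is attained
  at \<open>A\<close> itself.\<close>

lemma pos_part_measure:
  fixes K :: "(real^'l) measure"
  assumes "finite_measure K" and sets: "sets K = sets borel"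
  shows "pos_part (measure K) = K"
proof -
  interpret finite_measure K by fact
  have space: "space K = UNIV" using sets_eq_imp_space_eq[OF sets] by simp
  have "pos_part (measure K) = measure_of UNIV (sets borel) (emeasure K)"
    unfolding pos_part_def
  proof (rule measure_of_eq)
    fix A :: "(real^'l) set" assume "A \<in> sigma_sets UNIV (sets borel)"
    then have A: "A \<in> sets borel" using sets.sigma_sets_eq[of "borel :: (real^'l) measure"] by simp
    show "(SUP B\<in>{B \<in> sets borel. B \<subseteq> A}. ennreal (measure K B)) = emeasure K A"
    proof (rule antisym)
      show "(SUP B\<in>{B \<in> sets borel. B \<subseteq> A}. ennreal (measure K B)) \<le> emeasure K A"
        using A sets by (auto intro!: SUP_least emeasure_mono simp: emeasure_eq_measure[symmetric])
      show "emeasure K A \<le> (SUP B\<in>{B \<in> sets borel. B \<subseteq> A}. ennreal (measure K B))"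
        using A by (intro SUP_upper2[of A]) (auto simp: emeasure_eq_measure)
    qed
  qed simp
  also have "\<dots> = K" using measure_of_of_measure[of K] by (simp add: space sets)
  finally show ?thesis .
qed

text \<open>Every value in the supremum is \<open>ennreal\<close> of a nonpositive number, which is
  truncated to 0.\<close>

lemma neg_part_measure:
  fixes K :: "(real^'l) measure"
  shows "neg_part (measure K) = null_measure borel"
proof -
  have "neg_part (measure K) = measure_of UNIV (sets borel) (\<lambda>_. 0)"
    unfolding neg_part_def pos_part_def
  proof (rule measure_of_eq)
    fix A :: "(real^'l) set"
    show "(SUP B\<in>{B \<in> sets borel. B \<subseteq> A}. ennreal (- measure K B)) = 0"
      by (rule antisym[OF SUP_least]) (auto simp: ennreal_neg)
  qed simp
  then show ?thesis by (simp add: null_measure_def)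
qed

text \<open>For a positive measure the signed integral is the ordinary one, and its w-norm is at
  most the integral of \<open>w\<close>.\<close>

lemma measure_in_M1:
  fixes K :: "(real^'l) measure"
  assumes K: "finite_measure K" "sets K = sets borel" and w: "\<And>x. w x > 0" "integrable K w"
  shows "measure K \<in> M1 w"
    and "h \<in> L_inf w \<Longrightarrow> integrable K h"
    and "h \<in> borel_measurable borel \<Longrightarrow> sm_integral (measure K) h = (\<integral>x. h x \<partial>K)"
proof -
  interpret finite_measure K by fact
  show int: "integrable K h" if "h \<in> L_inf w" for h
  proof -
    from that have m: "h \<in> borel_measurable borel" and "\<exists>c\<ge>0. \<forall>x. \<bar>h x\<bar> \<le> c * w x" by (auto simp: mem_L_inf_iff[of w h] w)
    then obtain c where c: "c \<ge> 0" "\<And>x. \<bar>h x\<bar> \<le> c * w x" by blast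
    show ?thesis
    proof (rule Bochner_Integration.integrable_bound)
      show "integrable K (\<lambda>x. c * w x)" using w by simp
      show "h \<in> borel_measurable K" using m K(2) by (simp cong: measurable_cong_sets)
      show "AE x in K. norm (h x) \<le> norm (c * w x)" using order_trans[OF c(2) abs_ge_self] by simp
    qed
  qed
  show sm: "sm_integral (measure K) h = (\<integral>x. h x \<partial>K)" for h
    by (simp add: sm_integral_def pos_part_measure[OF K] neg_part_measure)
  have "signed_measure (measure K)"
    unfolding signed_measure_def
  proof (intro conjI allI impI)
    fix A :: "nat \<Rightarrow> (real^'l) set" assume A: "range A \<subseteq> sets borel \<and> disjoint_family A"
    show "(\<lambda>n. measure K (A n)) sums measure K (\<Union>n. A n)"
      using A K(2) by (intro finite_measure_UNION) auto
  qed simp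
  moreover have "sm_integrable (measure K) h" if "h \<in> L_inf w" for h
    using int[OF that] that by (auto simp: sm_integrable_def pos_part_measure[OF K] neg_part_measure L_inf_def)
  moreover have "sm_norm w (measure K) < \<infinity>"
  proof -
    have "sm_norm w (measure K) \<le> ennreal (\<integral>x. w x \<partial>K)"
      unfolding sm_norm_def
    proof (rule SUP_least)
      fix h assume "h \<in> {h \<in> L_inf w. wnorm w h \<noteq> 0}"
      then have h: "h \<in> L_inf w" "wnorm w h \<noteq> 0" "wnorm w h < \<infinity>" by (auto simp: L_inf_def)
      obtain c where c: "0 \<le> c" "wnorm w h = ennreal c" "\<And>x. \<bar>h x\<bar> \<le> c * w x"
        by (rule wnorm_finite[of w h, OF w(1) h(3)]) (rule that)
      have c0: "c > 0" using c(1,2) h(2) by (cases "c = 0") auto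
      have "\<bar>\<integral>x. h x \<partial>K\<bar> \<le> (\<integral>x. c * w x \<partial>K)"
        by (rule order_trans[OF integral_abs_bound integral_mono]) (use int[OF h(1)] w c(3) in auto)
      then have "ennreal \<bar>\<integral>x. h x \<partial>K\<bar> / ennreal c \<le> ennreal (c * (\<integral>x. w x \<partial>K)) / ennreal c"
        by (intro divide_right_mono_ennreal ennreal_leI) simp
      also have "\<dots> = ennreal (\<integral>x. w x \<partial>K)"
        using c0 w(1) by (subst divide_ennreal) (auto intro!: integral_nonneg_AE mult_nonneg_nonneg simp: less_imp_le)
      finally show "ennreal \<bar>sm_integral (measure K) h\<bar> / wnorm w h \<le> ennreal (\<integral>x. w x \<partial>K)"
        by (simp add: sm c(2))
    qed
    then show ?thesis using ennreal_less_top le_less_trans by (metis infinity_ennreal_def)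
  qed
  ultimately show "measure K \<in> M1 w" by (simp add: M1_def)
qed

section \<open>Operator norms and operators of finite rank\<close>

lemma Lk_subset_L_inf0: "f \<in> Lk w k \<Longrightarrow> f \<in> L_inf0 w"
  by (auto simp: Lk_def L_inf1_def split: if_splits)

lemma L_inf1_subset_Lk: "f \<in> L_inf1 w \<Longrightarrow> f \<in> Lk w k"
  by (auto simp: Lk_def L_inf1_def)

lemma wnorm1_le_iff:
  "wnorm1 w f \<le> e \<longleftrightarrow> wnorm w f \<le> e \<and> (\<forall>i. wnorm w (partial i f) \<le> e)"
  unfolding wnorm1_def by (subst Max_le_iff) auto

text \<open>The estimates hold for every admissible constant \<open>c\<close>, so the norm of f can
  be inserted for it; functions of norm 0 are excluded from the supremum, which permits division.
  The case k = 1 combines both estimates.\<close>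

lemma opnorm_leI:
  assumes w: "\<And>x. w x > 0" and \<epsilon>: "0 \<le> \<epsilon>" and k: "k \<in> {0, 1}"
    and 0: "\<And>f c x. continuous_on UNIV f \<Longrightarrow> 0 \<le> c \<Longrightarrow> (\<And>x. \<bar>f x\<bar> \<le> c * w x) \<Longrightarrow> \<bar>Z f x\<bar> \<le> \<epsilon> * c * w x"
    and 1: "\<And>f G c. C1 f G \<Longrightarrow> 0 \<le> c \<Longrightarrow> (\<And>x. \<bar>f x\<bar> \<le> c * w x) \<Longrightarrow> (\<And>x k. \<bar>G x $ k\<bar> \<le> c * w x) \<Longrightarrow>
      \<exists>H. C1 (Z f) H \<and> (\<forall>x k. \<bar>H x $ k\<bar> \<le> \<epsilon> * c * w x)"
  shows "opnorm w k Z \<le> ennreal \<epsilon>"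
  unfolding opnorm_def
proof (rule SUP_least)
  fix f assume f: "f \<in> {f \<in> Lk w k. normk w k f \<noteq> 0}"
  have fin: "normk w k f < \<infinity>"
  proof (cases "k = 0")
    case True
    then show ?thesis using f by (auto simp: Lk_def normk_def L_inf0_def L_inf_def)
  next
    case False
    then have "wnorm w f < \<infinity>" "\<And>i. wnorm w (partial i f) < \<infinity>"
      using f by (auto simp: Lk_def L_inf1_def L_inf0_def L_inf_def)
    then show ?thesis using False by (simp add: normk_def wnorm1_def Max_less_iff)
  qed
  then obtain c where c: "0 \<le> c" "normk w k f = ennreal c" by (cases "normk w k f") auto
  have c0: "c > 0" using c f by (cases "c = 0") auto
  have \<epsilon>c: "0 \<le> \<epsilon> * c" using \<epsilon> c by simp
  have "normk w k (Z f) \<le> ennreal (\<epsilon> * c)"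
  proof (cases "k = 0")
    case True
    then have "continuous_on UNIV f" using f by (auto simp: Lk_def L_inf0_def)
    moreover have "\<And>x. \<bar>f x\<bar> \<le> c * w x" using c True wnorm_le_iff[of w c f] w by (auto simp: normk_def)
    ultimately have "\<And>x. \<bar>Z f x\<bar> \<le> \<epsilon> * c * w x" using 0 c(1) by blast
    then show ?thesis using True wnorm_le_iff[of w "\<epsilon> * c" "Z f"] w \<epsilon>c by (auto simp: normk_def)
  next
    case False
    then have "f \<in> L_inf1 w" using f by (auto simp: Lk_def)
    then obtain G where C: "C1 f G" by (auto simp: mem_L_inf1_iff[OF w])
    have le: "wnorm w f \<le> ennreal c" "\<And>i. wnorm w (partial i f) \<le> ennreal c"
      using c(2) False wnorm1_le_iff[of w f "ennreal c"] by (auto simp: normk_def)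
    have fc: "\<And>x. \<bar>f x\<bar> \<le> c * w x" using le(1) wnorm_le_iff[of w c f] w c(1) by auto
    have Gc: "\<And>x i. \<bar>G x $ i\<bar> \<le> c * w x"
      using le(2) wnorm_le_iff[of w c "partial _ f"] w c(1) by (auto simp: C1_partial(2)[OF C])
    obtain H where H: "C1 (Z f) H" "\<And>x k. \<bar>H x $ k\<bar> \<le> \<epsilon> * c * w x" using 1[OF C c(1) fc Gc] by blast
    have "\<And>x. \<bar>Z f x\<bar> \<le> \<epsilon> * c * w x" using 0[OF C1_continuous[OF C] c(1) fc] .
    then have "wnorm w (Z f) \<le> ennreal (\<epsilon> * c)" using wnorm_le_iff[of w "\<epsilon> * c" "Z f"] w \<epsilon>c by auto
    moreover have "wnorm w (partial i (Z f)) \<le> ennreal (\<epsilon> * c)" for i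
      using wnorm_le_iff[of w "\<epsilon> * c" "partial i (Z f)"] w \<epsilon>c H(2) by (auto simp: C1_partial(2)[OF H(1)])
    ultimately show ?thesis using False by (simp add: normk_def wnorm1_le_iff)
  qed
  then have "normk w k (Z f) / normk w k f \<le> ennreal (\<epsilon> * c) / ennreal c"
    unfolding c(2) by (rule divide_right_mono_ennreal)
  also have "\<dots> = ennreal \<epsilon>" using c0 \<epsilon>c by (simp add: divide_ennreal)
  finally show "normk w k (Z f) / normk w k f \<le> ennreal \<epsilon>" .
qed

text \<open>Membership of each \<open>\<sigma> i\<close> in \<open>L_inf1\<close> serves both values
  of k. The image of any f is a finite combination of these functions, so it lies in the
  space.\<close>

lemma finite_rank_measures:
  fixes K :: "nat \<Rightarrow> (real^'l) measure"
  assumes w: "\<And>x. w x > 0"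
    and \<sigma>: "\<And>i. i < n \<Longrightarrow> C1 (\<sigma> i) (\<Sigma> i)" "0 \<le> b" "\<And>i x. i < n \<Longrightarrow> \<bar>\<sigma> i x\<bar> \<le> b * w x"
      "\<And>i x k. i < n \<Longrightarrow> \<bar>\<Sigma> i x $ k\<bar> \<le> b * w x"
    and K: "\<And>i. i < n \<Longrightarrow> finite_measure (K i)" "\<And>i. i < n \<Longrightarrow> sets (K i) = sets borel"
      "\<And>i. i < n \<Longrightarrow> integrable (K i) w"
  shows "finite_rank w k (\<lambda>f x. \<Sum>i<n. \<sigma> i x * (\<integral>y. f y \<partial>K i))"
proof -
  define T where "T f x = (\<Sum>i<n. \<sigma> i x * (\<integral>y. f y \<partial>K i))" for f x
  have \<sigma>L: "\<sigma> i \<in> L_inf1 w" if "i < n" for i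
    using \<sigma>(1)[OF that] \<sigma>(2) \<sigma>(3)[OF that] \<sigma>(4)[OF that] unfolding mem_L_inf1_iff[OF w]
    by (intro exI[of _ "\<Sigma> i"] conjI exI[of _ b]) auto
  have TL: "T f \<in> L_inf1 w" for f
  proof -
    define m where "m = (\<Sum>i<n. b * \<bar>\<integral>y. f y \<partial>K i\<bar>)"
    have C: "C1 (T f) (\<lambda>x. \<Sum>i<n. (\<integral>y. f y \<partial>K i) *\<^sub>R \<Sigma> i x)"
      unfolding T_def[abs_def] by (rule C1_sum, rule C1_cmult, rule \<sigma>(1)) simp
    have m0: "0 \<le> m" unfolding m_def using \<sigma>(2) by (auto intro!: sum_nonneg)
    have b: "\<bar>\<Sum>i<n. (u i) * (\<integral>y. f y \<partial>K i)\<bar> \<le> m * w x" if "\<And>i. i < n \<Longrightarrow> \<bar>u i\<bar> \<le> b * w x" for u x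
    proof -
      have "\<bar>\<Sum>i<n. (u i) * (\<integral>y. f y \<partial>K i)\<bar> \<le> (\<Sum>i<n. \<bar>u i * (\<integral>y. f y \<partial>K i)\<bar>)" by (rule sum_abs)
      also have "\<dots> \<le> (\<Sum>i<n. (b * w x) * \<bar>\<integral>y. f y \<partial>K i\<bar>)"
        unfolding abs_mult by (intro sum_mono mult_right_mono that) auto
      also have "\<dots> = m * w x" by (simp add: m_def sum_distrib_left sum_distrib_right mult_ac)
      finally show ?thesis .
    qed
    have "\<bar>T f x\<bar> \<le> m * w x" for x unfolding T_def by (rule b[OF \<sigma>(3)])
    moreover have "\<bar>(\<Sum>i<n. (\<integral>y. f y \<partial>K i) *\<^sub>R \<Sigma> i x) $ k\<bar> \<le> m * w x" for x k
      using b[of "\<lambda>i. \<Sigma> i x $ k" x] \<sigma>(4) by (simp add: mult.commute)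
    ultimately show ?thesis using C m0 unfolding mem_L_inf1_iff[OF w] by blast
  qed
  have Kint: "integrable (K i) f" if "f \<in> Lk w k" "i < n" for f i
    by (rule measure_in_M1(2)[OF K(1)[OF that(2)] K(2)[OF that(2)] w K(3)[OF that(2)]])
      (use Lk_subset_L_inf0[OF that(1)] in \<open>simp add: L_inf0_def\<close>)
  have sm: "sm_integral (measure (K i)) f = (\<integral>y. f y \<partial>K i)" if "f \<in> Lk w k" "i < n" for f i
    by (rule measure_in_M1(3)[OF K(1)[OF that(2)] K(2)[OF that(2)] w K(3)[OF that(2)]])
      (use Lk_subset_L_inf0[OF that(1)] in \<open>simp add: L_inf0_def L_inf_def\<close>)
  have "linear_operator w k T"
    unfolding linear_operator_def
  proof (intro conjI ballI allI)
    show "T f \<in> Lk w k" for f by (rule L_inf1_subset_Lk[OF TL])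
    fix f g c d assume f: "f \<in> Lk w k" and g: "g \<in> Lk w k"
    show "T (\<lambda>x. c * f x + d * g x) = (\<lambda>x. c * T f x + d * T g x)"
    proof
      fix x
      have "T (\<lambda>x. c * f x + d * g x) x = (\<Sum>i<n. c * (\<sigma> i x * (\<integral>y. f y \<partial>K i)) + d * (\<sigma> i x * (\<integral>y. g y \<partial>K i)))"
        unfolding T_def by (rule sum.cong) (use Kint[OF f] Kint[OF g] in \<open>auto simp: algebra_simps\<close>)
      then show "T (\<lambda>x. c * f x + d * g x) x = c * T f x + d * T g x"
        by (simp add: T_def sum.distrib sum_distrib_left)
    qed
  qed
  moreover have "\<exists>(n::nat) (m :: nat \<Rightarrow> nat \<Rightarrow> real) s \<nu>.
        (\<forall>i<n. s i \<in> Lk w k) \<and> (\<forall>j<n. \<nu> j \<in> M1 w) \<and>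
        (\<forall>f\<in>Lk w k. \<forall>x. T f x = (\<Sum>i<n. \<Sum>j<n. m i j * (s i x * sm_integral (\<nu> j) f)))"
  proof (intro exI conjI allI impI ballI)
    show "\<sigma> i \<in> Lk w k" if "i < n" for i by (rule L_inf1_subset_Lk[OF \<sigma>L[OF that]])
    show "measure (K j) \<in> M1 w" if "j < n" for j 
      by (rule measure_in_M1(1)[OF K(1)[OF that] K(2)[OF that] w K(3)[OF that]])
    fix f x assume f: "f \<in> Lk w k"
    \<comment> \<open>The coefficient matrix is the identity: each function is paired with its own
      measure only.\<close>
    have "(\<Sum>j<n. (if i = j then 1 else 0) * (\<sigma> i x * sm_integral (measure (K j)) f)) = \<sigma> i x * (\<integral>y. f y \<partial>K i)"
      if "i < n" for i
    proof -
      have "(\<Sum>j<n. (if i = j then 1 else 0) * (\<sigma> i x * sm_integral (measure (K j)) f))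
        = (\<Sum>j<n. if i = j then \<sigma> i x * sm_integral (measure (K j)) f else 0)" by (rule sum.cong) auto
      then show ?thesis using that sm[OF f that] by simp
    qed
    then show "T f x = (\<Sum>i<n. \<Sum>j<n. (if i = j then 1 else 0) * (\<sigma> i x * sm_integral (measure (K j)) f))"
      unfolding T_def by (intro sum.cong) auto
  qed
  ultimately show ?thesis unfolding finite_rank_def T_def[abs_def] by blast
qed

lemma (in smooth_dv3_chain) separable:
  assumes \<eta>: "0 < \<eta>" "\<eta> \<le> 1" and t: "t \<ge> 2 * t0 + 1" and k: "k \<in> {0, 1}"
  shows "separable_op (\<lambda>x. exp (\<eta> * V x)) k (P t)"
proof -
  define w where "w = (\<lambda>x. exp (\<eta> * V x))"
  have w: "w x > 0" for x by (simp add: w_def)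
  have maps: "P_maps M a N t w k"
    unfolding w_def by (rule mapping_properties(1)[OF \<eta> _ _ k]) (use t in auto)
  have "linear_operator w k (P t)"
    unfolding linear_operator_def
  proof (intro conjI ballI allI)
    show "P t f \<in> Lk w k" if "f \<in> Lk w k" for f using maps that by (simp add: P_maps_def)
    fix f g c d assume "f \<in> Lk w k" "g \<in> Lk w k"
    then have "integrable (kernel M a N t x) f" "integrable (kernel M a N t x) g" for x
      using maps by (auto simp: P_maps_def)
    then show "P t (\<lambda>x. c * f x + d * g x) = (\<lambda>x. c * P t f x + d * P t g x)"
      by (simp add: P_op_def fun_eq_iff)
  qed
  moreover have "\<exists>T. finite_rank w k T \<and> opnorm w k (\<lambda>f x. P t f x - T f x) \<le> ennreal \<epsilon>" if \<epsilon>: "\<epsilon> > 0" for \<epsilon>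
  proof -
    obtain n :: nat and \<sigma> \<Sigma> b and K :: "nat \<Rightarrow> (real^'l) measure" where
      \<sigma>: "\<And>i. i < n \<Longrightarrow> C1 (\<sigma> i) (\<Sigma> i)" "0 \<le> b" "\<And>i x. i < n \<Longrightarrow> \<bar>\<sigma> i x\<bar> \<le> b * w x"
        "\<And>i x k. i < n \<Longrightarrow> \<bar>\<Sigma> i x $ k\<bar> \<le> b * w x" and
      K: "\<And>i. i < n \<Longrightarrow> finite_measure (K i)" "\<And>i. i < n \<Longrightarrow> sets (K i) = sets borel"
        "\<And>i. i < n \<Longrightarrow> integrable (K i) w" and
      0: "\<forall>f c. continuous_on UNIV f \<longrightarrow> 0 \<le> c \<longrightarrow> (\<forall>x. \<bar>f x\<bar> \<le> c * w x) \<longrightarrow>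
        (\<forall>x. \<bar>P t f x - (\<Sum>i<n. \<sigma> i x * (\<integral>y. f y \<partial>K i))\<bar> \<le> \<epsilon> * c * w x)" and
      1: "\<forall>f G c. C1 f G \<longrightarrow> 0 \<le> c \<longrightarrow> (\<forall>x. \<bar>f x\<bar> \<le> c * w x) \<longrightarrow> (\<forall>x k. \<bar>G x $ k\<bar> \<le> c * w x) \<longrightarrow>
        (\<exists>H. C1 (\<lambda>x. P t f x - (\<Sum>i<n. \<sigma> i x * (\<integral>y. f y \<partial>K i))) H \<and> (\<forall>x k. \<bar>H x $ k\<bar> \<le> \<epsilon> * c * w x))"
      by (rule finite_rank_approximation[OF \<eta> t \<epsilon> w_def]) (rule that)
    have "finite_rank w k (\<lambda>f x. \<Sum>i<n. \<sigma> i x * (\<integral>y. f y \<partial>K i))"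
      by (rule finite_rank_measures[OF w \<sigma> K])
    moreover have "opnorm w k (\<lambda>f x. P t f x - (\<Sum>i<n. \<sigma> i x * (\<integral>y. f y \<partial>K i))) \<le> ennreal \<epsilon>"
      by (rule opnorm_leI[OF w _ k 0[rule_format] 1[rule_format]]) (use \<epsilon> in auto)
    ultimately show ?thesis by blast
  qed
  ultimately have "separable_op w k (P t)" by (simp add: separable_op_def)
  then show ?thesis by (simp add: w_def)
qed

theorem theorem3p10:
  fixes M :: "'w measure"
    and a :: "real^'l \<Rightarrow> real^'m \<Rightarrow> real^'l"
    and N :: "nat \<Rightarrow> 'w \<Rightarrow> real^'m"
    and V W :: "real^'l \<Rightarrow> real" and C :: "(real^'l) set" and \<delta> b :: real
  assumes "prob_space M"
    and "iid_noise M N"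
    and "continuous_on UNIV (\<lambda>(x, n). a x n)"
    and A1: "smooth_dynamics a"
    and A2: "smooth_density M a N"
    and A3: "reachable_state M a N"
    and A4: "lyapunov M a N V W C \<delta> b"
  shows "\<exists>t1\<ge>1.
    (\<forall>t\<ge>t1. \<forall>\<eta>\<in>{0<..1}. let w = (\<lambda>x. exp (V x) powr \<eta>) in
       (\<forall>k\<in>{0,1}. P_maps M a N t w k) \<and>
       (\<forall>i j. Q_maps M a N t w i j) \<and>
       grad_P_eq_Q_grad M a N t w \<and>
       (\<forall>k\<in>{0,1}. separable_op w k (P_op M a N t))) \<and>
    (\<forall>t\<ge>1. \<forall>\<eta>\<in>{0<..<1}. let w = (\<lambda>x. exp (V x) powr \<eta>) in
       (\<forall>k\<in>{0,1}. P_maps M a N t w k) \<and>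
       (\<forall>i j. Q_maps M a N t w i j) \<and>
       grad_P_eq_Q_grad M a N t w)"
proof -
  obtain a' :: "real^'m \<Rightarrow> real^'l \<Rightarrow> ((real^'l) \<Rightarrow>\<^sub>L (real^'l))" and L where
    a': "\<And>n x. ((\<lambda>x. a x n) has_derivative blinfun_apply (a' n x)) (at x)"
    "\<And>n. continuous_on UNIV (a' n)" "\<And>n x. norm (a' n x) \<le> L"
    using smooth_dynamics_derivative[OF A1] by blast
  interpret prob_space M by fact
  interpret noisy_chain M a N a' L
    by unfold_locales (use assms(2,3) a' in auto)
  from A4 have V: "\<And>x. V x > 0" and W: "\<And>x. W x \<ge> 1"
    and CV: "continuously_differentiable V" "continuously_differentiable W"
    and sub: "\<And>r. r \<ge> 0 \<Longrightarrow> compact {x. V x \<le> r}" "\<And>r. r \<ge> 0 \<Longrightarrow> compact {x. W x \<le> r}"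
    and \<delta>: "\<delta> > 0" and dr: "drift_DV3 M a N V W C \<delta> b"
    by (auto simp: lyapunov_def)
  have cd_cont: "continuous_on UNIV f" if "continuously_differentiable f" for f :: "'x::real_normed_vector \<Rightarrow> 'y::real_normed_vector"
    using that unfolding continuously_differentiable_def
    by (meson differentiable_def differentiable_imp_continuous_on differentiable_on_def has_derivative_at_withinI)
  have cV: "continuous_on UNIV V" "continuous_on UNIV W" using CV cd_cont by auto
  have [measurable]: "V \<in> borel_measurable borel" by (rule borel_measurable_continuous_onI[OF cV(1)])
  \<comment> \<open>A nonnegative constant makes the growth factors monotone in time and absorbs
    both values of the indicator.\<close>
  define B where "B = max b 0"
  have drift: "(\<integral>\<^sup>+\<omega>. ennreal (exp (V (X x 1 \<omega>))) \<partial>M) \<le> ennreal (exp (V x + B - \<delta> * W x))" for x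
  proof -
    from dr have i: "integrable (kernel M a N 1 x) (\<lambda>y. exp (V y))"
      and le: "ln (P 1 (\<lambda>y. exp (V y)) x) - V x \<le> - \<delta> * W x + b * indicator C x"
      by (auto simp: drift_DV3_def)
    have i': "integrable M (\<lambda>\<omega>. exp (V (X x 1 \<omega>)))"
      using i by (subst (asm) kernel_integrable_iff) auto
    have Pe: "P 1 (\<lambda>y. exp (V y)) x = (\<integral>\<omega>. exp (V (X x 1 \<omega>)) \<partial>M)" by (rule P_eq_expectation) measurable
    \<comment> \<open>Positivity of \<open>V\<close> keeps the expectation at least 1, in particular
      positive, so the logarithm in (DV3) can be undone.\<close>
    have "1 \<le> P 1 (\<lambda>y. exp (V y)) x"
    proof -
      have "(\<integral>\<omega>. 1 \<partial>M) \<le> (\<integral>\<omega>. exp (V (X x 1 \<omega>)) \<partial>M)"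
        by (rule integral_mono) (use i' V less_imp_le in auto)
      then show ?thesis unfolding Pe by (simp add: prob_space)
    qed
    moreover have "b * indicator C x \<le> B" by (auto simp: B_def indicator_def)
    then have "ln (P 1 (\<lambda>y. exp (V y)) x) \<le> V x + B - \<delta> * W x" using le by linarith
    ultimately have "P 1 (\<lambda>y. exp (V y)) x \<le> exp (V x + B - \<delta> * W x)"
      by (metis exp_le_cancel_iff exp_ln less_le_trans zero_less_one)
    moreover have "(\<integral>\<^sup>+\<omega>. ennreal (exp (V (X x 1 \<omega>))) \<partial>M) = ennreal (P 1 (\<lambda>y. exp (V y)) x)"
      unfolding Pe by (rule nn_integral_eq_integral[OF i']) simp
    ultimately show ?thesis by (simp only: ennreal_leI)
  qed
  from A2 obtain t0 and p :: "(real^'l) \<times> (real^'l) \<Rightarrow> real" where t0: "t0 \<ge> 1"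
    and Cp: "continuously_differentiable p"
    and density: "\<And>x A. A \<in> sets borel \<Longrightarrow> set_integrable lborel A (\<lambda>y. p (x, y)) \<and>
           measure (kernel M a N t0 x) A = (LINT y:A|lborel. p (x, y))"
    unfolding smooth_density_def by blast
  from Cp obtain p' where p': "\<And>z. (p has_derivative blinfun_apply (p' z)) (at z)" "continuous_on UNIV p'"
    by (auto simp: continuously_differentiable_def)
  \<comment> \<open>Restricting the derivative of \<open>p\<close> to directions
    \<open>(h, 0)\<close> leaves the gradient in the initial state.\<close>
  define J :: "(real^'l) \<times> (real^'l) \<Rightarrow> real^'l" where "J z = (\<chi> i. blinfun_apply (p' z) (axis i 1, 0))" for z
  have cJ: "continuous_on UNIV J" unfolding J_def by (intro continuous_intros p'(2))
  have dJ: "((\<lambda>x. p (x, y)) has_derivative (\<lambda>h. J (x, y) \<bullet> h)) (at x)" for x y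
  proof -
    have "((\<lambda>x. (x, y)) has_derivative (\<lambda>h. (h, 0))) (at x)" by (auto intro!: derivative_eq_intros)
    from diff_chain_at[OF this p'(1)]
    have d: "((\<lambda>x. p (x, y)) has_derivative (\<lambda>h. blinfun_apply (p' (x, y)) (h, 0))) (at x)" by (simp add: o_def)
    define F where "F h = blinfun_apply (p' (x, y)) (h, 0)" for h
    have lin: "linear F" using has_derivative_linear[OF d] unfolding F_def[abs_def] .
    have "F h = J (x, y) \<bullet> h" for h
    proof -
      have "F h = F (\<Sum>i\<in>UNIV. (h $ i) *\<^sub>R axis i 1)"
        by (subst basis_expansion[of h, symmetric]) (simp add: scalar_mult_eq_scaleR)
      also have "\<dots> = (\<Sum>i\<in>UNIV. (h $ i) *\<^sub>R F (axis i 1))" using lin by (simp add: linear_sum linear_cmul)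
      also have "\<dots> = J (x, y) \<bullet> h" by (simp add: J_def F_def inner_vec_def mult.commute)
      finally show ?thesis .
    qed
    with d show ?thesis by (simp add: F_def)
  qed
  interpret smooth_dv3_chain M a N a' L V W \<delta> B t0 p J
    by unfold_locales (use V W cV sub \<delta> drift t0 cd_cont[OF Cp] density cJ dJ in \<open>auto simp: B_def\<close>)
  have powr: "(\<lambda>x. exp (V x) powr \<eta>) = (\<lambda>x. exp (\<eta> * V x))" for \<eta> by (simp add: powr_def)
  \<comment> \<open>\<open>2 * t0 + 1\<close> is what separability asks for, and it exceeds the
    \<open>t0 + 1\<close> of the mapping properties at \<eta> = 1. At earlier times \<eta> < 1 takes
    over.\<close>
  show ?thesis
    unfolding Let_def powr
    using mapping_properties separable t0
    by (intro exI[of _ "2 * t0 + 1"]) auto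
qed

end
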